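(* Let $d\ge 2$ and let $\Omega_0,\Omega_1\subset\mathbb{R}^d$ be non-empty open convex sets, $\Omega_0\neq\mathbb{R}^d$, with $\operatorname{cl}\Omega_1\subset\Omega_0$, satisfying the strict convexity condition and the cone condition. Let $\Omega=\operatorname{cl}\Omega_0\setminus\Omega_1$ and $\Omega^*=\operatorname{cl}\Omega_0\setminus\operatorname{cl}\Omega_1$. Assume that $\partial\Omega_1$ is $C^2$-smooth. Let $f\colon\partial\Omega_0\to\mathbb{R}$ be locally bounded, lower semi-continuous and bounded from below. Then $$\boldsymbol{B}_{\Omega,f}(x)=\mathfrak{B}_{\Omega,f}(x),\qquad x\in\Omega^*.$$
   Context: Strict convexity condition: the boundaries $\partial\Omega_0$ and $\partial\Omega_1$ contain no (non-degenerate) line segments. Cone condition: any ray lying inside $\Omega_0$ has a translate that lies entirely inside $\Omega_1$. $\partial\Omega_1\in C^2$ means that locally $\partial\Omega_1$ coincides with the graph of a $C^2$-smooth function. Averages: $\langle\varphi\rangle_E=\frac1{|E|}\int_E\varphi$ for measurable $E$ with $0<|E|<\infty$. Fix a (bounded, non-degenerate) interval $I\subset\mathbb{R}$; nothing depends on its choice. Let $$\boldsymbol{A}=\{\varphi\colon I\to\partial\Omega_0\ \text{summable}\;:\;\langle\varphi\rangle_J\notin\Omega_1\ \text{for every subinterval } J\subset I\}.$$ The Bellman function is $$\boldsymbol{B}_{\Omega,f}(x)=\sup\{\langle f(\varphi)\rangle_I\;:\;\varphi\in\boldsymbol{A},\ \langle\varphi\rangle_I=x\},\qquad x\in\Omega$$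 (it may take the value $+\infty$). For $\omega\subset\mathbb{R}^d$, a function $G\colon\omega\to\mathbb{R}\cup\{+\infty\}$ is locally concave if its restriction to every segment contained in $\omega$ is concave. The fixed boundary $\partial_{\mathrm{fixed}}\omega$ is the set of $x\in\omega$ that do not lie in the (relative) interior of any segment contained in $\omega$; for the sets $\Omega$ considered here $\partial_{\mathrm{fixed}}\Omega=\partial\Omega_0$. For $f\colon\partial_{\mathrm{fixed}}\omega\to\mathbb{R}$, $\Lambda_{\omega,f}$ is the class of locally concave $G$ on $\omega$ with $G\ge f$ on $\partial_{\mathrm{fixed}}\omega$, and $\mathfrak{B}_{\omega,f}(x)=\inf\{G(x): G\in\Lambda_{\omega,f}\}$, $x\in\omega$ (the minimal locally concave function). *)

theory Defs
  imports "HOL-Analysis.Analysis"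
begin

definition no_segments :: "'a::euclidean_space set \<Rightarrow> bool" where
  "no_segments S \<longleftrightarrow> (\<forall>a b. a \<noteq> b \<longrightarrow> \<not> closed_segment a b \<subseteq> S)"

definition ray :: "'a::real_vector \<Rightarrow> 'a \<Rightarrow> 'a set" where
  "ray a v = {a + t *\<^sub>R v |t. 0 \<le> t}"

definition cone_condition :: "'a::euclidean_space set \<Rightarrow> 'a set \<Rightarrow> bool" where
  "cone_condition \<Omega>0 \<Omega>1 \<longleftrightarrow>
     (\<forall>a v. v \<noteq> 0 \<longrightarrow> ray a v \<subseteq> \<Omega>0 \<longrightarrow> (\<exists>c. (+) c ` ray a v \<subseteq> \<Omega>1))"

definition C2_on :: "('a::euclidean_space \<Rightarrow> real) \<Rightarrow> 'a set \<Rightarrow> bool" where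
  "C2_on h V \<longleftrightarrow>
     (\<exists>(h' :: 'a \<Rightarrow> 'a \<Rightarrow>\<^sub>L real) (h'' :: 'a \<Rightarrow> 'a \<Rightarrow>\<^sub>L ('a \<Rightarrow>\<^sub>L real)).
        (\<forall>x\<in>V. (h has_derivative blinfun_apply (h' x)) (at x)) \<and>
        (\<forall>x\<in>V. (h' has_derivative blinfun_apply (h'' x)) (at x)) \<and>
        continuous_on V h'')"

text \<open>
  Near each of its points \<open>S\<close> is the graph, in the direction of a unit vector \<open>e\<close>, of a
  \<open>C\<^sup>2\<close> function of \<open>d - 1\<close> variables, i.e. of a function on a relatively open subset
  of the hyperplane orthogonal to \<open>e\<close>. To stay within one type, \<open>h\<close> is defined on an open
  subset \<open>V\<close> of the whole space and only its values on the hyperplane enter. Nothing is lost: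
  a \<open>C\<^sup>2\<close> function on an open subset of the hyperplane extends to a cylinder, constantly
  along \<open>e\<close>.
\<close>

definition C2_hypersurface :: "'a::euclidean_space set \<Rightarrow> bool" where
  "C2_hypersurface S \<longleftrightarrow>
     (\<forall>p\<in>S. \<exists>U V e h. open U \<and> p \<in> U \<and> open V \<and> norm e = 1 \<and> C2_on h V \<and>
        S \<inter> U = {y + h y *\<^sub>R e |y. y \<in> V \<and> y \<bullet> e = 0})"

definition locally_bounded_on :: "'a::topological_space set \<Rightarrow> ('a \<Rightarrow> real) \<Rightarrow> bool" where
  "locally_bounded_on S f \<longleftrightarrow> (\<forall>x\<in>S. \<exists>U. open U \<and> x \<in> U \<and> bounded (f ` (U \<inter> S)))"

definition lsc_on :: "'a::topological_space set \<Rightarrow> ('a \<Rightarrow> real) \<Rightarrow> bool" where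
  "lsc_on S f \<longleftrightarrow> (\<forall>x\<in>S. \<forall>c<f x. eventually (\<lambda>y. c < f y) (at x within S))"

definition nondegenerate_interval :: "real set \<Rightarrow> bool" where
  "nondegenerate_interval J \<longleftrightarrow> is_interval J \<and> bounded J \<and> interior J \<noteq> {}"

definition average :: "real set \<Rightarrow> (real \<Rightarrow> 'a::euclidean_space) \<Rightarrow> 'a" where
  "average E \<phi> = (1 / measure lebesgue E) *\<^sub>R (LINT t|lebesgue_on E. \<phi> t)"

text \<open>
  The average of a scalar function as an extended real. \<open>ennreal\<close> truncates negative reals
  to \<open>0\<close>, so the two integrals are those of the positive and the negative part. For \<open>g\<close>
  bounded from below on a set of finite measure the second one is finite, and the difference is
  the usual Lebesgue integral with values in \<open>(-\<infinity>, \<infinity>]\<close>.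
\<close>

definition ext_average :: "real set \<Rightarrow> (real \<Rightarrow> real) \<Rightarrow> ereal" where
  "ext_average E g =
     (enn2ereal (\<integral>\<^sup>+t. ennreal (g t) \<partial>lebesgue_on E) -
      enn2ereal (\<integral>\<^sup>+t. ennreal (- g t) \<partial>lebesgue_on E)) / ereal (measure lebesgue E)"

definition admissible ::
  "'a::euclidean_space set \<Rightarrow> 'a set \<Rightarrow> real set \<Rightarrow> (real \<Rightarrow> 'a) set" where
  "admissible \<Omega>0 \<Omega>1 I =
     {\<phi>. \<phi> \<in> I \<rightarrow> frontier \<Omega>0 \<and> integrable (lebesgue_on I) \<phi> \<and>
         (\<forall>J. nondegenerate_interval J \<longrightarrow> J \<subseteq> I \<longrightarrow> average J \<phi> \<notin> \<Omega>1)}"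

definition Bellman ::
  "'a::euclidean_space set \<Rightarrow> 'a set \<Rightarrow> real set \<Rightarrow> ('a \<Rightarrow> real) \<Rightarrow> 'a \<Rightarrow> ereal" where
  "Bellman \<Omega>0 \<Omega>1 I f x =
     (SUP \<phi> \<in> {\<phi> \<in> admissible \<Omega>0 \<Omega>1 I. average I \<phi> = x}. ext_average I (\<lambda>t. f (\<phi> t)))"

text \<open>
  The library's \<open>concave_on\<close> is for real-valued functions only. Below, \<open>G\<close> never takes the
  value \<open>-\<infinity>\<close> on the set in question, so the right-hand side is never
  \<open>\<infinity> - \<infinity>\<close>; at the end points, \<open>0 * \<infinity> = 0\<close> in type \<open>ereal\<close>.
\<close>

definition ext_concave_on :: "'a::real_vector set \<Rightarrow> ('a \<Rightarrow> ereal) \<Rightarrow> bool" where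
  "ext_concave_on S G \<longleftrightarrow>
     (\<forall>x\<in>S. \<forall>y\<in>S. \<forall>u\<ge>0. \<forall>v\<ge>0. u + v = 1 \<longrightarrow>
        G (u *\<^sub>R x + v *\<^sub>R y) \<ge> ereal u * G x + ereal v * G y)"

definition locally_concave_on :: "'a::euclidean_space set \<Rightarrow> ('a \<Rightarrow> ereal) \<Rightarrow> bool" where
  "locally_concave_on \<omega> G \<longleftrightarrow>
     (\<forall>x\<in>\<omega>. G x \<noteq> -\<infinity>) \<and>
     (\<forall>a b. closed_segment a b \<subseteq> \<omega> \<longrightarrow> ext_concave_on (closed_segment a b) G)"

definition fixed_boundary :: "'a::euclidean_space set \<Rightarrow> 'a set" where
  "fixed_boundary \<omega> =
     {x \<in> \<omega>. \<not> (\<exists>a b. closed_segment a b \<subseteq> \<omega> \<and> x \<in> open_segment a b)}"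

definition loc_concave_majorants ::
  "'a::euclidean_space set \<Rightarrow> ('a \<Rightarrow> real) \<Rightarrow> ('a \<Rightarrow> ereal) set" where
  "loc_concave_majorants \<omega> f =
     {G. locally_concave_on \<omega> G \<and> (\<forall>x\<in>fixed_boundary \<omega>. G x \<ge> ereal (f x))}"

definition min_locally_concave ::
  "'a::euclidean_space set \<Rightarrow> ('a \<Rightarrow> real) \<Rightarrow> 'a \<Rightarrow> ereal" where
  "min_locally_concave \<omega> f x = (INF G \<in> loc_concave_majorants \<omega> f. G x)"

end

theory Submission
  imports Defs
begin

text \<open>The minimal locally concave function is the supremum of the expected final values of \<open>f\<close> over
  finite martingales that move along segments in the annulus and stop on the outer boundary. A small
  dilation with centre in \<open>\<Omega>1\<close> pushes such a martingale away from \<open>\<Omega>1\<close>, and then it is realized up to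
  \<open>\<epsilon>\<close> by an admissible step function: every point near the martingale lies on a chord missing \<open>\<Omega>1\<close>
  that depends continuously enough on the point (the cone condition keeps these chords bounded), and
  the step function alternates slowly between the step functions of these chords.

  Conversely, let \<open>G\<close> be a locally concave majorant and \<open>\<phi>\<close> an admissible function. An interval can be
  split in two such that the segment between the dilated means misses \<open>\<Omega>1\<close>, so concavity of \<open>G\<close> on
  the part of that segment inside \<open>\<Omega>0\<close> propagates the inequality for the mean of \<open>f \<circ> \<phi>\<close> from short
  intervals to long ones. The loss at the points where the segment leaves \<open>\<Omega>0\<close> is controlled by strict
  convexity, first for Lipschitz minorants of \<open>f\<close>.\<close>

section \<open>Convex geometry of the annulus\<close>

text \<open>A locally concave majorant may be discontinuous or infinite. Its concavity can be used
  only along actual segments in the annulus, finitely often; every passage to a limit has to take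
  place in lengths, means or values of \<open>f\<close>. Dilations provide the necessary room: a
  point outside \<open>\<Omega>1\<close> is moved to a distance at least
  \<open>\<delta> * \<rho>\<close> from \<open>\<Omega>1\<close>, where \<open>\<rho>\<close> is the
  radius of a ball in \<open>\<Omega>1\<close> about the centre, and segments go to segments. The
  price is that a dilated martingale or mean belongs to a point near \<open>x\<close> instead of
  \<open>x\<close>. Both inequalities pay it in the same way: \<open>x\<close> lies between its
  dilation and a fixed point \<open>z\<close> on the side of the centre, and the weight of
  \<open>z\<close> tends to \<open>0\<close> with \<open>\<delta>\<close>. This takes place in a
  ball about \<open>x\<close> that misses \<open>closure \<Omega>1\<close>. On the outer boundary
  there is no such ball in \<open>\<Omega>0\<close>; there strict convexity forces martingales and
  admissible functions with mean \<open>x\<close> to be constant, the latter almost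
  everywhere.\<close>

lemma frontier_supporting_hyperplane:
  fixes S :: "'a::euclidean_space set"
  assumes "open S" "convex S" "p \<in> frontier S"
  obtains w where "norm w = 1" "\<And>y. y \<in> closure S \<Longrightarrow> 0 \<le> w \<bullet> (y - p)"
proof -
  have p: "p \<in> closure S" "p \<notin> rel_interior S"
    using assms rel_interior_subset interior_open by (auto simp: frontier_def)
  obtain a where a: "a \<noteq> 0" "\<And>y. y \<in> closure S \<Longrightarrow> a \<bullet> p \<le> a \<bullet> y"
    using supporting_hyperplane_relative_frontier[OF \<open>convex S\<close> p] by metis
  show ?thesis
  proof (rule that[of "a /\<^sub>R norm a"])
    show "norm (a /\<^sub>R norm a) = 1" using a by simp
    show "0 \<le> (a /\<^sub>R norm a) \<bullet> (y - p)" if "y \<in> closure S" for y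
      using a by (simp add: inner_diff_right divide_right_mono a(2)[OF that] mult_left_mono)
  qed
qed

text \<open>With each of its points an open set contains a small step in direction
  \<open>- w\<close>, and there the functional would be negative.\<close>

lemma hyperplane_point_in_frontier:
  fixes S :: "'a::euclidean_space set"
  assumes "open S" "w \<noteq> 0" and ge: "\<And>y. y \<in> S \<Longrightarrow> 0 \<le> w \<bullet> (y - p)"
    and "y \<in> closure S" "w \<bullet> (y - p) \<le> 0"
  shows "y \<in> frontier S"
proof -
  have "y \<notin> S"
  proof
    assume "y \<in> S"
    then obtain e where e: "e > 0" "ball y e \<subseteq> S" using \<open>open S\<close> open_contains_ball by blast
    define z where "z = y - (e / (2 * norm w)) *\<^sub>R w"
    have "z \<in> ball y e" using e \<open>w \<noteq> 0\<close> by (simp add: z_def dist_norm)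
    then have "0 \<le> w \<bullet> (z - p)" using e ge by blast
    moreover have "w \<bullet> (z - p) = w \<bullet> (y - p) - (e / (2 * norm w)) * (w \<bullet> w)"
      by (simp add: z_def inner_diff_right)
    moreover have "(e / (2 * norm w)) * (w \<bullet> w) > 0" using e \<open>w \<noteq> 0\<close> by simp
    ultimately show False using assms by linarith
  qed
  then show ?thesis using assms by (simp add: frontier_def interior_open)
qed

text \<open>The main form in which strict convexity is used: two contact points with a supporting
  hyperplane would span a segment in the frontier.\<close>

lemma strictly_supported_point_unique:
  fixes S :: "'a::euclidean_space set"
  assumes "open S" "convex S" "no_segments (frontier S)" "w \<noteq> 0"
    and ge: "\<And>y. y \<in> S \<Longrightarrow> 0 \<le> w \<bullet> (y - p)"
    and p: "p \<in> closure S" and y: "y \<in> closure S" "w \<bullet> (y - p) \<le> 0"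
  shows "y = p"
proof (rule ccontr)
  assume "y \<noteq> p"
  have "z \<in> frontier S" if z: "z \<in> closed_segment p y" for z
  proof -
    have "z \<in> closure S"
      using z p y \<open>convex S\<close> by (meson closed_segment_subset convex_closure subsetD)
    moreover have "w \<bullet> (z - p) \<le> 0"
    proof -
      obtain u where u: "0 \<le> u" "z = (1-u) *\<^sub>R p + u *\<^sub>R y" using z by (auto simp: in_segment)
      have "z - p = u *\<^sub>R (y - p)" by (simp add: u algebra_simps)
      then show ?thesis using u(1) y(2) by (simp add: mult_le_0_iff)
    qed
    ultimately show ?thesis
      using hyperplane_point_in_frontier[OF \<open>open S\<close> \<open>w \<noteq> 0\<close> ge] by blast
  qed
  then have "closed_segment p y \<subseteq> frontier S" by blast
  then show False using \<open>no_segments (frontier S)\<close> \<open>y \<noteq> p\<close> by (metis no_segments_def)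
qed

text \<open>The supporting functional at a frontier point \<open>x\<close> is nonnegative at both
  ends and averages to \<open>0\<close>, so \<open>b\<close> would be a second contact
  point.\<close>

lemma open_segment_in_strictly_convex:
  fixes S :: "'a::euclidean_space set"
  assumes "open S" "convex S" "no_segments (frontier S)"
    and a: "a \<in> closure S" and b: "b \<in> closure S" and x: "x \<in> open_segment a b"
  shows "x \<in> S"
proof (rule ccontr)
  assume "x \<notin> S"
  have "x \<in> closure S"
    using x a b \<open>convex S\<close> by (meson closed_segment_subset convex_closure open_closed_segment subsetD)
  then have xf: "x \<in> frontier S" using \<open>x \<notin> S\<close> \<open>open S\<close> by (simp add: frontier_def interior_open)
  obtain w where w: "norm w = 1" "\<And>y. y \<in> closure S \<Longrightarrow> 0 \<le> w \<bullet> (y - x)"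
    using frontier_supporting_hyperplane[OF assms(1,2) xf] by blast
  obtain u where u: "0 < u" "u < 1" "x = (1-u) *\<^sub>R a + u *\<^sub>R b" "a \<noteq> b"
    using x by (auto simp: in_segment)
  have "(1-u) * (w \<bullet> (a - x)) + u * (w \<bullet> (b - x)) = 0"
  proof -
    have "(1-u) *\<^sub>R (a - x) + u *\<^sub>R (b - x) = 0" by (subst (1 2) u(3)) (simp add: algebra_simps)
    from arg_cong[OF this, of "\<lambda>z. w \<bullet> z"] show ?thesis by (simp add: inner_add_right)
  qed
  moreover have "0 \<le> (1-u) * (w \<bullet> (a - x))" "0 \<le> u * (w \<bullet> (b - x))"
    using u w(2)[OF a] w(2)[OF b] by auto
  ultimately have "u * (w \<bullet> (b - x)) = 0" by linarith
  then have "w \<bullet> (b - x) \<le> 0" using u by simp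
  then have "b = x"
    using strictly_supported_point_unique[OF assms(1-3), of w x b] w \<open>x \<in> closure S\<close> b
    by (metis closure_subset norm_zero subsetD zero_neq_one)
  then show False using x by (simp add: open_segment_def)
qed

lemma segment_to_outside_meets_frontier:
  fixes S :: "'a::euclidean_space set"
  assumes "a \<in> S" "b \<notin> S"
  obtains z where "z \<in> closed_segment a b" "z \<in> frontier S"
proof -
  have "closed_segment a b \<inter> frontier S \<noteq> {}"
    by (rule connected_Int_frontier) (use assms in auto)
  then show ?thesis using that by blast
qed

text \<open>Moving from \<open>a\<close> by the fraction \<open>t / r k\<close> towards
  \<open>y k\<close> leads to \<open>a + t *\<^sub>R v\<close> in the limit.\<close>

lemma recession_ray:
  fixes S :: "'a::euclidean_space set"
  assumes "open S" "convex S" "a \<in> S" and y: "\<And>k. y k \<in> closure S"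
    and lim: "(\<lambda>k. inverse (r k) *\<^sub>R y k) \<longlonglongrightarrow> v" and r: "filterlim r at_top sequentially"
  shows "ray a v \<subseteq> S"
proof -
  have cl: "a + t *\<^sub>R v \<in> closure S" if "0 \<le> t" for t
  proof (rule Lim_in_closed_set[OF closed_closure _ sequentially_bot])
    have i0: "(\<lambda>k. inverse (r k)) \<longlonglongrightarrow> 0"
      using r filterlim_compose tendsto_inverse_0_at_top by blast
    show "(\<lambda>k. (1 - t * inverse (r k)) *\<^sub>R a + (t * inverse (r k)) *\<^sub>R y k) \<longlonglongrightarrow> a + t *\<^sub>R v"
    proof -
      have "(\<lambda>k. (1 - t * inverse (r k)) *\<^sub>R a + t *\<^sub>R (inverse (r k) *\<^sub>R y k)) \<longlonglongrightarrow> (1 - t * 0) *\<^sub>R a + t *\<^sub>R v"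
        by (intro tendsto_intros i0 lim)
      then show ?thesis by simp
    qed
    have "\<forall>\<^sub>F k in sequentially. r k \<ge> max 1 t"
      using r unfolding filterlim_at_top by blast
    then show "\<forall>\<^sub>F k in sequentially. (1 - t * inverse (r k)) *\<^sub>R a + (t * inverse (r k)) *\<^sub>R y k \<in> closure S"
    proof eventually_elim
      case (elim k)
      then have "0 \<le> t * inverse (r k)" "t * inverse (r k) \<le> 1" using that by (auto simp: field_simps)
      then show ?case
        using convexD_alt[OF convex_closure[OF \<open>convex S\<close>], of a "y k" "t * inverse (r k)"] y \<open>a \<in> S\<close> closure_subset
        by blast
    qed
  qed
  \<comment> \<open>The point is the midpoint of \<open>a\<close>, which is interior, and of a point
    of the closure at twice the distance.\<close>
  have "a + t *\<^sub>R v \<in> S" if "0 \<le> t" for t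
  proof -
    have e: "a + (2 * t) *\<^sub>R v - (1/2) *\<^sub>R (a + (2 * t) *\<^sub>R v - a) = a + t *\<^sub>R v"
      by (simp add: algebra_simps flip: scaleR_add_left)
    have "a + (2 * t) *\<^sub>R v - (1/2) *\<^sub>R (a + (2 * t) *\<^sub>R v - a) \<in> interior S"
      by (rule mem_interior_closure_convex_shrink) (use assms cl[of "2*t"] that in \<open>auto simp: interior_open\<close>)
    then have "a + t *\<^sub>R v \<in> interior S" unfolding e .
    then show ?thesis using \<open>open S\<close> by (simp add: interior_open)
  qed
  then show ?thesis by (auto simp: ray_def)
qed

text \<open>Convex combinations of \<open>p\<close> with more and more distant points of the given
  ray, at weights tending to \<open>0\<close>, converge to the translated ray.\<close>

lemma recession_ray_translate:
  fixes S :: "'a::euclidean_space set"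
  assumes "open S" "convex S" "ray a v \<subseteq> S" "p \<in> closure S" "0 \<le> t"
  shows "p + t *\<^sub>R v \<in> closure S"
proof (rule Lim_in_closed_set[OF closed_closure _ sequentially_bot])
  have i0: "(\<lambda>k. inverse (real (Suc k))) \<longlonglongrightarrow> 0" by (rule LIMSEQ_inverse_real_of_nat)
  have "(\<lambda>k. (1 - inverse (real (Suc k))) *\<^sub>R p + inverse (real (Suc k)) *\<^sub>R a + t *\<^sub>R v)
     \<longlonglongrightarrow> (1 - 0) *\<^sub>R p + 0 *\<^sub>R a + t *\<^sub>R v" by (intro tendsto_intros i0)
  then show "(\<lambda>k. (1 - inverse (real (Suc k))) *\<^sub>R p + inverse (real (Suc k)) *\<^sub>R a + t *\<^sub>R v)
     \<longlonglongrightarrow> p + t *\<^sub>R v" by simp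
  have "(1 - inverse (real (Suc k))) *\<^sub>R p + inverse (real (Suc k)) *\<^sub>R a + t *\<^sub>R v \<in> closure S" for k
  proof -
    have "a + (t * real (Suc k)) *\<^sub>R v \<in> S" using assms by (force simp: ray_def)
    then have "(1 - inverse (real (Suc k))) *\<^sub>R p + inverse (real (Suc k)) *\<^sub>R (a + (t * real (Suc k)) *\<^sub>R v) \<in> closure S"
    proof (intro convexD_alt[OF convex_closure[OF \<open>convex S\<close>]] assms(4))
      show "inverse (real (Suc k)) \<le> 1" by (simp add: field_simps)
    qed (use closure_subset in auto)
    moreover have "inverse (real (Suc k)) *\<^sub>R (a + (t * real (Suc k)) *\<^sub>R v) = inverse (real (Suc k)) *\<^sub>R a + t *\<^sub>R v"
      by (simp add: scaleR_add_right del: of_nat_Suc)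
    ultimately show ?thesis by (simp add: add.assoc)
  qed
  then show "\<forall>\<^sub>F k in sequentially. (1 - inverse (real (Suc k))) *\<^sub>R p + inverse (real (Suc k)) *\<^sub>R a + t *\<^sub>R v \<in> closure S"
    by simp
qed

locale convex_annulus =
  fixes \<Omega>0 \<Omega>1 :: "'a::euclidean_space set"
  assumes dim: "2 \<le> DIM('a)"
    and open0: "open \<Omega>0" and convex0: "convex \<Omega>0" and proper0: "\<Omega>0 \<noteq> UNIV"
    and ne1: "\<Omega>1 \<noteq> {}" and open1: "open \<Omega>1" and convex1: "convex \<Omega>1"
    and cl1_sub: "closure \<Omega>1 \<subseteq> \<Omega>0"
    and strict0: "no_segments (frontier \<Omega>0)" and strict1: "no_segments (frontier \<Omega>1)"
    and cone: "cone_condition \<Omega>0 \<Omega>1"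
begin

lemma sub10: "\<Omega>1 \<subseteq> \<Omega>0" using cl1_sub closure_subset by blast

lemma frontier0_iff: "y \<in> frontier \<Omega>0 \<longleftrightarrow> y \<in> closure \<Omega>0 \<and> y \<notin> \<Omega>0"
  using open0 by (simp add: frontier_def interior_open)

lemma frontier0_nonempty: "frontier \<Omega>0 \<noteq> {}"
proof -
  have "\<Omega>0 \<noteq> {}" using ne1 sub10 by auto
  then show ?thesis using frontier_eq_empty[of \<Omega>0] proper0 by simp
qed

text \<open>Otherwise \<open>p + v\<close> would be a second contact point with the hyperplane at
  \<open>p\<close>. One such \<open>w\<close> is positive on all recession directions at once, which
  makes it a suitable tilt in \<open>separating_normals\<close>.\<close>

lemma recession_direction_positive:
  assumes "ray a v \<subseteq> \<Omega>0" "v \<noteq> 0" and w: "norm w = 1" "p \<in> frontier \<Omega>0"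
    and ge: "\<And>y. y \<in> closure \<Omega>0 \<Longrightarrow> 0 \<le> w \<bullet> (y - p)"
  shows "0 < w \<bullet> v"
proof (rule ccontr)
  assume "\<not> 0 < w \<bullet> v"
  have p: "p \<in> closure \<Omega>0" using w by (simp add: frontier_def)
  have "p + 1 *\<^sub>R v \<in> closure \<Omega>0" by (rule recession_ray_translate[OF open0 convex0 assms(1) p]) simp
  then have "p + v = p"
    using strictly_supported_point_unique[OF open0 convex0 strict0, of w p "p + v"] w ge p \<open>\<not> 0 < w \<bullet> v\<close>
    by (metis add_diff_cancel_left' closure_subset norm_zero not_le scaleR_one subsetD zero_neq_one not_less)
  then show False using \<open>v \<noteq> 0\<close> by simp
qed

lemma chord_along:
  assumes x: "x \<in> \<Omega>0" and v: "v \<noteq> 0"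
    and no: "\<not> ray x v \<subseteq> \<Omega>0" "\<not> ray x (- v) \<subseteq> \<Omega>0"
  obtains s t where "0 < s" "0 < t" "x + s *\<^sub>R v \<in> frontier \<Omega>0" "x - t *\<^sub>R v \<in> frontier \<Omega>0"
proof -
  have *: "\<exists>s>0. x + s *\<^sub>R v \<in> frontier \<Omega>0" if "\<not> ray x v \<subseteq> \<Omega>0" for v
  proof -
    obtain t where t: "0 \<le> t" "x + t *\<^sub>R v \<notin> \<Omega>0" using \<open>\<not> ray x v \<subseteq> \<Omega>0\<close> by (auto simp: ray_def)
    obtain z where z: "z \<in> closed_segment x (x + t *\<^sub>R v)" "z \<in> frontier \<Omega>0"
      using segment_to_outside_meets_frontier[OF x t(2)] by blast
    then obtain u where u: "0 \<le> u" "z = (1 - u) *\<^sub>R x + u *\<^sub>R (x + t *\<^sub>R v)" by (auto simp: in_segment)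
    then have z2: "z = x + (u * t) *\<^sub>R v" by (simp add: algebra_simps)
    have "z \<noteq> x" using z x frontier0_iff by blast
    then have "u * t \<noteq> 0" using z2 by auto
    then have "u * t > 0" using u t by (simp add: order_less_le)
    then show ?thesis using z z2 by blast
  qed
  show ?thesis using *[OF no(1)] *[OF no(2)] that by auto
qed

lemma closed_segment_closure0:
  assumes "a \<in> closure \<Omega>0" "b \<in> closure \<Omega>0" shows "closed_segment a b \<subseteq> closure \<Omega>0"
  using assms convex0 by (meson closed_segment_subset convex_closure)

lemma unit_orthogonal_exists:
  obtains v :: 'a where "v \<noteq> 0" "n \<bullet> v = 0"
  using orthogonal_to_vector_exists[OF dim, of n] by (metis orthogonal_def)

section \<open>Bounded chords through points at a positive distance from the inner domain\<close>

definition far :: "real \<Rightarrow> 'a set" where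
  "far r = {y. \<forall>z\<in>\<Omega>1. r \<le> dist y z}"

text \<open>The bound \<open>R\<close> gives compactness. A finite martingale kept at a positive
  distance from \<open>\<Omega>1\<close> stays in one such set, so constants obtained by compactness
  may depend on \<open>R\<close>.\<close>

definition away :: "real \<Rightarrow> real \<Rightarrow> 'a set" where
  "away r R = closure \<Omega>0 \<inter> cball 0 R \<inter> far r"

lemma far_mono: "r' \<le> r \<Longrightarrow> far r \<subseteq> far r'"
  unfolding far_def by force

lemma away_mono: "r' \<le> r \<Longrightarrow> R \<le> R' \<Longrightarrow> away r R \<subseteq> away r' R'"
  using far_mono unfolding away_def by force

lemma compact_away: "compact (away r R)"
proof -
  have "away r R = (closure \<Omega>0 \<inter> cball 0 R) \<inter> (\<Inter>z\<in>\<Omega>1. {y. r \<le> dist y z})"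
    by (auto simp: away_def far_def)
  moreover have "closed (\<Inter>z\<in>\<Omega>1. {y. r \<le> dist y z})"
    by (intro closed_INT ballI closed_Collect_le continuous_intros)
  ultimately show ?thesis
    by (metis closed_Int_compact closed_closure compact_cball compact_Int_closed)
qed

text \<open>\<open>n m\<close> points from \<open>m\<close> to the closest point of \<open>closure \<Omega>1\<close>, tilted slightly towards an inner
  normal of \<open>\<Omega>0\<close>. By the cone condition a recession direction of \<open>\<Omega>0\<close> is one of \<open>\<Omega>1\<close>, so the untilted
  vector is nonnegative on it; strict convexity makes the tilt positive on it.\<close>

lemma separating_normals:
  assumes r: "0 < r"
  obtains n :: "'a \<Rightarrow> 'a" and N \<eta> where
    "\<eta> > 0" "N > 0"
    "\<And>m. m \<in> away r R \<Longrightarrow> norm (n m) \<le> N"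
    "\<And>m m'. dist (n m) (n m') \<le> 2 * dist m m'"
    "\<And>m y. m \<in> away r R \<Longrightarrow> y \<in> \<Omega>1 \<Longrightarrow> \<eta> \<le> n m \<bullet> (y - m)"
    "\<And>m a v. m \<in> away r R \<Longrightarrow> ray a v \<subseteq> \<Omega>0 \<Longrightarrow> v \<noteq> 0 \<Longrightarrow> 0 < n m \<bullet> v"
proof -
  obtain p where p: "p \<in> frontier \<Omega>0" using frontier0_nonempty by blast
  obtain w where w: "norm w = 1" "\<And>y. y \<in> closure \<Omega>0 \<Longrightarrow> 0 \<le> w \<bullet> (y - p)"
    using frontier_supporting_hyperplane[OF open0 convex0 p] by blast
  define L where "L = norm p + \<bar>R\<bar> + 1"
  have L: "L > 0" by (simp add: L_def add_nonneg_pos)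
  \<comment> \<open>\<open>L\<close> bounds \<open>w \<bullet> (p - m)\<close> in modulus, so a tilt
    of this size costs at most half of the gain \<open>r\<^sup>2\<close> of the untilted
    vector.\<close>
  define \<epsilon> where "\<epsilon> = r\<^sup>2 / (2 * L)"
  have \<epsilon>: "\<epsilon> > 0" using r L by (simp add: \<epsilon>_def)
  define cp where "cp = closest_point (closure \<Omega>1)"
  have cl: "convex (closure \<Omega>1)" "closed (closure \<Omega>1)" "closure \<Omega>1 \<noteq> {}"
    using convex1 ne1 by (auto simp: convex_closure)
  define n where "n m = (cp m - m) + \<epsilon> *\<^sub>R w" for m
  define N where "N = norm (cp 0) + 2 * \<bar>R\<bar> + \<epsilon> + 1"
  have lip: "dist (cp m) (cp m') \<le> dist m m'" for m m'
    unfolding cp_def by (rule closest_point_lipschitz[OF cl])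
  have cpin: "cp m \<in> closure \<Omega>1" for m unfolding cp_def by (rule closest_point_in_set[OF cl(2,3)])
  have rle: "r \<le> norm (cp m - m)" if m: "m \<in> away r R" for m
  proof -
    have "closed {z. r \<le> dist m z}" by (intro closed_Collect_le continuous_intros)
    then have "closure \<Omega>1 \<subseteq> {z. r \<le> dist m z}" by (intro closure_minimal) (use m in \<open>auto simp: away_def far_def\<close>)
    then show ?thesis using cpin[of m] by (auto simp: dist_norm norm_minus_commute)
  qed
  have dot: "(norm (cp m - m))\<^sup>2 \<le> (cp m - m) \<bullet> (y - m)" if "y \<in> closure \<Omega>1" for y m
  proof -
    have "(m - cp m) \<bullet> (y - cp m) \<le> 0" unfolding cp_def by (rule closest_point_dot[OF cl(1,2) that])
    then have "0 \<le> (cp m - m) \<bullet> (y - cp m)" by (simp add: inner_diff_left)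
    also have "y - cp m = (y - m) - (cp m - m)" by simp
    finally show ?thesis by (simp add: inner_diff_right power2_norm_eq_inner)
  qed
  show ?thesis
  proof (rule that[of "r\<^sup>2/2" N n])
    show "r\<^sup>2/2 > 0" using r by simp
    show "N > 0" using \<epsilon> by (simp add: N_def add_nonneg_pos)
    show "norm (n m) \<le> N" if m: "m \<in> away r R" for m
    proof -
      have "norm (cp m) \<le> norm (cp 0) + norm m"
        using lip[of m 0] norm_triangle_sub[of "cp m" "cp 0"] by (simp add: dist_norm)
      moreover have "norm m \<le> \<bar>R\<bar>" using m by (auto simp: away_def far_def)
      moreover have "norm (n m) \<le> norm (cp m) + norm m + \<epsilon>"
        unfolding n_def using norm_triangle_ineq[of "cp m - m" "\<epsilon> *\<^sub>R w"] norm_triangle_ineq4[of "cp m" m] w \<epsilon> by simp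
      ultimately show ?thesis by (simp add: N_def)
    qed
    show "dist (n m) (n m') \<le> 2 * dist m m'" for m m'
    proof -
      have "n m - n m' = (cp m - cp m') - (m - m')" by (simp add: n_def)
      then have "norm (n m - n m') \<le> norm (cp m - cp m') + norm (m - m')" by (metis norm_triangle_ineq4)
      then show ?thesis using lip[of m m'] by (simp add: dist_norm)
    qed
    show "r\<^sup>2/2 \<le> n m \<bullet> (y - m)" if m: "m \<in> away r R" and y: "y \<in> \<Omega>1" for m y
    proof -
      have 1: "r\<^sup>2 \<le> (cp m - m) \<bullet> (y - m)"
      proof -
        have "y \<in> closure \<Omega>1" using y closure_subset by blast
        from dot[OF this, of m] show ?thesis
          using power_mono[OF rle[OF m], of 2] r by linarith
      qed
      have "0 \<le> w \<bullet> (y - p)" using w y sub10 closure_subset by blast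
      moreover have "w \<bullet> (p - m) \<ge> - L"
      proof -
        have "\<bar>w \<bullet> (p - m)\<bar> \<le> norm (p - m)" using Cauchy_Schwarz_ineq2[of w "p - m"] w by simp
        also have "\<dots> \<le> norm p + norm m" by (rule norm_triangle_ineq4)
        also have "\<dots> \<le> L" using m by (auto simp: away_def L_def)
        finally show ?thesis by linarith
      qed
      ultimately have "w \<bullet> (y - m) \<ge> - L" by (simp add: inner_diff_right)
      then have "\<epsilon> * (w \<bullet> (y - m)) \<ge> \<epsilon> * (- L)" using \<epsilon> by (intro mult_left_mono) auto
      moreover have "\<epsilon> * L = r\<^sup>2/2" using L by (simp add: \<epsilon>_def)
      ultimately show ?thesis using 1 by (simp add: n_def inner_add_left)
    qed
    show "0 < n m \<bullet> v" if m: "m \<in> away r R" and ray: "ray a v \<subseteq> \<Omega>0" "v \<noteq> 0" for m a v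
    proof -
      have "0 \<le> (cp m - m) \<bullet> v"
      proof (rule ccontr)
        \<comment> \<open>Far out, a translated ray inside \<open>\<Omega>1\<close> would get to the
          wrong side of the closest-point inequality \<open>dot\<close>.\<close>
        assume neg: "\<not> 0 \<le> (cp m - m) \<bullet> v"
        obtain c where c: "(+) c ` ray a v \<subseteq> \<Omega>1" using cone ray unfolding cone_condition_def by meson
        define D where "D = (cp m - m) \<bullet> (c + a - m)"
        have D: "0 \<le> D + t * ((cp m - m) \<bullet> v)" if "0 \<le> t" for t
        proof -
          have "c + (a + t *\<^sub>R v) \<in> closure \<Omega>1" using c that closure_subset by (force simp: ray_def)
          from dot[OF this, of m] have "0 \<le> (cp m - m) \<bullet> (c + (a + t *\<^sub>R v) - m)"
            using zero_le_power2 order_trans by blast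
          also have "c + (a + t *\<^sub>R v) - m = (c + a - m) + t *\<^sub>R v" by simp
          finally show ?thesis by (simp add: D_def inner_add_right)
        qed
        have "0 \<le> D" using D[of 0] by simp
        then have "0 \<le> (D + 1) / (- ((cp m - m) \<bullet> v))" using neg by (intro divide_nonneg_pos) auto
        from D[OF this] show False using neg by (simp add: field_simps)
      qed
      moreover have "0 < w \<bullet> v" by (rule recession_direction_positive[OF ray w(1) p w(2)])
      ultimately show ?thesis using \<epsilon> by (simp add: n_def inner_add_left add_nonneg_pos)
    qed
  qed
qed

text \<open>Points \<open>y k\<close> of slices with norms tending to infinity would, after
  normalization, have a limit that is a recession direction orthogonal to some \<open>n m0\<close>,
  against the strict sign in \<open>pos\<close>. Compactness of \<open>away r R\<close> makes the
  bound uniform in \<open>m\<close>.\<close>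

lemma slices_bounded:
  assumes n: "\<And>m m'. dist (n m) (n m') \<le> 2 * dist m m'"
    and pos: "\<And>m a v. m \<in> away r R \<Longrightarrow> ray a v \<subseteq> \<Omega>0 \<Longrightarrow> v \<noteq> 0 \<Longrightarrow> 0 < n m \<bullet> v"
  obtains B where "\<And>m y. m \<in> away r R \<Longrightarrow> y \<in> closure \<Omega>0 \<Longrightarrow> n m \<bullet> (y - m) = 0 \<Longrightarrow> norm y \<le> B"
proof -
  define P where "P B \<longleftrightarrow> (\<forall>m y. m \<in> away r R \<longrightarrow> y \<in> closure \<Omega>0 \<longrightarrow> n m \<bullet> (y - m) = 0 \<longrightarrow> norm y \<le> B)" for B
  have "\<exists>B. P B"
  proof (rule ccontr)
    assume "\<nexists>B. P B"
    then have "\<not> P (real k + 1)" for k by blast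
    then have "\<forall>k::nat. \<exists>m y. m \<in> away r R \<and> y \<in> closure \<Omega>0 \<and> n m \<bullet> (y - m) = 0 \<and> real k + 1 < norm y"
      unfolding P_def by (simp add: not_le)
    then obtain m y where my: "\<And>k. m k \<in> away r R" "\<And>k. y k \<in> closure \<Omega>0"
        "\<And>k. n (m k) \<bullet> (y k - m k) = 0" "\<And>k. real k + 1 < norm (y k)"
      by metis
    define u where "u k = inverse (norm (y k)) *\<^sub>R y k" for k
    have ypos: "norm (y k) > 0" for k using my(4)[of k] by (smt (verit) of_nat_0_le_iff)
    have "(m k, u k) \<in> away r R \<times> sphere 0 1" for k
      using my(1) ypos[of k] by (auto simp: u_def)
    then have mem: "\<forall>k. (m k, u k) \<in> away r R \<times> sphere 0 1" by blast
    have "seq_compact (away r R \<times> sphere (0::'a) 1)"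
      by (simp add: compact_Times compact_away compact_eq_seq_compact_metric[symmetric])
    then obtain l \<sigma> where l: "l \<in> away r R \<times> sphere (0::'a) 1" "strict_mono (\<sigma> :: nat \<Rightarrow> nat)"
        "((\<lambda>k. (m k, u k)) \<circ> \<sigma>) \<longlonglongrightarrow> l"
      using seq_compactE[OF _ mem] by blast
    obtain m0 v where l0: "l = (m0, v)" by (cases l)
    have m0: "m0 \<in> away r R" and v: "norm v = 1" using l(1) l0 by auto
    have ml: "(\<lambda>k. m (\<sigma> k)) \<longlonglongrightarrow> m0" and ul: "(\<lambda>k. u (\<sigma> k)) \<longlonglongrightarrow> v"
      using tendsto_fst[OF l(3)] tendsto_snd[OF l(3)] l0 by (auto simp: o_def)
    have rt: "filterlim (\<lambda>k. norm (y (\<sigma> k))) at_top sequentially"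
    proof (rule filterlim_at_top_mono[OF filterlim_real_sequentially])
      have "real k \<le> norm (y (\<sigma> k))" for k
        using my(4)[of "\<sigma> k"] seq_suble[OF l(2), of k] by (smt (verit) of_nat_le_iff)
      then show "\<forall>\<^sub>F k in sequentially. real k \<le> norm (y (\<sigma> k))" by simp
    qed
    obtain a where a: "a \<in> \<Omega>0" using ne1 sub10 by blast
    have "ray a v \<subseteq> \<Omega>0"
      by (rule recession_ray[OF open0 convex0 a _ _ rt]) (use my(2) ul in \<open>auto simp: u_def\<close>)
    then have "0 < n m0 \<bullet> v" using pos[OF m0] v by force
    have nl: "(\<lambda>k. n (m (\<sigma> k))) \<longlonglongrightarrow> n m0"
    proof (rule metric_tendsto_imp_tendsto)
      show "(\<lambda>k. 2 *\<^sub>R (m (\<sigma> k) - m0)) \<longlonglongrightarrow> 0"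
        using tendsto_scaleR[OF tendsto_const LIM_zero[OF ml], of 2] by simp
      show "\<forall>\<^sub>F k in sequentially. dist (n (m (\<sigma> k))) (n m0) \<le> dist (2 *\<^sub>R (m (\<sigma> k) - m0)) 0"
        using n by (auto simp: dist_norm)
    qed
    have inv: "(\<lambda>k. inverse (norm (y (\<sigma> k)))) \<longlonglongrightarrow> 0"
      using rt filterlim_compose tendsto_inverse_0_at_top by blast
    have "(\<lambda>k. n (m (\<sigma> k)) \<bullet> u (\<sigma> k)) \<longlonglongrightarrow> n m0 \<bullet> v" by (intro tendsto_intros nl ul)
    moreover have "n (m k) \<bullet> u k = inverse (norm (y k)) * (n (m k) \<bullet> m k)" for k
      using my(3)[of k] by (simp add: u_def inner_diff_right)
    moreover have "(\<lambda>k. inverse (norm (y (\<sigma> k))) * (n (m (\<sigma> k)) \<bullet> m (\<sigma> k))) \<longlonglongrightarrow> 0 * (n m0 \<bullet> m0)"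
      by (intro tendsto_intros inv nl ml)
    ultimately have "n m0 \<bullet> v = 0" using LIMSEQ_unique by force
    then show False using \<open>0 < n m0 \<bullet> v\<close> by simp
  qed
  then show ?thesis using that unfolding P_def by blast
qed

text \<open>The chord of \<open>m\<close> is taken in the hyperplane through \<open>m\<close>
  orthogonal to \<open>n m\<close>. Its direction there is arbitrary and need not depend
  continuously on \<open>m\<close>; what matters is that the hyperplane does and that the ends are
  bounded, for then the chords of two nearby points lie in a common halfspace away from
  \<open>\<Omega>1\<close>.\<close>

lemma default_chords:
  assumes r: "0 < r"
  obtains r1 \<delta> B l and p q :: "'a \<Rightarrow> 'a" where
    "0 < r1" "r1 \<le> r" "0 < \<delta>"
    "\<And>m. m \<in> away r R \<Longrightarrow> 0 < l m \<and> l m < 1 \<and> m = (1 - l m) *\<^sub>R p m + l m *\<^sub>R q m"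
    "\<And>m. m \<in> away r R \<Longrightarrow> p m \<in> frontier \<Omega>0 \<and> q m \<in> frontier \<Omega>0 \<and> norm (p m) \<le> B \<and> norm (q m) \<le> B"
    "\<And>m. m \<in> frontier \<Omega>0 \<Longrightarrow> p m = m \<and> q m = m"
    "\<And>m m'. m \<in> away r R \<Longrightarrow> m' \<in> away r R \<Longrightarrow> dist m m' < \<delta> \<Longrightarrow>
       \<exists>X. convex X \<and> {p m, q m, p m', q m'} \<subseteq> X \<and> X \<subseteq> far r1"
proof -
  obtain n N \<eta> where \<eta>: "\<eta> > 0" and N: "N > 0"
    and nN: "\<And>m. m \<in> away r R \<Longrightarrow> norm (n m) \<le> N"
    and nlip: "\<And>m m'. dist (n m) (n m') \<le> 2 * dist m m'"
    and sep: "\<And>m y. m \<in> away r R \<Longrightarrow> y \<in> \<Omega>1 \<Longrightarrow> \<eta> \<le> n m \<bullet> (y - m)"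
    and pos: "\<And>m a v. m \<in> away r R \<Longrightarrow> ray a v \<subseteq> \<Omega>0 \<Longrightarrow> v \<noteq> 0 \<Longrightarrow> 0 < n m \<bullet> v"
    using separating_normals[OF r] by metis
  obtain B0 where B0: "\<And>m y. m \<in> away r R \<Longrightarrow> y \<in> closure \<Omega>0 \<Longrightarrow> n m \<bullet> (y - m) = 0 \<Longrightarrow> norm y \<le> B0"
  proof (rule slices_bounded[of n r R])
    show "dist (n m) (n m') \<le> 2 * dist m m'" for m m' by (rule nlip)
    show "0 < n m \<bullet> v" if "m \<in> away r R" "ray a v \<subseteq> \<Omega>0" "v \<noteq> 0" for m a v using pos that by blast
  qed blast
  define B where "B = \<bar>B0\<bar> + \<bar>R\<bar>"
  have "\<exists>p q l. m \<in> away r R \<longrightarrow> 0 < l \<and> l < 1 \<and> m = (1 - l) *\<^sub>R p + l *\<^sub>R q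
     \<and> p \<in> frontier \<Omega>0 \<and> q \<in> frontier \<Omega>0 \<and> n m \<bullet> (p - m) = 0 \<and> n m \<bullet> (q - m) = 0 \<and> (m \<in> frontier \<Omega>0 \<longrightarrow> p = m \<and> q = m)" for m
  proof (cases "m \<in> away r R \<and> m \<notin> frontier \<Omega>0")
    case True
    then have m: "m \<in> away r R" "m \<in> \<Omega>0" by (auto simp: away_def frontier0_iff)
    obtain v where v: "v \<noteq> 0" "n m \<bullet> v = 0" using unit_orthogonal_exists by metis
    have "\<not> ray m v \<subseteq> \<Omega>0" "\<not> ray m (-v) \<subseteq> \<Omega>0" using pos[OF m(1), of m v] pos[OF m(1), of m "-v"] v by auto
    then obtain s t where st: "0 < s" "0 < t" "m + s *\<^sub>R v \<in> frontier \<Omega>0" "m - t *\<^sub>R v \<in> frontier \<Omega>0"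
      using chord_along[OF m(2) v(1)] by metis
    have st1: "1 - s / (s + t) = t / (s + t)" using st by (simp add: field_simps)
    have "m = (1 - s/(s+t)) *\<^sub>R (m + s *\<^sub>R v) + (s/(s+t)) *\<^sub>R (m - t *\<^sub>R v)"
    proof -
      have "(1 - s/(s+t)) *\<^sub>R (m + s *\<^sub>R v) + (s/(s+t)) *\<^sub>R (m - t *\<^sub>R v)
         = ((1 - s/(s+t)) + s/(s+t)) *\<^sub>R m + ((1 - s/(s+t)) * s - (s/(s+t)) * t) *\<^sub>R v"
        by (simp add: algebra_simps)
      also have "(1 - s/(s+t)) * s - (s/(s+t)) * t = 0" unfolding st1 by simp
      finally show ?thesis by simp
    qed
    moreover have "0 < s/(s+t)" "s/(s+t) < 1" using st by auto
    ultimately show ?thesis using st v True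
      by (intro exI[of _ "m + s *\<^sub>R v"] exI[of _ "m - t *\<^sub>R v"] exI[of _ "s/(s+t)"]) auto
  next
    \<comment> \<open>On the outer boundary the chord degenerates to the point itself; outside
      \<open>away r R\<close> nothing is demanded.\<close>
    case False
    then show ?thesis
      by (intro exI[of _ m] exI[of _ "1/2"]) (auto simp flip: scaleR_add_left)
  qed
  then obtain p q l where pql: "\<And>m. m \<in> away r R \<Longrightarrow> 0 < l m \<and> l m < 1 \<and> m = (1 - l m) *\<^sub>R p m + l m *\<^sub>R q m
     \<and> p m \<in> frontier \<Omega>0 \<and> q m \<in> frontier \<Omega>0 \<and> n m \<bullet> (p m - m) = 0 \<and> n m \<bullet> (q m - m) = 0 \<and> (m \<in> frontier \<Omega>0 \<longrightarrow> p m = m \<and> q m = m)"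
    by metis
  \<comment> \<open>The chords are to be degenerate at all points of the outer boundary, not only at
    those in \<open>away r R\<close>.\<close>
  define p' where "p' m = (if m \<in> frontier \<Omega>0 then m else p m)" for m
  define q' where "q' m = (if m \<in> frontier \<Omega>0 then m else q m)" for m
  have p'p: "p' m = p m" "q' m = q m" if "m \<in> away r R" for m using pql[OF that] by (auto simp: p'_def q'_def)
  have bd: "norm (p m) \<le> B" "norm (q m) \<le> B" if "m \<in> away r R" for m
    using pql[OF that] B0[OF that] frontier0_iff unfolding B_def by (smt (verit))+
  \<comment> \<open>Chosen so that passing from \<open>m\<close> to \<open>m'\<close> changes the
    functional on the chord by at most half of the gap \<open>\<eta>\<close>.\<close>
  define \<delta> where "\<delta> = \<eta> / (2 * (2 * (B + \<bar>R\<bar>) + N))"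
  have BR: "0 \<le> B" by (simp add: B_def)
  have \<delta>: "\<delta> > 0" using \<eta> N BR by (simp add: \<delta>_def add_nonneg_pos)
  \<comment> \<open>A remaining gap \<open>\<eta> / 2\<close> of a functional of norm at most
    \<open>N\<close> is a distance of at least \<open>\<eta> / (2 * N)\<close>.\<close>
  define r1 where "r1 = min r (\<eta> / (2 * N))"
  have r1: "0 < r1" "r1 \<le> r" "N * r1 \<le> \<eta>/2" using r \<eta> N by (auto simp: r1_def min_def field_simps)
  show ?thesis
  proof (rule that[of r1 \<delta> l p' q' B])
    show "0 < r1" "r1 \<le> r" "0 < \<delta>" by fact+
    show "0 < l m \<and> l m < 1 \<and> m = (1 - l m) *\<^sub>R p' m + l m *\<^sub>R q' m" if "m \<in> away r R" for m
      using pql[OF that] p'p[OF that] by simp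
    show "p' m \<in> frontier \<Omega>0 \<and> q' m \<in> frontier \<Omega>0 \<and> norm (p' m) \<le> B \<and> norm (q' m) \<le> B" if "m \<in> away r R" for m
      using pql[OF that] bd[OF that] p'p[OF that] by simp
    show "p' m = m \<and> q' m = m" if "m \<in> frontier \<Omega>0" for m using that by (simp add: p'_def q'_def)
    fix m m' assume m: "m \<in> away r R" and m': "m' \<in> away r R" and d: "dist m m' < \<delta>"
    define X where "X = {y. n m \<bullet> (y - m) \<le> \<eta>/2}"
    have X2: "X = {y. n m \<bullet> y \<le> \<eta>/2 + n m \<bullet> m}" by (auto simp: X_def inner_diff_right)
    \<comment> \<open>The two hyperplanes differ by the change of the normal, applied to a bounded
      vector, and by the shift of the base point.\<close>
    have close: "y \<in> X" if y: "n m' \<bullet> (y - m') = 0" "norm y \<le> B" for y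
    proof -
      have "n m \<bullet> (y - m) = (n m - n m') \<bullet> (y - m') + n m \<bullet> (m' - m)"
        using y by (simp add: inner_diff_left inner_diff_right)
      also have "\<dots> \<le> norm (n m - n m') * norm (y - m') + norm (n m) * norm (m' - m)"
        by (intro add_mono norm_cauchy_schwarz)
      also have "\<dots> \<le> (2 * dist m m') * (B + \<bar>R\<bar>) + N * dist m m'"
      proof (intro add_mono mult_mono)
        show "norm (n m - n m') \<le> 2 * dist m m'" using nlip[of m m'] by (simp add: dist_norm)
        show "norm (y - m') \<le> B + \<bar>R\<bar>"
          using norm_triangle_ineq4[of y m'] y(2) m' by (auto simp: away_def)
      qed (use nN[OF m] N in \<open>auto simp: dist_norm norm_minus_commute\<close>)
      also have "\<dots> = (2 * (B + \<bar>R\<bar>) + N) * dist m m'" by (simp add: algebra_simps)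
      also have "\<dots> \<le> (2 * (B + \<bar>R\<bar>) + N) * \<delta>" using d BR N by (intro mult_left_mono) auto
      also have "\<dots> = \<eta>/2" using BR N by (simp add: \<delta>_def add_nonneg_pos field_simps)
      finally show ?thesis by (simp add: X_def)
    qed
    show "\<exists>X. convex X \<and> {p' m, q' m, p' m', q' m'} \<subseteq> X \<and> X \<subseteq> far r1"
    proof (intro exI conjI)
      show "convex X" unfolding X2 by (rule convex_halfspace_le)
      show "{p' m, q' m, p' m', q' m'} \<subseteq> X"
        using close pql[OF m'] bd[OF m'] pql[OF m] \<eta> p'p[OF m] p'p[OF m'] by (auto simp: X_def)
      show "X \<subseteq> far r1"
      proof (clarsimp simp: far_def)
        fix y z assume y: "y \<in> X" and z: "z \<in> \<Omega>1"
        have "\<eta>/2 \<le> n m \<bullet> (z - y)" using sep[OF m z] y by (simp add: X_def inner_diff_right)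
        also have "\<dots> \<le> N * dist y z"
          using norm_cauchy_schwarz[of "n m" "z - y"] mult_right_mono[OF nN[OF m] norm_ge_zero, of "z - y"]
          by (simp add: dist_norm norm_minus_commute)
        finally have "N * r1 \<le> N * dist y z" using r1 by linarith
        then show "r1 \<le> dist y z" using N by simp
      qed
    qed
  qed
qed

lemma far_point:
  assumes "x \<notin> closure \<Omega>1" obtains r where "0 < r" "x \<in> far r"
proof -
  have "\<not> (\<forall>e>0. \<exists>y\<in>\<Omega>1. dist y x < e)" using assms unfolding closure_approachable .
  then obtain e where e: "e > 0" "\<not> (\<exists>y\<in>\<Omega>1. dist y x < e)" by blast
  have "x \<in> far e"
    unfolding far_def
  proof (clarify)
    fix z assume "z \<in> \<Omega>1"
    then have "\<not> dist z x < e" using e by blast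
    then show "e \<le> dist x z" by (simp add: dist_commute)
  qed
  then show ?thesis using e that by blast
qed

text \<open>Any direction in a hyperplane through \<open>x\<close> will do, provided that the
  hyperplane misses \<open>\<Omega>1\<close> and contains no recession direction of
  \<open>\<Omega>0\<close>. Off \<open>closure \<Omega>1\<close> a separating normal gives such a
  hyperplane. On the inner boundary it is a supporting one: by the cone condition a recession
  direction \<open>v\<close> in it would yield the second contact point
  \<open>x + v\<close>.\<close>

lemma chord_exists:
  assumes x: "x \<in> \<Omega>0" "x \<notin> \<Omega>1"
  obtains a b where "a \<in> frontier \<Omega>0" "b \<in> frontier \<Omega>0" "x \<in> open_segment a b"
    "closed_segment a b \<subseteq> closure \<Omega>0 - \<Omega>1"
proof -
  have "\<exists>n. (\<forall>y\<in>\<Omega>1. 0 < n \<bullet> (y - x)) \<and> (\<forall>v. v \<noteq> 0 \<longrightarrow> n \<bullet> v = 0 \<longrightarrow> \<not> ray x v \<subseteq> \<Omega>0)"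
  proof (cases "x \<in> closure \<Omega>1")
    case False
    then obtain r where r: "0 < r" "x \<in> far r" using far_point by blast
    then have xa: "x \<in> away r (norm x)" using x closure_subset by (auto simp: away_def)
    obtain n N \<eta> where \<eta>: "\<eta> > 0"
      "\<And>m y. m \<in> away r (norm x) \<Longrightarrow> y \<in> \<Omega>1 \<Longrightarrow> \<eta> \<le> n m \<bullet> (y - m)"
      "\<And>m a v. m \<in> away r (norm x) \<Longrightarrow> ray a v \<subseteq> \<Omega>0 \<Longrightarrow> v \<noteq> 0 \<Longrightarrow> 0 < n m \<bullet> v"
      using separating_normals[OF r(1)] by metis
    then show ?thesis using xa by (metis less_irrefl less_le_trans)
  next
    case True
    then have xf: "x \<in> frontier \<Omega>1" using x open1 by (simp add: frontier_def interior_open)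
    obtain n where n: "norm n = 1" "\<And>y. y \<in> closure \<Omega>1 \<Longrightarrow> 0 \<le> n \<bullet> (y - x)"
      using frontier_supporting_hyperplane[OF open1 convex1 xf] by blast
    have n0: "n \<noteq> 0" using n by auto
    have uniq: "y = x" if "y \<in> closure \<Omega>1" "n \<bullet> (y - x) \<le> 0" for y
      using strictly_supported_point_unique[OF open1 convex1 strict1 n0 _ True that] n closure_subset by blast
    show ?thesis
    proof (intro exI[of _ n] conjI ballI allI impI notI)
      fix y assume "y \<in> \<Omega>1"
      then show "0 < n \<bullet> (y - x)" using uniq[of y] x closure_subset by force
    next
      fix v assume v: "v \<noteq> 0" "n \<bullet> v = 0" "ray x v \<subseteq> \<Omega>0"
      obtain c where c: "(+) c ` ray x v \<subseteq> \<Omega>1" using cone v unfolding cone_condition_def by meson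
      have "ray (c + x) v \<subseteq> \<Omega>1" using c by (force simp: ray_def)
      then have "x + 1 *\<^sub>R v \<in> closure \<Omega>1" by (rule recession_ray_translate[OF open1 convex1]) (use True in auto)
      then show False using uniq[of "x + v"] v by simp
    qed
  qed
  then obtain n where n: "\<And>y. y \<in> \<Omega>1 \<Longrightarrow> 0 < n \<bullet> (y - x)" "\<And>v. v \<noteq> 0 \<Longrightarrow> n \<bullet> v = 0 \<Longrightarrow> \<not> ray x v \<subseteq> \<Omega>0"
    by blast
  obtain v where v: "v \<noteq> 0" "n \<bullet> v = 0" using unit_orthogonal_exists by metis
  obtain s t where st: "0 < s" "0 < t" "x + s *\<^sub>R v \<in> frontier \<Omega>0" "x - t *\<^sub>R v \<in> frontier \<Omega>0"
    using chord_along[OF x(1) v(1)] n(2)[of v] n(2)[of "-v"] v by auto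
  show ?thesis
  proof (rule that[OF st(3,4)])
    have "x = (1 - s/(s+t)) *\<^sub>R (x + s *\<^sub>R v) + (s/(s+t)) *\<^sub>R (x - t *\<^sub>R v)"
    proof -
      have "(1 - s/(s+t)) *\<^sub>R (x + s *\<^sub>R v) + (s/(s+t)) *\<^sub>R (x - t *\<^sub>R v)
         = ((1 - s/(s+t)) + s/(s+t)) *\<^sub>R x + ((1 - s/(s+t)) * s - (s/(s+t)) * t) *\<^sub>R v"
        by (simp add: algebra_simps)
      also have "(1 - s/(s+t)) * s - (s/(s+t)) * t = 0" using st by (simp add: field_simps)
      finally show ?thesis by simp
    qed
    moreover have "0 < s/(s+t)" "s/(s+t) < 1" using st by auto
    moreover have "x + s *\<^sub>R v \<noteq> x - t *\<^sub>R v"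
    proof
      assume "x + s *\<^sub>R v = x - t *\<^sub>R v"
      then have "(s + t) *\<^sub>R v = 0" by (simp add: scaleR_add_left)
      then show False using st v by simp
    qed
    ultimately show "x \<in> open_segment (x + s *\<^sub>R v) (x - t *\<^sub>R v)"
      unfolding in_segment by blast
    have "y \<notin> \<Omega>1" if y: "y \<in> closed_segment (x + s *\<^sub>R v) (x - t *\<^sub>R v)" for y
    proof -
      obtain u where "y = (1-u) *\<^sub>R (x + s *\<^sub>R v) + u *\<^sub>R (x - t *\<^sub>R v)" using y by (auto simp: in_segment)
      then have "y - x = ((1 - u) * s - u * t) *\<^sub>R v" by (simp add: algebra_simps)
      then have "n \<bullet> (y - x) = 0" using v by simp
      then show ?thesis using n(1)[of y] by auto
    qed
    then show "closed_segment (x + s *\<^sub>R v) (x - t *\<^sub>R v) \<subseteq> closure \<Omega>0 - \<Omega>1"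
      using closed_segment_closure0[of "x + s *\<^sub>R v" "x - t *\<^sub>R v"] st frontier0_iff by blast
  qed
qed

text \<open>Points of \<open>\<Omega>0\<close> are inner points of chords in the annulus; points of
  the outer boundary are extreme by strict convexity.\<close>

lemma fixed_boundary_annulus: "fixed_boundary (closure \<Omega>0 - \<Omega>1) = frontier \<Omega>0"
proof (intro set_eqI iffI)
  fix x assume fx: "x \<in> fixed_boundary (closure \<Omega>0 - \<Omega>1)"
  have x: "x \<in> closure \<Omega>0 - \<Omega>1" using fx unfolding fixed_boundary_def mem_Collect_eq by (rule conjunct1)
  have nx: "\<not> (\<exists>a b. closed_segment a b \<subseteq> closure \<Omega>0 - \<Omega>1 \<and> x \<in> open_segment a b)"
    using fx unfolding fixed_boundary_def mem_Collect_eq by (rule conjunct2)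
  have "x \<notin> \<Omega>0"
  proof
    assume "x \<in> \<Omega>0"
    moreover have "x \<notin> \<Omega>1" using x by simp
    ultimately obtain a b where "x \<in> open_segment a b" "closed_segment a b \<subseteq> closure \<Omega>0 - \<Omega>1"
      by (rule chord_exists)
    then have "\<exists>a b. closed_segment a b \<subseteq> closure \<Omega>0 - \<Omega>1 \<and> x \<in> open_segment a b"
      by (intro exI conjI)
    from nx this show False by (rule notE)
  qed
  then show "x \<in> frontier \<Omega>0" using x frontier0_iff by blast
next
  fix x assume x: "x \<in> frontier \<Omega>0"
  then have "x \<in> closure \<Omega>0 - \<Omega>1" using frontier0_iff sub10 by blast
  moreover have "x \<notin> open_segment a b" if "closed_segment a b \<subseteq> closure \<Omega>0 - \<Omega>1" for a b
    using open_segment_in_strictly_convex[OF open0 convex0 strict0, of a b x] that x frontier0_iff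
    by (meson DiffD1 ends_in_segment subsetD)
  ultimately show "x \<in> fixed_boundary (closure \<Omega>0 - \<Omega>1)" by (auto simp: fixed_boundary_def)
qed

end

section \<open>Step functions as words\<close>

text \<open>A word \<open>[(l\<^sub>1, p\<^sub>1), \<dots>, (l\<^sub>n, p\<^sub>n)]\<close> stands for the step function that takes the
  value \<open>p\<^sub>i\<close> on the \<open>i\<close>-th of consecutive intervals of lengths \<open>l\<^sub>i\<close>, starting at \<open>0\<close>.\<close>

type_synonym 'b word = "(real \<times> 'b) list"

definition wlen :: "'b word \<Rightarrow> real" where
  "wlen w = (\<Sum>(l, p)\<leftarrow>w. l)"

definition wint :: "'b::real_vector word \<Rightarrow> 'b" where
  "wint w = (\<Sum>(l, p)\<leftarrow>w. l *\<^sub>R p)"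

text \<open>The primitive of the step function that vanishes at \<open>0\<close>. Averages over
  intervals are its difference quotients, so they can be treated without integration.\<close>

fun wprim :: "'b::real_vector word \<Rightarrow> real \<Rightarrow> 'b" where
  "wprim [] t = 0"
| "wprim ((l, p) # w) t = (if t \<le> l then t *\<^sub>R p else l *\<^sub>R p + wprim w (t - l))"

definition wpos :: "'b word \<Rightarrow> bool" where
  "wpos w \<longleftrightarrow> (\<forall>(l, p)\<in>set w. 0 < l)"

definition wvals :: "'b word \<Rightarrow> 'b set" where
  "wvals w = snd ` set w"

definition wrep :: "nat \<Rightarrow> 'b word \<Rightarrow> 'b word" where
  "wrep n w = concat (replicate n w)"

definition safe :: "'b::real_vector set \<Rightarrow> 'b word \<Rightarrow> bool" where
  "safe F w \<longleftrightarrow> (\<forall>s t. 0 \<le> s \<longrightarrow> s < t \<longrightarrow> t \<le> wlen w \<longrightarrow> (wprim w t - wprim w s) /\<^sub>R (t - s) \<in> F)"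

text \<open>Long runs of \<open>u\<close> and of \<open>v\<close> may be put side by side. The cases
  \<open>n = 0\<close> and \<open>n' = 0\<close> contain the safety of the runs themselves.\<close>

definition compat :: "'b::real_vector set \<Rightarrow> 'b word \<Rightarrow> 'b word \<Rightarrow> bool" where
  "compat F u v \<longleftrightarrow> (\<forall>n n'. safe F (wrep n u @ wrep n' v))"

lemma wlen_simps [simp]: "wlen [] = 0" "wlen ((l, p) # w) = l + wlen w" "wlen (u @ v) = wlen u + wlen v"
  by (simp_all add: wlen_def)

lemma wint_simps [simp]: "wint [] = 0" "wint ((l, p) # w) = l *\<^sub>R p + wint w" "wint (u @ v) = wint u + wint v"
  by (simp_all add: wint_def)

lemma wpos_simps [simp]: "wpos []" "wpos ((l, p) # w) \<longleftrightarrow> 0 < l \<and> wpos w" "wpos (u @ v) \<longleftrightarrow> wpos u \<and> wpos v"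
  by (auto simp: wpos_def)

lemma wvals_simps [simp]: "wvals [] = {}" "wvals ((l, p) # w) = insert p (wvals w)" "wvals (u @ v) = wvals u \<union> wvals v"
  by (auto simp: wvals_def)

lemma wrep_simps [simp]: "wrep 0 w = []" "wrep (Suc n) w = w @ wrep n w" "wrep (m + n) w = wrep m w @ wrep n w"
  by (simp_all add: wrep_def replicate_add)

lemma wlen_wrep [simp]: "wlen (wrep n w) = real n * wlen w"
  by (induction n) (simp_all add: algebra_simps)

lemma wint_wrep [simp]: "wint (wrep n w) = real n *\<^sub>R wint w"
  by (induction n) (simp_all add: algebra_simps)

lemma wpos_wrep [simp]: "wpos w \<Longrightarrow> wpos (wrep n w)"
  by (induction n) simp_all

lemma wvals_wrep: "wvals (wrep n w) \<subseteq> wvals w"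
  by (induction n) auto

lemma wlen_nonneg: "wpos w \<Longrightarrow> 0 \<le> wlen w"
  by (induction w) auto

lemma wlen_pos: "wpos w \<Longrightarrow> w \<noteq> [] \<Longrightarrow> 0 < wlen w"
  by (cases w) (auto simp: wlen_nonneg add_pos_nonneg)

lemma wpos_concat: "(\<And>u. u \<in> set us \<Longrightarrow> wpos u) \<Longrightarrow> wpos (concat us)"
  by (induction us) auto

lemma wprim_0 [simp]: "wpos w \<Longrightarrow> wprim w 0 = 0"
  by (cases w) auto

lemma wprim_append_left: "wpos u \<Longrightarrow> wpos v \<Longrightarrow> 0 \<le> t \<Longrightarrow> t \<le> wlen u \<Longrightarrow> wprim (u @ v) t = wprim u t"
  by (induction u arbitrary: t) auto

lemma wprim_wlen: "wpos w \<Longrightarrow> wprim w (wlen w) = wint w"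
proof (induction w)
  case (Cons a w)
  obtain l p where a: "a = (l, p)" by (cases a)
  show ?case
  proof (cases "w = []")
    case False
    then have "0 < wlen w" using Cons.prems a by (simp add: wlen_pos)
    then show ?thesis using Cons a by simp
  qed (simp add: a)
qed simp

lemma wprim_append_right:
  "wpos u \<Longrightarrow> wpos v \<Longrightarrow> wlen u \<le> t \<Longrightarrow> wprim (u @ v) t = wint u + wprim v (t - wlen u)"
proof (induction u arbitrary: t)
  case (Cons a u)
  obtain l p where a: "a = (l, p)" by (cases a)
  have le: "wlen u \<le> t - l" using Cons.prems a by simp
  have pos: "wpos u" "wpos v" using Cons.prems a by auto
  show ?case
  proof (cases "t \<le> l")
    case True
    then have "u = []" "t = l" using Cons.prems a wlen_pos[OF pos(1)] wlen_nonneg[OF pos(1)] by force+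
    then show ?thesis using pos a by simp
  next
    case False
    then show ?thesis using Cons.IH[OF pos le] a by (simp add: algebra_simps)
  qed
qed simp

text \<open>An interval starting in the first letter has as average a convex combination of the
  first value and an average of the remaining word.\<close>

lemma average_in_convex:
  assumes "convex X" and "wvals w \<subseteq> X" "wpos w" "0 \<le> s" "s < t" "t \<le> wlen w"
  shows "(wprim w t - wprim w s) /\<^sub>R (t - s) \<in> X"
  using assms(2-)
proof (induction w arbitrary: s t)
  case (Cons a w)
  obtain l p where a: "a = (l, p)" by (cases a)
  have p: "p \<in> X" "0 < l" "wpos w" "wvals w \<subseteq> X" using Cons.prems a by auto
  consider "t \<le> l" | "l \<le> s" | "s < l" "l < t" by linarith
  then show ?case
  proof cases
    case 1
    have "t *\<^sub>R p - s *\<^sub>R p = (t - s) *\<^sub>R p" by (simp add: algebra_simps)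
    then show ?thesis using 1 Cons.prems a p by simp
  next
    case 2
    have "wprim (a # w) s = l *\<^sub>R p + wprim w (s - l)" using 2 a p by (cases "s = l") auto
    moreover have "wprim (a # w) t = l *\<^sub>R p + wprim w (t - l)" using 2 a Cons.prems by simp
    moreover have "(wprim w (t - l) - wprim w (s - l)) /\<^sub>R ((t - l) - (s - l)) \<in> X"
      by (rule Cons.IH) (use 2 Cons.prems a p in auto)
    ultimately show ?thesis by simp
  next
    case 3
    define y where "y = (wprim w (t - l) - wprim w 0) /\<^sub>R ((t - l) - 0)"
    have y: "y \<in> X" unfolding y_def by (rule Cons.IH) (use 3 Cons.prems a p in auto)
    have y2: "wprim w (t - l) = (t - l) *\<^sub>R y" using 3 p by (simp add: y_def)
    have "((l - s) / (t - s)) *\<^sub>R p + ((t - l) / (t - s)) *\<^sub>R y \<in> X"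
      by (rule convexD[OF \<open>convex X\<close> p(1) y]) (use 3 in \<open>auto simp flip: add_divide_distrib\<close>)
    moreover have "wprim (a # w) t - wprim (a # w) s = (l - s) *\<^sub>R p + (t - l) *\<^sub>R y"
      using 3 a by (simp add: y2 algebra_simps)
    ultimately show ?thesis by (simp add: scaleR_add_right divide_inverse mult.commute)
  qed
qed simp

lemma average_bounded:
  assumes "wvals w \<subseteq> cball 0 B" "norm q \<le> B" "wpos w" "0 \<le> s" "s \<le> t" "t \<le> wlen w"
  shows "norm (wprim w t - wprim w s - (t - s) *\<^sub>R q) \<le> (t - s) * (2 * B)"
proof (cases "s = t")
  case False
  then have st: "s < t" using assms by simp
  define y where "y = (wprim w t - wprim w s) /\<^sub>R (t - s)"
  have "y \<in> cball 0 B" unfolding y_def by (rule average_in_convex) (use assms st in auto)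
  then have "norm (y - q) \<le> 2 * B" using norm_triangle_ineq4[of y q] assms by auto
  moreover have "wprim w t - wprim w s - (t - s) *\<^sub>R q = (t - s) *\<^sub>R (y - q)"
    using st by (simp add: y_def scaleR_diff_right)
  ultimately show ?thesis using st by (simp add: mult_left_mono)
qed simp

lemma safe_mono: "safe F w \<Longrightarrow> F \<subseteq> G \<Longrightarrow> safe G w"
  unfolding safe_def by blast

lemma compat_mono: "compat F u v \<Longrightarrow> F \<subseteq> G \<Longrightarrow> compat G u v"
  unfolding compat_def using safe_mono by blast

lemma safe_prefix:
  assumes "safe F (u @ v)" "wpos u" "wpos v" shows "safe F u"
  unfolding safe_def
proof (intro allI impI)
  fix s t assume st: "0 \<le> s" "s < t" "t \<le> wlen u"
  have "(wprim (u @ v) t - wprim (u @ v) s) /\<^sub>R (t - s) \<in> F"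
    by (rule assms(1)[unfolded safe_def, rule_format]) (use st wlen_nonneg[OF assms(3)] in auto)
  then show "(wprim u t - wprim u s) /\<^sub>R (t - s) \<in> F"
    using st assms by (simp add: wprim_append_left)
qed

lemma safe_suffix:
  assumes "safe F (u @ v)" "wpos u" "wpos v" shows "safe F v"
  unfolding safe_def
proof (intro allI impI)
  fix s t assume st: "0 \<le> s" "s < t" "t \<le> wlen v"
  have "(wprim (u @ v) (wlen u + t) - wprim (u @ v) (wlen u + s)) /\<^sub>R ((wlen u + t) - (wlen u + s)) \<in> F"
    by (rule assms(1)[unfolded safe_def, rule_format]) (use st wlen_nonneg[OF assms(2)] in auto)
  then show "(wprim v t - wprim v s) /\<^sub>R (t - s) \<in> F"
    using st assms by (simp add: wprim_append_right)
qed

lemma safe_convex: "convex X \<Longrightarrow> wvals w \<subseteq> X \<Longrightarrow> wpos w \<Longrightarrow> X \<subseteq> F \<Longrightarrow> safe F w"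
  unfolding safe_def by (auto dest: average_in_convex)

text \<open>A short interval meets at most two neighbouring blocks.\<close>

lemma average_short_interval:
  assumes "successively (\<lambda>b b'. safe F (b @ b')) bs" "\<And>b. b \<in> set bs \<Longrightarrow> safe F b \<and> wpos b \<and> \<Lambda> \<le> wlen b"
    and "0 \<le> s" "s < t" "t \<le> wlen (concat bs)" "t - s \<le> \<Lambda>"
  shows "(wprim (concat bs) t - wprim (concat bs) s) /\<^sub>R (t - s) \<in> F"
  using assms
proof (induction bs arbitrary: s t)
  case (Cons b bs)
  have b: "safe F b" "wpos b" and pos: "wpos (concat bs)"
    using Cons.prems(2) by (auto simp: wpos_def)
  show ?case
  proof (cases "wlen b \<le> s")
    case True
    have "(wprim (concat bs) (t - wlen b) - wprim (concat bs) (s - wlen b)) /\<^sub>R ((t - wlen b) - (s - wlen b)) \<in> F"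
      by (rule Cons.IH) (use Cons.prems True in \<open>auto simp: successively_Cons\<close>)
    then show ?thesis using True Cons.prems b pos by (simp add: wprim_append_right)
  next
    case False
    show ?thesis
    proof (cases bs)
      case Nil
      then show ?thesis using b Cons.prems by (simp add: safe_def)
    next
      case (Cons b' bs')
      have sb: "safe F (b @ b')" using Cons.prems(1) local.Cons by (simp add: successively_Cons)
      have b': "wpos b'" "\<Lambda> \<le> wlen b'" "wpos (concat bs')"
        using Cons.prems(2)[of b'] pos local.Cons by auto
      have t: "t \<le> wlen (b @ b')" using False Cons.prems b' by simp
      have e: "wprim (concat (b # bs)) y = wprim (b @ b') y" if "0 \<le> y" "y \<le> wlen (b @ b')" for y
        using wprim_append_left[of "b @ b'" "concat bs'" y] b b' that local.Cons by simp
      show ?thesis using sb t Cons.prems e[of t] e[of s] unfolding safe_def by simp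
    qed
  qed
qed simp

text \<open>A unit is a word repeated within a block. Its own average lies in \<open>E\<close>, in
  use a segment of the martingale, so only units cut by the ends of an interval can move an average
  off \<open>E\<close>.\<close>

definition unit_ok :: "'b::real_normed_vector set \<Rightarrow> real \<Rightarrow> real \<Rightarrow> 'b word \<Rightarrow> bool" where
  "unit_ok E l B u \<longleftrightarrow> wpos u \<and> u \<noteq> [] \<and> wlen u \<le> l \<and> wvals u \<subseteq> cball 0 B \<and> (\<exists>y\<in>E. wint u = wlen u *\<^sub>R y)"

text \<open>From the start of a unit only the last, incomplete unit contributes an error, at most
  its length times \<open>2 * B\<close>.\<close>

lemma average_units_initial:
  assumes "convex E" "E \<subseteq> cball 0 B" and "0 \<le> t" "t \<le> wlen (concat us)"
    and "\<And>u. u \<in> set us \<Longrightarrow> unit_ok E l B u" and E: "E \<noteq> {}" and lB: "0 \<le> l" "0 \<le> B"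
  shows "\<exists>q\<in>E. norm (wprim (concat us) t - t *\<^sub>R q) \<le> l * (2 * B)"
  using assms(3-5)
proof (induction us arbitrary: t)
  case Nil
  then show ?case using E lB by (auto simp: wlen_def)
next
  case (Cons u us)
  have u: "unit_ok E l B u" using Cons.prems by simp
  then obtain y where y: "y \<in> E" "wint u = wlen u *\<^sub>R y" and lu: "wlen u \<le> l" "wpos u" "wvals u \<subseteq> cball 0 B"
    by (auto simp: unit_ok_def)
  have pos: "wpos (concat us)" using Cons.prems(3) by (intro wpos_concat) (auto simp: unit_ok_def)
  show ?case
  proof (cases "t \<le> wlen u")
    case True
    have "norm (wprim u t - wprim u 0 - (t - 0) *\<^sub>R y) \<le> (t - 0) * (2 * B)"
      by (rule average_bounded) (use lu y assms(2) Cons.prems True in auto)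
    also have "\<dots> \<le> l * (2 * B)" using True lu lB by (intro mult_right_mono) auto
    finally show ?thesis using y lu pos True Cons.prems by (auto simp: wprim_append_left)
  next
    case False
    define t' where "t' = t - wlen u"
    obtain q where q: "q \<in> E" "norm (wprim (concat us) t' - t' *\<^sub>R q) \<le> l * (2 * B)"
      using Cons.IH[of t'] False Cons.prems by (auto simp: t'_def)
    have t0: "0 < t'" "0 \<le> wlen u" "0 < t" using False lu wlen_nonneg[of u] by (auto simp: t'_def)
    define q' where "q' = (wlen u / t) *\<^sub>R y + (t' / t) *\<^sub>R q"
    have "q' \<in> E" unfolding q'_def
      by (rule convexD[OF assms(1) y(1) q(1)]) (use t0 in \<open>auto simp: t'_def field_simps\<close>)
    moreover have "t *\<^sub>R q' = wint u + t' *\<^sub>R q" using t0 by (simp add: q'_def scaleR_add_right y)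
    moreover have "wprim (concat (u # us)) t = wint u + wprim (concat us) t'"
      using False lu pos by (simp add: wprim_append_right t'_def)
    ultimately show ?thesis using q by (intro bexI[of _ q']) auto
  qed
qed

text \<open>An interval cuts at most two units, one at each end, whence the factor
  \<open>2\<close>.\<close>

lemma average_units:
  assumes "convex E" "E \<subseteq> cball 0 B" and "0 \<le> s" "s \<le> t" "t \<le> wlen (concat us)"
    and "\<And>u. u \<in> set us \<Longrightarrow> unit_ok E l B u" and E: "E \<noteq> {}" and lB: "0 \<le> l" "0 \<le> B"
  shows "\<exists>q\<in>E. norm (wprim (concat us) t - wprim (concat us) s - (t - s) *\<^sub>R q) \<le> 2 * (l * (2 * B))"
  using assms(3-6)
proof (induction us arbitrary: s t)
  case Nil
  then have "s = t" by (simp add: wlen_def)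
  then show ?case using E lB by auto
next
  case (Cons u us)
  have u: "unit_ok E l B u" using Cons.prems by simp
  then obtain y where y: "y \<in> E" "wint u = wlen u *\<^sub>R y" and lu: "wlen u \<le> l" "wpos u" "wvals u \<subseteq> cball 0 B"
    by (auto simp: unit_ok_def)
  have pos: "wpos (concat us)" using Cons.prems(4) by (intro wpos_concat) (auto simp: unit_ok_def)
  have C: "0 \<le> l * (2 * B)" using lB by simp
  consider "wlen u \<le> s" | "s < wlen u" "t \<le> wlen u" | "s < wlen u" "wlen u < t" by linarith
  then show ?case
  proof cases
    case 1
    then obtain q where "q \<in> E" "norm (wprim (concat us) (t - wlen u) - wprim (concat us) (s - wlen u)
        - ((t - wlen u) - (s - wlen u)) *\<^sub>R q) \<le> 2 * (l * (2 * B))"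
      using Cons.IH[of "s - wlen u" "t - wlen u"] Cons.prems by auto
    then show ?thesis using 1 Cons.prems lu pos by (intro bexI[of _ q]) (auto simp: wprim_append_right)
  next
    case 2
    have "norm (wprim u t - wprim u s - (t - s) *\<^sub>R y) \<le> (t - s) * (2 * B)"
      by (rule average_bounded) (use lu y assms(2) Cons.prems 2 in auto)
    also have "\<dots> \<le> l * (2 * B)" using 2 lu lB Cons.prems by (intro mult_right_mono) auto
    finally have "norm (wprim u t - wprim u s - (t - s) *\<^sub>R y) \<le> 2 * (l * (2 * B))" using C by linarith
    then show ?thesis using y lu pos 2 Cons.prems by (intro bexI[of _ y]) (auto simp: wprim_append_left)
  next
    case 3
    define t' where "t' = t - wlen u"
    obtain q where q: "q \<in> E" "norm (wprim (concat us) t' - t' *\<^sub>R q) \<le> l * (2 * B)"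
      using average_units_initial[OF assms(1,2), of t' us l] 3 Cons.prems E lB by (auto simp: t'_def)
    have "norm (wprim u (wlen u) - wprim u s - (wlen u - s) *\<^sub>R q) \<le> (wlen u - s) * (2 * B)"
      by (rule average_bounded) (use lu q assms(2) Cons.prems 3 in auto)
    also have "\<dots> \<le> l * (2 * B)" using 3 lu lB Cons.prems by (intro mult_right_mono) auto
    finally have 4: "norm (wint u - wprim u s - (wlen u - s) *\<^sub>R q) \<le> l * (2 * B)"
      using lu by (simp add: wprim_wlen)
    have eq: "wprim (concat (u # us)) t - wprim (concat (u # us)) s - (t - s) *\<^sub>R q
        = (wint u - wprim u s - (wlen u - s) *\<^sub>R q) + (wprim (concat us) t' - t' *\<^sub>R q)"
      using 3 lu pos Cons.prems by (simp add: wprim_append_right wprim_append_left t'_def algebra_simps)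
    have "norm (wprim (concat (u # us)) t - wprim (concat (u # us)) s - (t - s) *\<^sub>R q)
        \<le> l * (2 * B) + l * (2 * B)"
      unfolding eq by (rule norm_triangle_mono[OF 4 q(2)])
    then have "norm (wprim (concat (u # us)) t - wprim (concat (u # us)) s - (t - s) *\<^sub>R q) \<le> 2 * (l * (2 * B))"
      by linarith
    then show ?thesis using q by blast
  qed
qed

definition wblocks :: "(nat \<times> 'b word) list \<Rightarrow> 'b word" where
  "wblocks nus = concat (map (\<lambda>(n, u). wrep n u) nus)"

lemma wblocks_simps [simp]: "wblocks [] = []" "wblocks ((n, u) # nus) = wrep n u @ wblocks nus"
  "wblocks (xs @ ys) = wblocks xs @ wblocks ys"
  by (simp_all add: wblocks_def)

lemma wblocks_replicate: "wblocks (concat (replicate n nus)) = wrep n (wblocks nus)"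
  by (induction n) simp_all

text \<open>The same word has two readings: as a sequence of long blocks, for averages over short
  intervals, and as a sequence of short units, for averages over long ones.\<close>

lemma wblocks_units: "wblocks nus = concat (concat (map (\<lambda>(n, u). replicate n u) nus))"
  by (induction nus) (auto simp: wrep_def)

context convex_annulus
begin

lemma far_perturb: "q \<in> far r' \<Longrightarrow> dist y q \<le> r' - r \<Longrightarrow> y \<in> far r"
  unfolding far_def using dist_triangle2 by (smt (verit) dist_commute mem_Collect_eq)

text \<open>\<open>\<Lambda>\<close> separates two regimes. An interval of length at most
  \<open>\<Lambda>\<close> meets at most two blocks, where compatibility applies; on a longer one
  the error of the cut units, divided by the length, is at most \<open>r' - r\<close>. This is the
  loss in the distance from \<open>\<Omega>1\<close>.\<close>

lemma safe_blocks:
  assumes units: "\<And>n u. (n, u) \<in> set nus \<Longrightarrow> unit_ok E l B u \<and> compat (far r') u u \<and> \<Lambda> \<le> real n * wlen u"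
    and succ: "successively (\<lambda>(n, u) (n', u'). compat (far r') u u') nus"
    and E: "convex E" "E \<noteq> {}" "E \<subseteq> cball 0 B" "E \<subseteq> far r'"
    and lB: "0 \<le> l" "0 \<le> B" and r: "r \<le> r'" and \<Lambda>: "2 * (l * (2 * B)) \<le> \<Lambda> * (r' - r)" "0 < \<Lambda>"
  shows "safe (far r) (wblocks nus)"
  unfolding safe_def
proof (intro allI impI)
  fix s t assume st: "0 \<le> s" "s < t" "t \<le> wlen (wblocks nus)"
  show "(wprim (wblocks nus) t - wprim (wblocks nus) s) /\<^sub>R (t - s) \<in> far r"
  proof (cases "t - s \<le> \<Lambda>")
    case True
    have "(wprim (wblocks nus) t - wprim (wblocks nus) s) /\<^sub>R (t - s) \<in> far r'"
      unfolding wblocks_def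
    proof (rule average_short_interval)
      show "successively (\<lambda>b b'. safe (far r') (b @ b')) (map (\<lambda>(n, u). wrep n u) nus)"
        unfolding successively_map by (rule successively_mono[OF succ]) (auto simp: compat_def)
      fix b assume "b \<in> set (map (\<lambda>(n, u). wrep n u) nus)"
      then obtain n u where nu: "(n, u) \<in> set nus" "b = wrep n u" by auto
      have "safe (far r') (wrep n u @ wrep 0 u)" using units[OF nu(1)] unfolding compat_def by blast
      then show "safe (far r') b \<and> wpos b \<and> \<Lambda> \<le> wlen b" using units[OF nu(1)] nu by (simp add: unit_ok_def)
    qed (use st True in \<open>auto simp: wblocks_def\<close>)
    then show ?thesis using far_mono[OF r] by blast
  next
    case False
    have "\<exists>q\<in>E. norm (wprim (wblocks nus) t - wprim (wblocks nus) s - (t - s) *\<^sub>R q) \<le> 2 * (l * (2 * B))"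
      unfolding wblocks_units
      by (rule average_units[OF E(1,3)]) (use st units E lB in \<open>auto simp: wblocks_units\<close>)
    then obtain q where q: "q \<in> E" "norm (wprim (wblocks nus) t - wprim (wblocks nus) s - (t - s) *\<^sub>R q) \<le> 2 * (l * (2 * B))"
      by blast
    have "(wprim (wblocks nus) t - wprim (wblocks nus) s) /\<^sub>R (t - s) - q
        = (wprim (wblocks nus) t - wprim (wblocks nus) s - (t - s) *\<^sub>R q) /\<^sub>R (t - s)"
      using st by (simp add: scaleR_diff_right)
    then have "dist ((wprim (wblocks nus) t - wprim (wblocks nus) s) /\<^sub>R (t - s)) q
        = norm (wprim (wblocks nus) t - wprim (wblocks nus) s - (t - s) *\<^sub>R q) / (t - s)"
      using st by (simp add: dist_norm divide_inverse mult.commute)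
    also have "\<dots> \<le> (2 * (l * (2 * B))) / (t - s)" using q st by (intro divide_right_mono) auto
    also have "\<dots> \<le> (\<Lambda> * (r' - r)) / (t - s)" using \<Lambda> st by (intro divide_right_mono) auto
    also have "\<dots> \<le> ((t - s) * (r' - r)) / (t - s)"
      using False st r by (intro divide_right_mono mult_right_mono) auto
    also have "\<dots> = r' - r" using st by simp
    finally show ?thesis using far_perturb q E(4) by blast
  qed
qed

end

section \<open>Realizing finite martingales by words\<close>

text \<open>\<open>reach M F f x V\<close>: a finite martingale that starts at \<open>x\<close>, moves along segments in
  \<open>M\<close> and stops on \<open>F\<close> has expected final value \<open>V\<close> of \<open>f\<close>.\<close>

inductive reach :: "'a::euclidean_space set \<Rightarrow> 'a set \<Rightarrow> ('a \<Rightarrow> real) \<Rightarrow> 'a \<Rightarrow> real \<Rightarrow> bool"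
  for M F f where
  leaf: "x \<in> M \<Longrightarrow> x \<in> F \<Longrightarrow> reach M F f x (f x)"
| node: "reach M F f a V \<Longrightarrow> reach M F f b W \<Longrightarrow> closed_segment a b \<subseteq> M \<Longrightarrow> 0 \<le> s \<Longrightarrow> s \<le> 1 \<Longrightarrow>
    reach M F f ((1 - s) *\<^sub>R a + s *\<^sub>R b) ((1 - s) * V + s * W)"

lemma reach_mono: "reach M F f x V \<Longrightarrow> M \<subseteq> M' \<Longrightarrow> reach M' F f x V"
  by (induction rule: reach.induct) (auto intro: reach.intros)

lemma reach_in: "reach M F f x V \<Longrightarrow> x \<in> M"
  by (induction rule: reach.induct) (auto simp: closed_segment_def)

text \<open>The chords supplied by \<open>default_chords\<close>, held fixed while the words of a
  whole martingale are assembled.\<close>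

locale chord_family = convex_annulus +
  fixes M :: "'a set" and r1 \<delta> B :: real and l :: "'a \<Rightarrow> real" and p q :: "'a \<Rightarrow> 'a"
  assumes r1: "0 < r1" and \<delta>: "0 < \<delta>"
    and weight: "\<And>m. m \<in> M \<Longrightarrow> 0 < l m \<and> l m < 1 \<and> m = (1 - l m) *\<^sub>R p m + l m *\<^sub>R q m"
    and ends: "\<And>m. m \<in> M \<Longrightarrow> p m \<in> frontier \<Omega>0 \<and> q m \<in> frontier \<Omega>0 \<and> norm (p m) \<le> B \<and> norm (q m) \<le> B"
    and fixed: "\<And>m. m \<in> frontier \<Omega>0 \<Longrightarrow> p m = m \<and> q m = m"
    and close: "\<And>m m'. m \<in> M \<Longrightarrow> m' \<in> M \<Longrightarrow> dist m m' < \<delta> \<Longrightarrow>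
       \<exists>X. convex X \<and> {p m, q m, p m', q m'} \<subseteq> X \<and> X \<subseteq> far r1"
begin

definition chord :: "'a \<Rightarrow> 'a word" where
  "chord m = [(1 - l m, p m), (l m, q m)]"

text \<open>The chord of \<open>x\<close> serves as the interface: a word compatible with it on both
  sides can be entered and left by walks along default chords, whatever its inner structure.\<close>

definition good :: "real \<Rightarrow> 'a word \<Rightarrow> 'a \<Rightarrow> bool" where
  "good r w x \<longleftrightarrow> wpos w \<and> w \<noteq> [] \<and> wvals w \<subseteq> frontier \<Omega>0 \<and> wint w = wlen w *\<^sub>R x \<and>
     compat (far r) w w \<and> compat (far r) (chord x) w \<and> compat (far r) w (chord x)"

lemma chord_props [simp]:
  assumes "m \<in> M"
  shows "wpos (chord m)" "wlen (chord m) = 1" "wint (chord m) = m" "wvals (chord m) = {p m, q m}"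
    "wvals (chord m) \<subseteq> frontier \<Omega>0" "wvals (chord m) \<subseteq> cball 0 B" "chord m \<noteq> []"
proof -
  show "wpos (chord m)" "wlen (chord m) = 1" "wvals (chord m) = {p m, q m}" "chord m \<noteq> []"
    using weight[OF assms] by (auto simp: chord_def)
  show "wint (chord m) = m" using weight[OF assms] by (simp add: chord_def)
  show "wvals (chord m) \<subseteq> frontier \<Omega>0" "wvals (chord m) \<subseteq> cball 0 B"
    using ends[OF assms] by (auto simp: chord_def)
qed

lemma mem_far: assumes "m \<in> M" shows "m \<in> far r1"
proof -
  obtain X where X: "convex X" "{p m, q m} \<subseteq> X" "X \<subseteq> far r1" using close[OF assms assms] \<delta> by auto
  have "(1 - l m) *\<^sub>R p m + l m *\<^sub>R q m \<in> X"
    using convexD_alt[OF X(1), of "p m" "q m" "l m"] X weight[OF assms] by auto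
  then show ?thesis using X weight[OF assms] by auto
qed

lemma chord_compat:
  assumes "m \<in> M" "m' \<in> M" "dist m m' < \<delta>"
  shows "compat (far r1) (chord m) (chord m')"
  unfolding compat_def
proof (intro allI)
  fix n n'
  obtain X where X: "convex X" "{p m, q m, p m', q m'} \<subseteq> X" "X \<subseteq> far r1" using close[OF assms] by auto
  show "safe (far r1) (wrep n (chord m) @ wrep n' (chord m'))"
  proof (rule safe_convex[OF X(1) _ _ X(3)])
    show "wvals (wrep n (chord m) @ wrep n' (chord m')) \<subseteq> X"
      using wvals_wrep[of n "chord m"] wvals_wrep[of n' "chord m'"] X assms by auto
  qed (use assms in auto)
qed

lemma good_mono:
  assumes "good r' w x" "r \<le> r'" shows "good r w x"
  using assms(1) compat_mono[OF _ far_mono[OF assms(2)]] unfolding good_def by simp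

text \<open>The chord of a point of the outer boundary is degenerate, so all words involved have the
  single value \<open>x\<close>.\<close>

lemma good_leaf:
  assumes "x \<in> M" "x \<in> frontier \<Omega>0"
  shows "good r1 [(1, x)] x"
proof -
  have px: "p x = x" "q x = x" using fixed[OF assms(2)] by auto
  have "x \<in> far r1" by (rule mem_far[OF assms(1)])
  then have *: "compat (far r1) u v" if "wpos u" "wpos v" "wvals u = {x}" "wvals v = {x}" for u v
    unfolding compat_def
  proof (intro allI safe_convex[of "{x}"])
    show "wvals (wrep n u @ wrep n' v) \<subseteq> {x}" for n n'
      using wvals_wrep[of n u] wvals_wrep[of n' v] that by auto
  qed (use that in auto)
  show ?thesis unfolding good_def using assms px by (auto intro!: *)
qed

section \<open>Words for one step of a martingale\<close>

definition walk :: "nat \<Rightarrow> 'a \<Rightarrow> 'a \<Rightarrow> nat \<Rightarrow> (nat \<times> 'a word) list" where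
  "walk K y z n = map (\<lambda>i. (K, chord (y + (real i / real n) *\<^sub>R (z - y)))) [0..<Suc n]"

lemma walk_point:
  assumes "0 < n" "i \<le> n"
  shows "y + (real i / real n) *\<^sub>R (z - y) \<in> closed_segment y z"
proof -
  have "y + c *\<^sub>R (z - y) = (1 - c) *\<^sub>R y + c *\<^sub>R z" for c :: real by (simp add: algebra_simps)
  moreover have "0 \<le> real i / real n" "real i / real n \<le> 1" using assms by auto
  ultimately show ?thesis unfolding in_segment by blast
qed

lemma walk_ends:
  assumes "0 < n"
  shows "walk K y z n \<noteq> []" "hd (walk K y z n) = (K, chord y)" "last (walk K y z n) = (K, chord z)"
proof -
  show "walk K y z n \<noteq> []" by (simp add: walk_def)
  have "[0..<Suc n] = 0 # [Suc 0..<Suc n]" by (rule upt_conv_Cons) simp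
  then show "hd (walk K y z n) = (K, chord y)" by (simp add: walk_def del: upt_Suc)
  show "last (walk K y z n) = (K, chord z)" using assms by (simp add: walk_def)
qed

lemma walk_successively:
  assumes "closed_segment y z \<subseteq> M" "0 < n" "dist y z < real n * \<delta>" "r \<le> r1"
  shows "successively (\<lambda>(n, u) (n', u'). compat (far r) u u') (walk K y z n)"
  unfolding walk_def successively_map
proof (subst successively_conv_nth, intro allI impI)
  fix i assume i: "Suc i < length [0..<Suc n]"
  define a where "a i = y + (real i / real n) *\<^sub>R (z - y)" for i
  have "i \<le> n" "Suc i \<le> n" using i by auto
  then have "a i \<in> M" "a (Suc i) \<in> M"
    unfolding a_def by (auto intro!: subsetD[OF assms(1)] walk_point[OF assms(2)] simp del: of_nat_Suc)
  moreover have "dist (a i) (a (Suc i)) < \<delta>"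
  proof -
    have "a i - a (Suc i) = (- (1 / real n)) *\<^sub>R (z - y)"
      by (simp add: a_def add_divide_distrib algebra_simps)
    then have "dist (a i) (a (Suc i)) = dist y z / real n"
      by (simp add: dist_norm norm_minus_commute)
    then show ?thesis using assms by (simp add: divide_less_eq mult.commute)
  qed
  ultimately have "compat (far r1) (chord (a i)) (chord (a (Suc i)))" by (rule chord_compat)
  then have "compat (far r) (chord (a i)) (chord (a (Suc i)))" using compat_mono far_mono[OF assms(4)] by blast
  then show "(case (K, chord (y + (real ([0..<Suc n] ! i) / real n) *\<^sub>R (z - y))) of
      (n, u) \<Rightarrow> \<lambda>(n', u'). compat (far r) u u') (K, chord (y + (real ([0..<Suc n] ! Suc i) / real n) *\<^sub>R (z - y)))"
    using i by (simp add: a_def del: upt_Suc)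
qed

lemma walk_set:
  assumes "closed_segment y z \<subseteq> M" "0 < n" "(k, u) \<in> set (walk K y z n)"
  obtains m where "m \<in> M" "m \<in> closed_segment y z" "u = chord m" "k = K"
proof -
  obtain i where i: "i \<le> n" "k = K" "u = chord (y + (real i / real n) *\<^sub>R (z - y))"
    using assms(3) unfolding walk_def by (auto simp: less_Suc_eq_le simp del: upt_Suc)
  have "y + (real i / real n) *\<^sub>R (z - y) \<in> closed_segment y z" by (rule walk_point[OF assms(2) i(1)])
  then show ?thesis using that i assms(1) by blast
qed

text \<open>The mean of the walks can be off \<open>x\<close> only along the direction of the edge,
  so a single scalar has to be corrected.\<close>

lemma blocks_on_line:
  assumes "\<And>k u. (k, u) \<in> set nus \<Longrightarrow> \<exists>c. wint u = wlen u *\<^sub>R x + c *\<^sub>R e"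
  obtains c where "wint (wblocks nus) = wlen (wblocks nus) *\<^sub>R x + c *\<^sub>R e"
proof -
  have "\<exists>c. wint (wblocks nus) = wlen (wblocks nus) *\<^sub>R x + c *\<^sub>R e" using assms
  proof (induction nus)
    case (Cons a nus)
    obtain k u where a: "a = (k, u)" by (cases a)
    obtain c where c: "wint u = wlen u *\<^sub>R x + c *\<^sub>R e" using Cons.prems a by auto
    obtain d where d: "wint (wblocks nus) = wlen (wblocks nus) *\<^sub>R x + d *\<^sub>R e" using Cons by auto
    have "wint (wblocks (a # nus)) = wlen (wblocks (a # nus)) *\<^sub>R x + (real k * c + d) *\<^sub>R e"
      by (simp add: a c d algebra_simps)
    then show ?case by blast
  qed simp
  then show ?thesis using that by blast
qed

lemma point_on_line:
  assumes "m \<in> closed_segment a b" "x \<in> closed_segment a b"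
  shows "\<exists>c. m = x + c *\<^sub>R (b - a)"
proof -
  obtain u v where mu: "m = (1 - u) *\<^sub>R a + u *\<^sub>R b" and xv: "x = (1 - v) *\<^sub>R a + v *\<^sub>R b"
    using assms by (auto simp: in_segment)
  have "m - x = (u - v) *\<^sub>R (b - a)" unfolding mu xv by (simp add: algebra_simps)
  then have "m = x + (u - v) *\<^sub>R (b - a)" by (simp add: diff_eq_eq add.commute)
  then show ?thesis by blast
qed

definition wfint :: "('a \<Rightarrow> real) \<Rightarrow> 'a word \<Rightarrow> real" where
  "wfint f w = wint (map (\<lambda>(l, p). (l, f p)) w)"

lemma wfint_simps [simp]: "wfint f [] = 0" "wfint f (u @ v) = wfint f u + wfint f v"
  by (simp_all add: wfint_def)

lemma wfint_wrep [simp]: "wfint f (wrep n w) = real n * wfint f w"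
  by (induction n) (simp_all add: algebra_simps)

lemma wfint_ge:
  assumes "wpos w" "\<And>y. y \<in> wvals w \<Longrightarrow> c \<le> f y"
  shows "c * wlen w \<le> wfint f w"
  using assms
proof (induction w)
  case (Cons a w)
  obtain k y where a: "a = (k, y)" by (cases a)
  have "k * c \<le> k * f y" using Cons.prems a by (intro mult_left_mono) auto
  moreover have "c * wlen w \<le> wint (map (\<lambda>(l, p). (l, f p)) w)" using Cons a by (simp add: wfint_def)
  ultimately show ?case using a by (simp add: wfint_def algebra_simps)
qed (simp add: wfint_def)

lemma successively_concat_replicate:
  assumes "successively P xs" "xs \<noteq> []" "P (last xs) (hd xs)"
  shows "successively P (concat (replicate n xs))"
proof (induction n)
  case (Suc n)
  show ?case
  proof (cases n)
    case 0
    then show ?thesis using assms by simp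
  next
    case (Suc m)
    have "hd (concat (replicate n xs)) = hd xs" "concat (replicate n xs) \<noteq> []" using Suc assms(2) by auto
    then show ?thesis using Suc.IH assms by (simp add: successively_append_iff)
  qed
qed simp

text \<open>The step function walks along default chords from \<open>x\<close> to \<open>a\<close>, repeats \<open>wa\<close>, walks through \<open>x\<close>
  to \<open>b\<close>, repeats \<open>wb\<close> and walks back; every stop is long, so that averages over intervals meeting
  several stops are close to the segment. Repetitions of the chord of a point near \<open>x\<close> correct the
  mean to be exactly \<open>x\<close>; for many repetitions of \<open>wa\<close> and \<open>wb\<close> the rest has negligible weight.\<close>

lemma good_node:
  assumes seg: "closed_segment a b \<subseteq> M" and s: "0 < s" "s < 1"
    and wa: "good r' wa a" and wb: "good r' wb b" and r: "r < r'" "r' \<le> r1"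
    and Va: "Va * wlen wa \<le> wfint f wa" and Vb: "Vb * wlen wb \<le> wfint f wb"
    and c: "\<And>y. y \<in> frontier \<Omega>0 \<Longrightarrow> c \<le> f y" and \<epsilon>: "0 < \<epsilon>"
  shows "\<exists>w. good r w ((1 - s) *\<^sub>R a + s *\<^sub>R b) \<and> ((1 - s) * Va + s * Vb - \<epsilon>) * wlen w \<le> wfint f w"
proof -
  define x where "x = (1 - s) *\<^sub>R a + s *\<^sub>R b"
  define e where "e = b - a"
  define E where "E = closed_segment a b"
  have xE: "x \<in> E" unfolding E_def x_def in_segment using s by (intro exI[of _ s]) auto
  have abE: "a \<in> E" "b \<in> E" by (auto simp: E_def)
  have EM: "m \<in> M" if "m \<in> E" for m using that seg by (auto simp: E_def)
  have sub: "closed_segment y z \<subseteq> E" if "y \<in> E" "z \<in> E" for y z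
    using that unfolding E_def by (simp add: subset_closed_segment)
  have Efar: "E \<subseteq> far r'" using mem_far EM far_mono[OF r(2)] by blast
  have ax: "a = x + (- s) *\<^sub>R e" and bx: "b = x + (1 - s) *\<^sub>R e"
    by (simp_all add: x_def e_def algebra_simps)
  have wa': "wpos wa" "wa \<noteq> []" "wvals wa \<subseteq> frontier \<Omega>0" "wint wa = wlen wa *\<^sub>R a"
    "compat (far r') wa wa" "compat (far r') (chord a) wa" "compat (far r') wa (chord a)"
    using wa unfolding good_def by blast+
  have wb': "wpos wb" "wb \<noteq> []" "wvals wb \<subseteq> frontier \<Omega>0" "wint wb = wlen wb *\<^sub>R b"
    "compat (far r') wb wb" "compat (far r') (chord b) wb" "compat (far r') wb (chord b)"
    using wb unfolding good_def by blast+
  have la: "0 < wlen wa" and lb: "0 < wlen wb" using wa' wb' wlen_pos by auto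
  have "bounded (wvals wa \<union> wvals wb \<union> E)"
    unfolding E_def wvals_def by (simp add: finite_imp_bounded compact_imp_bounded[OF compact_segment])
  then obtain B1 where B1: "0 < B1" "\<And>y. y \<in> wvals wa \<union> wvals wb \<union> E \<Longrightarrow> norm y \<le> B1"
    unfolding bounded_pos by blast
  define B' where "B' = max B B1"
  \<comment> \<open>Exceeds the length of every unit: the chords have length
    \<open>1\<close>.\<close>
  define l' where "l' = 1 + wlen wa + wlen wb"
  have lB: "0 \<le> l'" "0 \<le> B'" using la lb B1 by (auto simp: l'_def B'_def)
  have EB: "E \<subseteq> cball 0 B'" using B1 by (auto simp: B'_def le_max_iff_disj)
  have unit_chord: "unit_ok E l' B' (chord m)" if "m \<in> E" for m
  proof -
    have "wvals (chord m) \<subseteq> cball 0 B'" using chord_props(6)[OF EM[OF that]] by (force simp: B'_def)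
    then show ?thesis unfolding unit_ok_def using EM[OF that] la lb that
      by (auto simp: l'_def intro!: bexI[of _ m])
  qed
  have unit_a: "unit_ok E l' B' wa"
    unfolding unit_ok_def using wa' B1 lb abE by (auto simp: l'_def B'_def le_max_iff_disj intro!: bexI[of _ a])
  have unit_b: "unit_ok E l' B' wb"
    unfolding unit_ok_def using wb' B1 la abE by (auto simp: l'_def B'_def le_max_iff_disj intro!: bexI[of _ b])
  \<comment> \<open>The threshold of \<open>safe_blocks\<close> for the loss \<open>r' - r\<close>;
    the summand \<open>1\<close> makes it positive.\<close>
  define \<Lambda> where "\<Lambda> = 2 * (l' * (2 * B')) / (r' - r) + 1"
  have \<Lambda>: "0 < \<Lambda>" "2 * (l' * (2 * B')) \<le> \<Lambda> * (r' - r)"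
  proof -
    have "0 \<le> 2 * (l' * (2 * B')) / (r' - r)" using lB r by (intro divide_nonneg_pos) auto
    then show "0 < \<Lambda>" by (simp add: \<Lambda>_def)
    have "\<Lambda> * (r' - r) = 2 * (l' * (2 * B')) + (r' - r)" using r by (simp add: \<Lambda>_def distrib_right)
    then show "2 * (l' * (2 * B')) \<le> \<Lambda> * (r' - r)" using r by simp
  qed
  obtain K where K: "\<Lambda> < real K" using reals_Archimedean2 by blast
  obtain n where n0: "dist a b < real n * \<delta>" using reals_Archimedean3[OF \<delta>] by blast
  have n: "0 < n" using n0 by (cases n) auto
  have dE: "dist y z < real n * \<delta>" if yE: "y \<in> E" and zE: "z \<in> E" for y z
  proof -
    obtain u where u: "0 \<le> u" "u \<le> 1" "y = (1 - u) *\<^sub>R a + u *\<^sub>R b"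
      using yE by (auto simp: E_def in_segment)
    obtain v where v: "0 \<le> v" "v \<le> 1" "z = (1 - v) *\<^sub>R a + v *\<^sub>R b"
      using zE by (auto simp: E_def in_segment)
    have "y - z = (v - u) *\<^sub>R (a - b)" unfolding u(3) v(3) by (simp add: algebra_simps)
    then have "dist y z = \<bar>v - u\<bar> * dist a b" by (simp add: dist_norm)
    also have "\<dots> \<le> 1 * dist a b" using u v by (intro mult_right_mono) auto
    finally show ?thesis using n0 by simp
  qed
  \<comment> \<open>The walks alone, which do not depend on the numbers of repetitions of
    \<open>wa\<close> and \<open>wb\<close> chosen later.\<close>
  define W where "W = walk K x a n @ walk K a x n @ walk K x b n @ walk K b x n"
  have W_set: "\<exists>m\<in>E. u = chord m \<and> k = K" if ku: "(k, u) \<in> set (walk K y z n)" and yz: "y \<in> E" "z \<in> E" for k u y z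
  proof -
    have "closed_segment y z \<subseteq> M" using sub[OF yz] EM by (auto intro: EM)
    then obtain m where "m \<in> closed_segment y z" "u = chord m" "k = K"
      using walk_set[OF _ n ku] by metis
    then show ?thesis using sub[OF yz] by blast
  qed
  have W_set': "\<exists>m\<in>E. u = chord m \<and> k = K" if "(k, u) \<in> set W" for k u
    using that W_set xE abE unfolding W_def by auto
  have "\<exists>c. wint u = wlen u *\<^sub>R x + c *\<^sub>R e" if "(k, u) \<in> set W" for k u
  proof -
    obtain m where m: "m \<in> E" "u = chord m" using W_set'[OF \<open>(k, u) \<in> set W\<close>] by blast
    then show ?thesis using point_on_line[of m a b x] EM[OF m(1)] xE by (simp add: E_def e_def)
  qed
  then obtain c0 where c0: "wint (wblocks W) = wlen (wblocks W) *\<^sub>R x + c0 *\<^sub>R e"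
    using blocks_on_line by blast
  define L0 where "L0 = wlen (wblocks W)"
  \<comment> \<open>A bound for the drift to be corrected: that of the walks, and that caused by
    repeating \<open>wb\<close> an integer number of times.\<close>
  define \<Xi> where "\<Xi> = \<bar>c0\<bar> + wlen wb"
  have \<Xi>: "0 < \<Xi>" using lb by (simp add: \<Xi>_def add_nonneg_pos)
  define \<mu> where "\<mu> = min s (1 - s)"
  have \<mu>: "0 < \<mu>" "\<mu> \<le> s" "\<mu> \<le> 1 - s" using s by (auto simp: \<mu>_def)
  \<comment> \<open>So many copies of the correcting chord that its point stays on the edge, is
    within \<open>\<delta>\<close> of \<open>x\<close>, and the block is long.\<close>
  obtain K2 where K2: "max (real K) (max (\<Xi> / \<mu>) (\<Xi> * norm e / \<delta>)) < real K2"
    using reals_Archimedean2 by blast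
  have K2': "\<Lambda> < real K2" "\<Xi> / real K2 \<le> \<mu>" "\<Xi> / real K2 * norm e < \<delta>" "0 < real K2"
  proof -
    have k: "real K < real K2" "\<Xi> / \<mu> < real K2" "\<Xi> * norm e / \<delta> < real K2" using K2 by auto
    then show "\<Lambda> < real K2" using K by linarith
    show k0: "0 < real K2" using k(1) of_nat_0_le_iff[of K] by linarith
    have "\<Xi> < real K2 * \<mu>" using k(2) \<mu>(1) by (simp add: divide_less_eq)
    then show "\<Xi> / real K2 \<le> \<mu>" using k0 by (simp add: divide_le_eq mult.commute)
    have "\<Xi> * norm e < real K2 * \<delta>" using k(3) \<delta> by (simp add: divide_less_eq)
    then show "\<Xi> / real K2 * norm e < \<delta>" using k0 by (simp add: divide_less_eq mult.commute)
  qed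
  define L1 where "L1 = L0 + real K2 + real K"
  define V where "V = (1 - s) * Va + s * Vb"
  \<comment> \<open>Collects the terms of the final inequality that stay bounded when the numbers of
    repetitions grow.\<close>
  define D where "D = wlen wb * \<bar>Vb\<bar> + \<bar>c * L1\<bar> + \<bar>V - \<epsilon>\<bar> * (\<bar>L1\<bar> + wlen wb)"
  have D: "0 \<le> D" unfolding D_def using lb by (intro add_nonneg_nonneg mult_nonneg_nonneg) auto
  \<comment> \<open>The summands ensure in turn that the block of \<open>wa\<close> is long, that
    \<open>\<epsilon> * T\<close> outweighs \<open>D\<close>, and that the block of
    \<open>wb\<close> is long even after rounding.\<close>
  obtain N where N: "\<Lambda> + D / \<epsilon> + (\<Lambda> + wlen wb) / s < real N * wlen wa"
    using reals_Archimedean3[OF la] by blast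
  \<comment> \<open>The joint length of both blocks if \<open>s * T\<close> were a multiple of
    \<open>wlen wb\<close>; rounding down loses \<open>\<tau>\<close>.\<close>
  define T where "T = real N * wlen wa / (1 - s)"
  have T: "real N * wlen wa = (1 - s) * T" using s by (simp add: T_def)
  have p1: "0 \<le> D / \<epsilon>" "0 < (\<Lambda> + wlen wb) / s" using D \<epsilon> \<Lambda> lb s by auto
  have NL: "\<Lambda> < real N * wlen wa" using N p1 by linarith
  have T0: "real N * wlen wa \<le> T"
    unfolding T_def using s la by (simp add: le_divide_eq mult_left_le mult_nonneg_nonneg)
  have T1: "D \<le> \<epsilon> * T"
  proof -
    have "D / \<epsilon> \<le> T" using N p1 T0 \<Lambda> by linarith
    then show ?thesis using \<epsilon> by (simp add: field_simps)
  qed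
  have T2: "\<Lambda> + wlen wb \<le> s * T"
  proof -
    have "(\<Lambda> + wlen wb) / s \<le> T" using N p1 T0 \<Lambda> by linarith
    then show ?thesis using s by (simp add: field_simps)
  qed
  define N' where "N' = nat \<lfloor>s * T / wlen wb\<rfloor>"
  define \<tau> where "\<tau> = s * T - real N' * wlen wb"
  have sT: "0 \<le> s * T / wlen wb" using T2 \<Lambda> lb by simp
  have N'1: "real N' \<le> s * T / wlen wb" "s * T / wlen wb < real N' + 1"
    using sT unfolding N'_def by (simp_all add: of_nat_nat)
  have \<tau>: "0 \<le> \<tau>" "\<tau> \<le> wlen wb"
    using N'1 lb unfolding \<tau>_def by (auto simp: field_simps)
  have N'L: "\<Lambda> \<le> real N' * wlen wb" using T2 \<tau> by (simp add: \<tau>_def)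
  \<comment> \<open>The drift along \<open>e\<close> that remains. Its bound does not involve
    \<open>N\<close>, which is why \<open>K2\<close> could be fixed before \<open>N\<close>.\<close>
  define \<xi> where "\<xi> = c0 - (1 - s) * \<tau>"
  have \<xi>: "\<bar>\<xi>\<bar> \<le> \<Xi>"
  proof -
    have "\<bar>(1 - s) * \<tau>\<bar> \<le> 1 * wlen wb" unfolding abs_mult using s \<tau> by (intro mult_mono) auto
    then show ?thesis unfolding \<xi>_def \<Xi>_def by linarith
  qed
  have \<xi>K: "\<bar>\<xi> / real K2\<bar> \<le> \<Xi> / real K2" using \<xi> K2'(4) by (simp add: divide_right_mono)
  define m where "m = x - (\<xi> / real K2) *\<^sub>R e"
  have mE: "m \<in> E"
  proof -
    have "m = (1 - (s - \<xi> / real K2)) *\<^sub>R a + (s - \<xi> / real K2) *\<^sub>R b"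
      by (simp add: m_def x_def e_def algebra_simps)
    moreover have "0 \<le> s - \<xi> / real K2" "s - \<xi> / real K2 \<le> 1" using \<xi>K K2'(2) \<mu> by linarith+
    ultimately show ?thesis unfolding E_def in_segment by blast
  qed
  have mx: "dist m x < \<delta>" "dist x m < \<delta>"
  proof -
    have "dist m x = \<bar>\<xi> / real K2\<bar> * norm e" by (simp add: m_def dist_norm)
    also have "\<dots> \<le> \<Xi> / real K2 * norm e" by (intro mult_right_mono \<xi>K norm_ge_zero)
    finally show "dist m x < \<delta>" using K2'(3) by linarith
    then show "dist x m < \<delta>" by (simp add: dist_commute)
  qed
  let ?C = "\<lambda>(n::nat, u) (n'::nat, u'). compat (far r') u u'"
  \<comment> \<open>Beginning and ending with the chord of \<open>x\<close> makes the list
    composable with itself and with that chord.\<close>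
  define nus where "nus = walk K x a n @ [(N, wa)] @ walk K a x n @ walk K x b n @ [(N', wb)] @ walk K b x n
      @ [(K2, chord m), (K, chord x)]"
  define Z where "Z = wblocks nus"
  have cc: "compat (far r') (chord y) (chord z)" if "y \<in> E" "z \<in> E" "dist y z < \<delta>" for y z
    using chord_compat[OF EM[OF that(1)] EM[OF that(2)] that(3)] compat_mono far_mono[OF r(2)] by blast
  have cr: "compat (far r') (chord y) (chord y)" if "y \<in> E" for y using cc[OF that that] \<delta> by simp
  have ws: "successively ?C (walk K y z n)" if "y \<in> E" "z \<in> E" for y z
    by (rule walk_successively[OF _ n dE[OF that] r(2)]) (use sub[OF that] EM in blast)
  note we = walk_ends[OF n]
  have succ: "successively ?C nus"
    unfolding nus_def
    using ws xE abE cr[OF xE] cr[OF abE(1)] cr[OF abE(2)] cc[OF xE mE mx(2)] cc[OF mE xE mx(1)] wa' wb'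
    by (simp add: successively_append_iff we successively_Cons)
  have lasthd: "nus \<noteq> []" "hd nus = (K, chord x)" "last nus = (K, chord x)"
    unfolding nus_def by (simp_all add: we)
  have nus_ok: "unit_ok E l' B' u \<and> compat (far r') u u \<and> \<Lambda> \<le> real k * wlen u"
    if ku: "(k, u) \<in> set nus" for k u
  proof -
    have chord_ok: "unit_ok E l' B' (chord y) \<and> compat (far r') (chord y) (chord y) \<and> \<Lambda> \<le> real k * wlen (chord y)"
      if "y \<in> E" "\<Lambda> \<le> real k" for y k
      using unit_chord cr that EM by simp
    from ku consider "(k, u) \<in> set W" | "k = N" "u = wa" | "k = N'" "u = wb"
      | "k = K2" "u = chord m" | "k = K" "u = chord x"
      unfolding nus_def W_def by auto
    then show ?thesis
    proof cases
      case 1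
      then obtain y where "y \<in> E" "u = chord y" "k = K" using W_set' by blast
      then show ?thesis using chord_ok[of y K] K by simp
    next
      case 2
      then show ?thesis using unit_a wa' NL by simp
    next
      case 3
      then show ?thesis using unit_b wb' N'L by simp
    next
      case 4
      then show ?thesis using chord_ok[OF mE, of K2] K2' by simp
    next
      case 5
      then show ?thesis using chord_ok[OF xE, of K] K by simp
    qed
  qed
  have safe_gen: "safe (far r) (wblocks nus')"
    if su: "successively ?C nus'"
      and se: "\<And>k u. (k, u) \<in> set nus' \<Longrightarrow> (k, u) \<in> set nus \<or> (u = chord x \<and> K \<le> k)" for nus'
  proof (rule safe_blocks[OF _ su])
    fix k u assume ku: "(k, u) \<in> set nus'"
    show "unit_ok E l' B' u \<and> compat (far r') u u \<and> \<Lambda> \<le> real k * wlen u"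
      using se[OF ku]
    proof
      assume "u = chord x \<and> K \<le> k"
      then show ?thesis using unit_chord[OF xE] cr[OF xE] K EM[OF xE] by simp
    qed (rule nus_ok)
  qed (use \<Lambda> lB EB Efar r abE in \<open>auto simp: E_def\<close>)
  have rep_succ: "successively ?C (concat (replicate k nus))" for k
    by (rule successively_concat_replicate[OF succ lasthd(1)]) (use lasthd cr[OF xE] in simp)
  have rep_hd: "hd (concat (replicate k nus)) = (K, chord x)" "last (concat (replicate k nus)) = (K, chord x)"
    if ne: "concat (replicate k nus) \<noteq> []" for k
  proof -
    obtain j where k: "k = Suc j" using ne by (cases k) auto
    then show "hd (concat (replicate k nus)) = (K, chord x)" using lasthd by simp
    have "concat (replicate k nus) = concat (replicate j nus) @ nus"
    proof -
      have "replicate (Suc j) nus = replicate j nus @ [nus]" by (simp add: replicate_append_same)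
      then show ?thesis unfolding k by simp
    qed
    then show "last (concat (replicate k nus)) = (K, chord x)" using lasthd by simp
  qed
  have Zpos: "wpos Z" unfolding Z_def wblocks_def
    using nus_ok by (intro wpos_concat) (auto simp: unit_ok_def)
  have xM: "x \<in> M" using xE EM by blast
  have ZZ: "compat (far r) Z Z"
    unfolding compat_def
  proof (intro allI)
    fix k k'
    have "safe (far r) (wblocks (concat (replicate (k + k') nus)))"
      by (rule safe_gen[OF rep_succ]) auto
    then show "safe (far r) (wrep k Z @ wrep k' Z)" by (simp add: wblocks_replicate Z_def)
  qed
  have cZ: "compat (far r) (chord x) Z"
    unfolding compat_def
  proof (intro allI)
    fix k k'
    \<comment> \<open>A run of \<open>k\<close> chords may be too short for a block, so
      \<open>K\<close> more are put in front and removed again by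
      \<open>safe_suffix\<close>.\<close>
    have "safe (far r) (wblocks ((K + k, chord x) # concat (replicate k' nus)))"
    proof (rule safe_gen)
      show "successively ?C ((K + k, chord x) # concat (replicate k' nus))"
        using rep_succ[of k'] rep_hd[of k'] cr[OF xE] by (auto simp: successively_Cons)
    qed auto
    then have "safe (far r) (wrep K (chord x) @ (wrep k (chord x) @ wrep k' Z))"
      by (simp add: wblocks_replicate Z_def)
    then show "safe (far r) (wrep k (chord x) @ wrep k' Z)"
      by (rule safe_suffix) (use Zpos xM in auto)
  qed
  have Zc: "compat (far r) Z (chord x)"
    unfolding compat_def
  proof (intro allI)
    fix k k'
    have "safe (far r) (wblocks (concat (replicate k nus) @ [(k' + K, chord x)]))"
    proof (rule safe_gen)
      show "successively ?C (concat (replicate k nus) @ [(k' + K, chord x)])"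
        using rep_succ[of k] rep_hd[of k] cr[OF xE] by (auto simp: successively_append_iff)
    qed auto
    then have "safe (far r) ((wrep k Z @ wrep k' (chord x)) @ wrep K (chord x))"
      by (simp add: wblocks_replicate Z_def)
    then show "safe (far r) (wrep k Z @ wrep k' (chord x))"
      by (rule safe_prefix) (use Zpos xM in auto)
  qed
  have mM: "m \<in> M" using mE EM by blast
  have Zlen: "wlen Z = L1 + T - \<tau>"
    using mM xM T by (simp add: Z_def nus_def L1_def L0_def W_def \<tau>_def algebra_simps)
  have Zint: "wint Z = wlen Z *\<^sub>R x"
  proof -
    have "wint Z = wint (wblocks W) + (real N * wlen wa) *\<^sub>R a + (real N' * wlen wb) *\<^sub>R b + real K2 *\<^sub>R m + real K *\<^sub>R x"
      using mM xM wa' wb' by (simp add: Z_def nus_def W_def algebra_simps)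
    also have "\<dots> = (L0 + real N * wlen wa + real N' * wlen wb + real K2 + real K) *\<^sub>R x
        + (c0 - s * (real N * wlen wa) + (1 - s) * (real N' * wlen wb)) *\<^sub>R e - real K2 *\<^sub>R ((\<xi> / real K2) *\<^sub>R e)"
      unfolding c0 m_def L0_def by (subst ax, subst bx) (simp add: algebra_simps)
    also have "c0 - s * (real N * wlen wa) + (1 - s) * (real N' * wlen wb) = \<xi>"
      unfolding T \<xi>_def \<tau>_def by (simp add: algebra_simps)
    also have "L0 + real N * wlen wa + real N' * wlen wb + real K2 + real K = wlen Z"
      using T by (simp add: Zlen L1_def \<tau>_def algebra_simps)
    finally show ?thesis using K2'(4) by simp
  qed
  have Zvals: "wvals Z \<subseteq> frontier \<Omega>0"
  proof -
    have nv: "wvals u \<subseteq> frontier \<Omega>0" if "(k, u) \<in> set nus" for k u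
    proof -
      have "(k, u) \<in> set W \<or> u = wa \<or> u = wb \<or> u = chord m \<or> u = chord x"
        using that unfolding nus_def W_def by auto
      then have "u = wa \<or> u = wb \<or> (\<exists>y\<in>M. u = chord y)" using W_set' EM mM xM by blast
      then show ?thesis using wa' wb' chord_props(5) by blast
    qed
    have "wvals (wblocks ns) \<subseteq> frontier \<Omega>0" if "\<And>k u. (k, u) \<in> set ns \<Longrightarrow> wvals u \<subseteq> frontier \<Omega>0" for ns :: "(nat \<times> 'a word) list"
      using that
    proof (induction ns)
      case (Cons a ns)
      obtain k u where a: "a = (k, u)" by (cases a)
      have "wvals u \<subseteq> frontier \<Omega>0" using Cons.prems a by auto
      then have "wvals (wrep k u) \<subseteq> frontier \<Omega>0" by (rule subset_trans[OF wvals_wrep])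
      moreover have "wvals (wblocks ns) \<subseteq> frontier \<Omega>0" using Cons by auto
      ultimately show ?case by (simp add: a)
    qed simp
    from this[OF nv] show ?thesis unfolding Z_def .
  qed
  have Wpos: "wpos (wblocks W)"
    unfolding wblocks_def
  proof (rule wpos_concat)
    fix w assume "w \<in> set (map (\<lambda>(n, u). wrep n u) W)"
    then obtain k u where ku: "(k, u) \<in> set W" "w = wrep k u" by auto
    obtain y where "y \<in> E" "u = chord y" using W_set'[OF ku(1)] by blast
    then show "wpos w" using chord_props(1)[OF EM] ku(2) by simp
  qed
  have "Z \<noteq> []"
  proof
    assume "Z = []"
    then have "wlen Z = 0" by simp
    moreover have "0 < wlen Z"
    proof -
      have "0 \<le> L0" unfolding L0_def by (rule wlen_nonneg[OF Wpos])
      moreover have "s * T \<le> 1 * T" using T0 NL \<Lambda> s by (intro mult_right_mono) auto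
      ultimately show ?thesis using T2 \<tau> \<Lambda> K2' unfolding Zlen L1_def by simp
    qed
    ultimately show False by simp
  qed
  then have goodZ: "good r Z x" unfolding good_def using Zpos Zvals Zint ZZ cZ Zc by blast
  have fZ: "wfint f Z = real N * wfint f wa + real N' * wfint f wb + wfint f (wblocks W) + real K2 * wfint f (chord m) + real K * wfint f (chord x)"
    by (simp add: Z_def nus_def W_def)
  have cW: "c * L0 \<le> wfint f (wblocks W)"
    unfolding L0_def
  proof (rule wfint_ge)
    show "wpos (wblocks W)" by (rule Wpos)
    fix y assume "y \<in> wvals (wblocks W)"
    then have "y \<in> wvals Z" by (auto simp: Z_def nus_def W_def)
    then show "c \<le> f y" using c Zvals by blast
  qed
  have cch: "c \<le> wfint f (chord y)" if "y \<in> M" for y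
    using wfint_ge[of "chord y" c f] that c ends by auto
  have "real N * (Va * wlen wa) + real N' * (Vb * wlen wb) + c * L0 + real K2 * c + real K * c \<le> wfint f Z"
    unfolding fZ by (intro add_mono mult_left_mono Va Vb cW cch mM xM) auto
  also have "real N * (Va * wlen wa) + real N' * (Vb * wlen wb) + c * L0 + real K2 * c + real K * c
      = Va * (real N * wlen wa) + Vb * (real N' * wlen wb) + c * L1"
    by (simp add: L1_def algebra_simps)
  also have "\<dots> = T * V - \<tau> * Vb + c * L1"
    unfolding T V_def by (simp add: \<tau>_def algebra_simps)
  finally have f1: "T * V - \<tau> * Vb + c * L1 \<le> wfint f Z" .
  have "(V - \<epsilon>) * wlen Z = T * V - \<epsilon> * T + (V - \<epsilon>) * (L1 - \<tau>)"
    unfolding Zlen by (simp add: algebra_simps)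
  moreover have "(V - \<epsilon>) * (L1 - \<tau>) \<le> \<bar>V - \<epsilon>\<bar> * (\<bar>L1\<bar> + wlen wb)"
  proof -
    have "(V - \<epsilon>) * (L1 - \<tau>) \<le> \<bar>V - \<epsilon>\<bar> * \<bar>L1 - \<tau>\<bar>" by (metis abs_ge_self abs_mult)
    also have "\<dots> \<le> \<bar>V - \<epsilon>\<bar> * (\<bar>L1\<bar> + wlen wb)" using \<tau> by (intro mult_left_mono) auto
    finally show ?thesis .
  qed
  moreover have "\<tau> * Vb \<le> wlen wb * \<bar>Vb\<bar>"
    using \<tau> by (smt (verit) mult_mono abs_ge_zero mult_left_mono)
  moreover have "- (c * L1) \<le> \<bar>c * L1\<bar>" by simp
  ultimately have "(V - \<epsilon>) * wlen Z \<le> T * V - \<tau> * Vb + c * L1"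
    using T1 unfolding D_def by linarith
  then show ?thesis using f1 goodZ unfolding V_def x_def by (intro exI[of _ Z]) auto
qed

text \<open>Each step of the martingale costs some distance from \<open>\<Omega>1\<close> and some
  value. Halving the margin \<open>r1 - r\<close> and \<open>\<epsilon>\<close> at every node leaves
  something for each level of the tree, whatever its depth.\<close>

lemma reach_good:
  assumes "reach M (frontier \<Omega>0) f x V" and c: "\<And>y. y \<in> frontier \<Omega>0 \<Longrightarrow> c \<le> f y"
    and "r < r1" "0 < \<epsilon>"
  shows "\<exists>w. good r w x \<and> (V - \<epsilon>) * wlen w \<le> wfint f w"
  using assms(1,3,4)
proof (induction arbitrary: r \<epsilon> rule: reach.induct)
  case (leaf x)
  have "good r [(1, x)] x"
    by (rule good_mono[OF good_leaf[OF leaf.hyps]]) (use leaf.prems in simp)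
  moreover have "(f x - \<epsilon>) * wlen [(1, x)] \<le> wfint f [(1, x)]"
    using leaf.prems by (simp add: wfint_def)
  ultimately show ?case by blast
next
  case (node a V b W s)
  show ?case
  proof (cases "s = 0 \<or> s = 1")
    case True
    then show ?thesis using node.IH(1)[OF node.prems] node.IH(2)[OF node.prems] by auto
  next
    case False
    define r' where "r' = (r + r1) / 2"
    have r': "r < r'" "r' < r1" using node.prems by (auto simp: r'_def)
    obtain wa where wa: "good r' wa a" "(V - \<epsilon>/2) * wlen wa \<le> wfint f wa"
      using node.IH(1)[OF r'(2), of "\<epsilon>/2"] node.prems by auto
    obtain wb where wb: "good r' wb b" "(W - \<epsilon>/2) * wlen wb \<le> wfint f wb"
      using node.IH(2)[OF r'(2), of "\<epsilon>/2"] node.prems by auto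
    have "\<exists>w. good r w ((1 - s) *\<^sub>R a + s *\<^sub>R b) \<and> ((1 - s) * (V - \<epsilon>/2) + s * (W - \<epsilon>/2) - \<epsilon>/2) * wlen w \<le> wfint f w"
      by (rule good_node[OF node.hyps(3) _ _ wa(1) wb(1) r'(1) _ wa(2) wb(2) c])
         (use False node r' in auto)
    moreover have "(1 - s) * (V - \<epsilon>/2) + s * (W - \<epsilon>/2) - \<epsilon>/2 = (1 - s) * V + s * W - \<epsilon>"
      by (simp add: field_simps)
    ultimately show ?thesis by simp
  qed
qed

end

section \<open>Admissible functions from words\<close>

lemma nondegenerate_interval_bounds:
  assumes "nondegenerate_interval J"
  obtains a b where "a < b" "{a<..<b} \<subseteq> J" "J \<subseteq> {a..b}"
proof -
  have J: "is_interval J" "bounded J" "interior J \<noteq> {}" using assms by (auto simp: nondegenerate_interval_def)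
  obtain x where "x \<in> interior J" using J by auto
  then obtain e where e: "e > 0" "cball x e \<subseteq> J" using mem_interior_cball by blast
  have xJ: "x \<in> J" "x + e \<in> J" using e by (auto simp: dist_norm)
  have bdd: "bdd_below J" "bdd_above J" using J(2) by (auto intro: bounded_imp_bdd_below bounded_imp_bdd_above)
  define a where "a = Inf J"
  define b where "b = Sup J"
  have "a \<le> x" "x + e \<le> b" using xJ bdd by (auto simp: a_def b_def intro: cInf_lower cSup_upper)
  moreover have "J \<subseteq> {a..b}" using bdd by (auto simp: a_def b_def intro: cInf_lower cSup_upper)
  moreover have "{a<..<b} \<subseteq> J"
  proof
    fix t assume t: "t \<in> {a<..<b}"
    obtain y where y: "y \<in> J" "y < t" using t xJ cInf_lessD[of J t] by (auto simp: a_def)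
    obtain z where z: "z \<in> J" "t < z" using t xJ less_cSupD[of J t] by (auto simp: b_def)
    show "t \<in> J" using J(1) y z unfolding is_interval_1 by (meson less_imp_le)
  qed
  ultimately show ?thesis using that[of a b] e by auto
qed

lemma interval_eq_interior_Un:
  fixes a b :: real
  assumes "{a<..<b} \<subseteq> J" "J \<subseteq> {a..b}"
  shows "J = {a<..<b} \<union> (J \<inter> {a, b})"
  using assms by force

lemma interval_measurable:
  assumes "a < b" "{a<..<b} \<subseteq> J" "J \<subseteq> {a..b::real}"
  shows "J \<in> sets lebesgue" "measure lebesgue J = b - a"
proof -
  define N where "N = J \<inter> {a, b}"
  have "negligible N" by (rule negligible_finite) (simp add: N_def)
  then have n: "N \<in> null_sets lebesgue" by (simp add: negligible_iff_null_sets)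
  have e: "J = {a<..<b} \<union> N" using interval_eq_interior_Un[OF assms(2,3)] by (simp only: N_def)
  have s: "{a<..<b} \<in> sets lebesgue" by simp
  show "J \<in> sets lebesgue" unfolding e using n by auto
  show "measure lebesgue J = b - a" unfolding e measure_Un_null_set[OF s n] using assms(1) by simp
qed

lemma integrable_on_interval:
  fixes \<phi> :: "real \<Rightarrow> 'b::euclidean_space"
  assumes "a < b" "{a<..<b} \<subseteq> J" "J \<subseteq> {a..b}"
  shows "integrable (lebesgue_on J) \<phi> \<longleftrightarrow> \<phi> absolutely_integrable_on {a..b}"
proof -
  have "integrable (lebesgue_on J) \<phi> \<longleftrightarrow> \<phi> absolutely_integrable_on J"
    unfolding set_integrable_def using interval_measurable(1)[OF assms] by (simp add: integrable_restrict_space)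
  also have "\<dots> \<longleftrightarrow> \<phi> absolutely_integrable_on {a..b}"
  proof (rule absolutely_integrable_spike_set_eq)
    show "negligible {x \<in> J - {a..b}. \<phi> x \<noteq> 0}" using assms(3) by (intro negligible_subset[OF negligible_empty]) auto
    show "negligible {x \<in> {a..b} - J. \<phi> x \<noteq> 0}"
      using assms(2) by (intro negligible_subset[OF negligible_finite[of "{a, b}"]]) force+
  qed
  finally show ?thesis .
qed

lemma lebesgue_integral_interval:
  fixes \<phi> :: "real \<Rightarrow> 'b::euclidean_space"
  assumes "a < b" "{a<..<b} \<subseteq> J" "J \<subseteq> {a..b}" and int: "integrable (lebesgue_on J) \<phi>"
  shows "(LINT t|lebesgue_on J. \<phi> t) = integral {a..b} \<phi>"
proof -
  have "(LINT t|lebesgue_on J. \<phi> t) = integral J \<phi>"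
    by (rule lebesgue_integral_eq_integral[OF int interval_measurable(1)[OF assms(1-3)]])
  also have "\<dots> = integral {a..b} \<phi>"
  proof (rule integral_spike_set)
    show "negligible {x \<in> J - {a..b}. \<phi> x \<noteq> 0}" using assms(3) by (intro negligible_subset[OF negligible_empty]) auto
    show "negligible {x \<in> {a..b} - J. \<phi> x \<noteq> 0}"
      using assms(2) by (intro negligible_subset[OF negligible_finite[of "{a, b}"]]) force+
  qed
  finally show ?thesis .
qed

lemma average_interval:
  fixes \<phi> :: "real \<Rightarrow> 'b::euclidean_space"
  assumes "a < b" "{a<..<b} \<subseteq> J" "J \<subseteq> {a..b}" and "integrable (lebesgue_on J) \<phi>"
  shows "average J \<phi> = integral {a..b} \<phi> /\<^sub>R (b - a)"
  using lebesgue_integral_interval[OF assms] interval_measurable(2)[OF assms(1-3)]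
  by (simp add: average_def divide_inverse)

lemma ext_average_integrable:
  assumes "integrable (lebesgue_on E) g" "0 < measure lebesgue E"
  shows "ext_average E g = ereal ((LINT t|lebesgue_on E. g t) / measure lebesgue E)"
proof -
  have fin: "(\<integral>\<^sup>+t. ennreal (g t) \<partial>lebesgue_on E) \<noteq> \<infinity>" "(\<integral>\<^sup>+t. ennreal (- g t) \<partial>lebesgue_on E) \<noteq> \<infinity>"
    using assms by (auto simp: real_integrable_def)
  have e: "enn2ereal z = ereal (enn2real z)" if "z \<noteq> \<infinity>" for z :: ennreal
    using that by (cases z) (auto simp: enn2ereal_ennreal)
  show ?thesis
    unfolding ext_average_def real_lebesgue_integral_def[OF assms(1)] e[OF fin(1)] e[OF fin(2)]
    using assms(2) by simp
qed

text \<open>The last value is continued indefinitely, so that all values, also those outside the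
  domain of the step function, are values of the word.\<close>

fun wfun :: "'b word \<Rightarrow> real \<Rightarrow> 'b" where
  "wfun [] t = undefined"
| "wfun [(l, p)] t = p"
| "wfun ((l, p) # a # w) t = (if t < l then p else wfun (a # w) (t - l))"

lemma wfun_in: "w \<noteq> [] \<Longrightarrow> wfun w t \<in> wvals w"
  by (induction w t rule: wfun.induct) (auto simp: wvals_def)

lemma wfun_map: "w \<noteq> [] \<Longrightarrow> wfun (map (\<lambda>(l, p). (l, g p)) w) t = g (wfun w t)"
  by (induction w t rule: wfun.induct) auto

lemma wfun_has_integral:
  fixes w :: "'b::euclidean_space word"
  assumes "wpos w" "0 \<le> s" "s \<le> t" "t \<le> wlen w"
  shows "(wfun w has_integral (wprim w t - wprim w s)) {s..t}"
  using assms
proof (induction w arbitrary: s t)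
  case Nil
  then show ?case by auto
next
  case (Cons a w)
  obtain l p where a: "a = (l, p)" by (cases a)
  have l: "0 < l" "wpos w" using Cons.prems a by auto
  have left: "(wfun (a # w) has_integral (wprim (a # w) t - wprim (a # w) s)) {s..t}" if "s \<le> t" "t \<le> l" for s t
  proof (rule has_integral_spike_finite[of "{l}"])
    show "wfun (a # w) x = p" if "x \<in> {s..t} - {l}" for x
      using that \<open>t \<le> l\<close> by (cases w) (auto simp: a)
    show "((\<lambda>x. p) has_integral (wprim (a # w) t - wprim (a # w) s)) {s..t}"
      using has_integral_const_real[of p s t] that by (simp add: a scaleR_diff_left)
  qed simp
  have right: "(wfun (a # w) has_integral (wprim (a # w) t - wprim (a # w) s)) {s..t}"
    if "l \<le> s" "s \<le> t" "t \<le> wlen (a # w)" for s t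
  proof (cases w)
    case Nil
    then have "s = t" "s = l" using that a by auto
    then show ?thesis by (intro left) auto
  next
    case (Cons b w')
    have "(wfun w has_integral (wprim w (t - l) - wprim w (s - l))) {s - l..t - l}"
      by (rule Cons.IH) (use that l a in auto)
    then have "((\<lambda>x. wfun w (x + - l)) has_integral (wprim w (t - l) - wprim w (s - l))) {s - l - - l..t - l - - l}"
      by (rule has_integral_shift_real_ivl)
    then have 1: "((\<lambda>x. wfun w (x - l)) has_integral (wprim w (t - l) - wprim w (s - l))) {s..t}" by simp
    have 2: "wprim (a # w) y = l *\<^sub>R p + wprim w (y - l)" if "l \<le> y" for y
      using that l by (cases "y = l") (auto simp: a)
    have "wprim (a # w) t - wprim (a # w) s = wprim w (t - l) - wprim w (s - l)"
      using 2[of t] 2[of s] that by simp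
    moreover have "wfun (a # w) x = wfun w (x - l)" if "x \<in> {s..t}" for x
      using that \<open>l \<le> s\<close> local.Cons a by simp
    ultimately show ?thesis using 1 by (metis (no_types, lifting) has_integral_cong)
  qed
  consider "t \<le> l" | "l \<le> s" | "s \<le> l" "l \<le> t" by linarith
  then show ?case
  proof cases
    case 1 then show ?thesis using left Cons.prems by simp
  next
    case 2 then show ?thesis using right Cons.prems by simp
  next
    case 3
    have "(wfun (a # w) has_integral ((wprim (a # w) l - wprim (a # w) s) + (wprim (a # w) t - wprim (a # w) l))) {s..t}"
      by (rule has_integral_combine[OF 3 left[OF 3(1) order_refl] right[OF order_refl 3(2) Cons.prems(4)]])
    then show ?thesis by simp
  qed
qed

lemma wmap_props:
  "wlen (map (\<lambda>(l, p). (l, g p)) w) = wlen w" "wpos (map (\<lambda>(l, p). (l, g p)) w) \<longleftrightarrow> wpos w"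
  by (induction w) auto

definition wscale :: "real \<Rightarrow> 'b word \<Rightarrow> 'b word" where
  "wscale c w = map (\<lambda>(l, p). (c * l, p)) w"

lemma wscale_props:
  assumes "0 < c"
  shows "wlen (wscale c w) = c * wlen w" "wint (wscale c w) = c *\<^sub>R wint w" "wvals (wscale c w) = wvals w"
    "wpos (wscale c w) \<longleftrightarrow> wpos w" "wscale c w = [] \<longleftrightarrow> w = []"
  using assms by (induction w) (auto simp: wscale_def algebra_simps zero_less_mult_iff)

lemma wprim_wscale:
  assumes "0 < c" shows "wprim (wscale c w) (c * t) = c *\<^sub>R wprim w t"
proof (induction w arbitrary: t)
  case (Cons a w)
  obtain l p where a: "a = (l, p)" by (cases a)
  have "c * t - c * l = c * (t - l)" by (simp add: algebra_simps)
  then show ?case using Cons.IH[of "t - l"] assms a by (simp add: wscale_def scaleR_add_right)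
qed (simp add: wscale_def)

lemma safe_wscale:
  assumes "0 < c" "safe F w" shows "safe F (wscale c w)"
  unfolding safe_def
proof (intro allI impI)
  fix s t assume st: "0 \<le> s" "s < t" "t \<le> wlen (wscale c w)"
  have "(wprim w (t / c) - wprim w (s / c)) /\<^sub>R (t / c - s / c) \<in> F"
    using assms(2) st assms(1) unfolding safe_def
    by (simp add: wscale_props divide_strict_right_mono divide_le_eq mult.commute)
  moreover have "wprim (wscale c w) y = c *\<^sub>R wprim w (y / c)" for y
    using wprim_wscale[OF assms(1), of w "y / c"] assms(1) by simp
  moreover have "inverse (t / c - s / c) = inverse (t - s) * c"
    using assms(1) st by (simp add: field_simps)
  ultimately show "(wprim (wscale c w) t - wprim (wscale c w) s) /\<^sub>R (t - s) \<in> F"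
    by (simp add: scaleR_diff_right)
qed

lemma word_function:
  fixes w :: "'b::euclidean_space word"
  assumes w: "wpos w" "w \<noteq> []" and len: "wlen w = b - a" and ab: "a \<le> s" "s < t" "t \<le> b"
    and J: "{s<..<t} \<subseteq> J" "J \<subseteq> {s..t}"
  shows "integrable (lebesgue_on J) (\<lambda>x. wfun w (x - a))"
    and "(LINT x|lebesgue_on J. wfun w (x - a)) = wprim w (t - a) - wprim w (s - a)"
proof -
  \<comment> \<open>Stated for words in an arbitrary space: the word of the norms then yields
    absolute integrability.\<close>
  have hi: "((\<lambda>x. wfun v (x - a)) has_integral (wprim v (t - a) - wprim v (s - a))) {s..t}"
    if "wpos v" "wlen v = wlen w" for v :: "'c::euclidean_space word"
  proof -
    have "(wfun v has_integral (wprim v (t - a) - wprim v (s - a))) {s - a..t - a}"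
      by (rule wfun_has_integral) (use that len ab in auto)
    then have "((\<lambda>x. wfun v (x + - a)) has_integral (wprim v (t - a) - wprim v (s - a))) {s - a - - a..t - a - - a}"
      by (rule has_integral_shift_real_ivl)
    then show ?thesis by simp
  qed
  have "(\<lambda>x. norm (wfun w (x - a))) integrable_on {s..t}"
    using hi[of "map (\<lambda>(l, p). (l, norm p)) w"] w by (auto simp: wmap_props wfun_map)
  then have "(\<lambda>x. wfun w (x - a)) absolutely_integrable_on {s..t}"
    unfolding absolutely_integrable_on_def using hi[OF w(1)] by auto
  then show 1: "integrable (lebesgue_on J) (\<lambda>x. wfun w (x - a))"
    using integrable_on_interval[OF ab(2) J] by blast
  show "(LINT x|lebesgue_on J. wfun w (x - a)) = wprim w (t - a) - wprim w (s - a)"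
    unfolding lebesgue_integral_interval[OF ab(2) J 1] by (rule integral_unique[OF hi[OF w(1) refl]])
qed

context convex_annulus
begin

text \<open>Stretching the word to the length of \<open>I\<close> changes neither its averages nor
  its mean value of \<open>f\<close>.\<close>

lemma Bellman_ge_word:
  assumes w0: "wpos w0" "w0 \<noteq> []" "wvals w0 \<subseteq> frontier \<Omega>0" "wint w0 = wlen w0 *\<^sub>R x"
    and safe: "safe (far r) w0" "0 < r" and I: "nondegenerate_interval I"
  shows "ereal (wint (map (\<lambda>(l, p). (l, f p)) w0) / wlen w0) \<le> Bellman \<Omega>0 \<Omega>1 I f x"
proof -
  obtain a b where ab: "a < b" "{a<..<b} \<subseteq> I" "I \<subseteq> {a..b}" using nondegenerate_interval_bounds[OF I] by blast
  define c where "c = (b - a) / wlen w0"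
  have len0: "0 < wlen w0" using w0 wlen_pos by blast
  have c: "0 < c" using ab len0 by (simp add: c_def)
  define w where "w = wscale c w0"
  have w: "wpos w" "w \<noteq> []" "wvals w \<subseteq> frontier \<Omega>0" "wlen w = b - a" "wint w = (b - a) *\<^sub>R x" "safe (far r) w"
    using w0 wscale_props[OF c, of w0] safe_wscale[OF c safe(1)] len0 by (auto simp: w_def c_def)
  define \<phi> where "\<phi> t = wfun w (t - a)" for t
  define wf where "wf = map (\<lambda>(l, p). (l, f p)) w"
  have wf: "wpos wf" "wf \<noteq> []" "wlen wf = b - a" using w by (auto simp: wf_def wmap_props)
  have f\<phi>: "f (\<phi> t) = wfun wf (t - a)" for t
    by (simp add: \<phi>_def wf_def wfun_map[OF w(2)])
  have avg: "average J \<phi> = (wprim w (t - a) - wprim w (s - a)) /\<^sub>R (t - s)"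
    if "a \<le> s" "s < t" "t \<le> b" "{s<..<t} \<subseteq> J" "J \<subseteq> {s..t}" for J s t
    using word_function(2)[OF w(1,2,4) that] interval_measurable(2)[OF that(2,4,5)]
    by (simp add: average_def \<phi>_def divide_inverse)
  have ends: "wprim w (b - a) = wint w" "wprim w (a - a) = 0" "wprim wf (b - a) = wint wf" "wprim wf (a - a) = 0"
    using wprim_wlen[OF w(1)] wprim_wlen[OF wf(1)] w wf by auto
  have "\<phi> \<in> admissible \<Omega>0 \<Omega>1 I"
    unfolding admissible_def
  proof (intro CollectI conjI allI impI)
    show "\<phi> \<in> I \<rightarrow> frontier \<Omega>0" using wfun_in[OF w(2)] w(3) by (auto simp: \<phi>_def)
    show "integrable (lebesgue_on I) \<phi>"
      unfolding \<phi>_def by (rule word_function(1)[OF w(1,2,4) order_refl ab(1) order_refl ab(2,3)])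
    fix J assume "nondegenerate_interval J" and JI: "J \<subseteq> I"
    then obtain s t where st: "s < t" "{s<..<t} \<subseteq> J" "J \<subseteq> {s..t}" using nondegenerate_interval_bounds by blast
    have "{s<..<t} \<subseteq> {a..b}" using st JI ab by blast
    then have sb: "a \<le> s" "t \<le> b" using st(1) by (auto simp: greaterThanLessThan_subseteq_atLeastAtMost_iff)
    have "average J \<phi> \<in> far r"
      unfolding avg[OF sb(1) st(1) sb(2) st(2,3)]
      using w(6)[unfolded safe_def, rule_format, of "s - a" "t - a"] sb st w(4) by simp
    then show "average J \<phi> \<notin> \<Omega>1" using safe(2) by (force simp: far_def)
  qed
  moreover have "average I \<phi> = x"
    unfolding avg[OF order_refl ab(1) order_refl ab(2,3)] ends using ab w by simp
  moreover have I_pos: "0 < measure lebesgue I" using interval_measurable(2)[OF ab] ab by simp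
  have "ext_average I (\<lambda>t. f (\<phi> t)) = ereal (wint wf / (b - a))"
    unfolding f\<phi> ext_average_integrable[OF word_function(1)[OF wf(1,2,3) order_refl ab(1) order_refl ab(2,3)] I_pos]
      word_function(2)[OF wf(1,2,3) order_refl ab(1) order_refl ab(2,3)] interval_measurable(2)[OF ab] ends
    by simp
  moreover have "wint wf / (b - a) = wint (map (\<lambda>(l, p). (l, f p)) w0) / wlen w0"
  proof -
    have "wf = wscale c (map (\<lambda>(l, p). (l, f p)) w0)" by (auto simp: wf_def w_def wscale_def)
    then have "wint wf = c * wint (map (\<lambda>(l, p). (l, f p)) w0)" by (simp add: wscale_props(2)[OF c])
    then show ?thesis using len0 ab by (simp add: c_def)
  qed
  ultimately have "\<phi> \<in> {\<phi> \<in> admissible \<Omega>0 \<Omega>1 I. average I \<phi> = x}"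
    "ext_average I (\<lambda>t. f (\<phi> t)) = ereal (wint (map (\<lambda>(l, p). (l, f p)) w0) / wlen w0)" by simp_all
  then show ?thesis unfolding Bellman_def by (intro SUP_upper2[of \<phi>]) simp_all
qed

text \<open>The words of \<open>reach_good\<close> have mean exactly \<open>x\<close>; only their
  values are approximate, and that is absorbed by the supremum.\<close>

lemma Bellman_ge_reach:
  assumes reach: "reach (away r R) (frontier \<Omega>0) f x V" and r: "0 < r"
    and c: "\<And>y. y \<in> frontier \<Omega>0 \<Longrightarrow> c \<le> f y" and I: "nondegenerate_interval I"
  shows "ereal V \<le> Bellman \<Omega>0 \<Omega>1 I f x"
proof (rule default_chords[OF r, of R])
  fix r1 \<delta> B l and p q :: "'a \<Rightarrow> 'a"
  assume fam: "0 < r1" "0 < \<delta>"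
    "\<And>m. m \<in> away r R \<Longrightarrow> 0 < l m \<and> l m < 1 \<and> m = (1 - l m) *\<^sub>R p m + l m *\<^sub>R q m"
    "\<And>m. m \<in> away r R \<Longrightarrow> p m \<in> frontier \<Omega>0 \<and> q m \<in> frontier \<Omega>0 \<and> norm (p m) \<le> B \<and> norm (q m) \<le> B"
    "\<And>m. m \<in> frontier \<Omega>0 \<Longrightarrow> p m = m \<and> q m = m"
    "\<And>m m'. m \<in> away r R \<Longrightarrow> m' \<in> away r R \<Longrightarrow> dist m m' < \<delta> \<Longrightarrow>
       \<exists>X. convex X \<and> {p m, q m, p m', q m'} \<subseteq> X \<and> X \<subseteq> far r1"
  interpret chord_family \<Omega>0 \<Omega>1 "away r R" r1 \<delta> B l p q
    by unfold_locales ((rule fam; assumption) | fact fam)+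
  show ?thesis
  proof (rule ereal_le_epsilon2)
    fix e :: real assume e: "0 < e"
    obtain w where w: "good (r1/2) w x" "(V - e) * wlen w \<le> wfint f w"
      using reach_good[OF reach c _ e, of "r1/2"] fam(1) by auto
    have w': "wpos w" "w \<noteq> []" "wvals w \<subseteq> frontier \<Omega>0" "wint w = wlen w *\<^sub>R x" "compat (far (r1/2)) w w"
      using w(1) unfolding good_def by auto
    have "safe (far (r1/2)) (wrep 1 w @ wrep 0 w)" using w'(5) unfolding compat_def by blast
    then have "safe (far (r1/2)) w" by simp
    then have "ereal (wfint f w / wlen w) \<le> Bellman \<Omega>0 \<Omega>1 I f x"
      unfolding wfint_def using Bellman_ge_word[OF w'(1-4) _ _ I] fam(1) by simp
    moreover have "V - e \<le> wfint f w / wlen w"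
      using w(2) wlen_pos[OF w'(1,2)] by (simp add: le_divide_eq)
    ultimately have "ereal (V - e) \<le> Bellman \<Omega>0 \<Omega>1 I f x" by (metis ereal_less_eq(3) order_trans)
    then have "ereal (V - e) + ereal e \<le> Bellman \<Omega>0 \<Omega>1 I f x + ereal e" by (rule add_right_mono)
    then show "ereal V \<le> Bellman \<Omega>0 \<Omega>1 I f x + ereal e" by simp
  qed
qed

end

section \<open>Pushing martingales off the inner boundary\<close>

text \<open>The homothety with centre \<open>c\<close> and ratio
  \<open>1 + \<delta>\<close>.\<close>

definition dil :: "'a::real_vector \<Rightarrow> real \<Rightarrow> 'a \<Rightarrow> 'a" where
  "dil c \<delta> y = c + (1 + \<delta>) *\<^sub>R (y - c)"

lemma dil_affine: "dil c \<delta> ((1 - u) *\<^sub>R a + u *\<^sub>R b) = (1 - u) *\<^sub>R dil c \<delta> a + u *\<^sub>R dil c \<delta> b"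
  by (simp add: dil_def algebra_simps)

lemma dil_line: "dil c \<delta> (x + t *\<^sub>R (a - x)) = dil c \<delta> x + t *\<^sub>R (dil c \<delta> a - dil c \<delta> x)"
  by (simp add: dil_def algebra_simps)

lemma dil_eq: "dil c \<delta> y = y + \<delta> *\<^sub>R (y - c)"
  by (simp add: dil_def algebra_simps)

lemma dist_dil:
  fixes c :: "'a::real_normed_vector"
  shows "0 \<le> \<delta> \<Longrightarrow> dist (dil c \<delta> y) y = \<delta> * dist y c"
  by (simp add: dil_eq dist_norm)

lemma undil: "0 < \<delta> \<Longrightarrow> y = (1 - \<delta> / (1 + \<delta>)) *\<^sub>R dil c \<delta> y + (\<delta> / (1 + \<delta>)) *\<^sub>R c"
proof -
  assume \<delta>: "0 < \<delta>"
  have e: "1 - \<delta> / (1 + \<delta>) = inverse (1 + \<delta>)" using \<delta> by (simp add: field_simps)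
  have "(1 - \<delta> / (1 + \<delta>)) *\<^sub>R dil c \<delta> y = (inverse (1 + \<delta>)) *\<^sub>R c + (y - c)"
    unfolding e dil_def using \<delta> by (simp add: scaleR_add_right)
  moreover have "inverse (1 + \<delta>) *\<^sub>R c + (\<delta> / (1 + \<delta>)) *\<^sub>R c = c"
    unfolding e[symmetric] by (simp flip: scaleR_add_left)
  ultimately show ?thesis by (metis add.commute add.left_commute diff_add_cancel)
qed

text \<open>When both ends are moved slightly towards \<open>x\<close>, the point \<open>x\<close>
  divides the new segment in almost the same ratio.\<close>

lemma segment_trimmed:
  fixes a b x :: "'a::real_vector"
  assumes x: "x = (1 - s) *\<^sub>R a + s *\<^sub>R b" and s: "0 < s" "s < 1"
    and \<theta>: "1 - \<tau> \<le> \<theta>a" "\<theta>a \<le> 1" "1 - \<tau> \<le> \<theta>b" "\<theta>b \<le> 1" and \<tau>: "0 < \<tau>" "\<tau> \<le> 1/2"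
  obtains s' where "0 \<le> s'" "s' \<le> 1" "\<bar>s' - s\<bar> \<le> \<tau>"
    "x = (1 - s') *\<^sub>R (x + \<theta>a *\<^sub>R (a - x)) + s' *\<^sub>R (x + \<theta>b *\<^sub>R (b - x))"
proof -
  define D where "D = \<theta>a * s + \<theta>b * (1 - s)"
  have "(1/2) * s + (1/2) * (1 - s) \<le> D"
    unfolding D_def using \<theta> \<tau> s by (intro add_mono mult_right_mono) auto
  then have D: "1/2 \<le> D" by (simp add: field_simps)
  \<comment> \<open>Solves \<open>(1 - s') * \<theta>a * s = s' * \<theta>b * (1 - s)\<close>, which
    says that the two displacements from \<open>x\<close> cancel.\<close>
  define s' where "s' = \<theta>a * s / D"
  have s'1: "1 - s' = \<theta>b * (1 - s) / D" using D by (simp add: s'_def D_def field_simps)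
  have pos: "0 \<le> \<theta>a" "0 \<le> \<theta>b" using \<theta> \<tau> by auto
  have "s' - s = s * (1 - s) * (\<theta>a - \<theta>b) / D" using D by (simp add: s'_def D_def field_simps)
  then have "\<bar>s' - s\<bar> = s * (1 - s) * \<bar>\<theta>a - \<theta>b\<bar> / D" using s D by (simp add: abs_mult)
  also have "\<dots> \<le> (1/4) * \<tau> / (1/2)"
  proof (intro frac_le mult_mono)
    show "s * (1 - s) \<le> 1/4" using zero_le_power2[of "s - 1/2"] by (simp add: power2_eq_square algebra_simps)
  qed (use \<theta> \<tau> s D in auto)
  also have "\<dots> \<le> \<tau>" using \<tau> by simp
  finally have 1: "\<bar>s' - s\<bar> \<le> \<tau>" .
  have "0 \<le> s'" using pos s D by (auto simp: s'_def)
  moreover have "0 \<le> 1 - s'" unfolding s'1 using pos s D by auto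
  moreover have "x = (1 - s') *\<^sub>R (x + \<theta>a *\<^sub>R (a - x)) + s' *\<^sub>R (x + \<theta>b *\<^sub>R (b - x))"
  proof -
    have ax: "a - x = (- s) *\<^sub>R (b - a)" and bx: "b - x = (1 - s) *\<^sub>R (b - a)"
      unfolding x by (simp_all add: algebra_simps)
    have "(1 - s') *\<^sub>R (x + \<theta>a *\<^sub>R (a - x)) + s' *\<^sub>R (x + \<theta>b *\<^sub>R (b - x))
        = x + ((1 - s') * \<theta>a * (- s) + s' * \<theta>b * (1 - s)) *\<^sub>R (b - a)"
      unfolding ax bx by (simp add: algebra_simps)
    also have "(1 - s') * \<theta>a * (- s) + s' * \<theta>b * (1 - s) = 0"
      unfolding s'1 unfolding s'_def by simp
    finally show ?thesis by simp
  qed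
  ultimately show ?thesis using that[of s'] 1 by simp
qed

context convex_annulus
begin

text \<open>If \<open>z\<close> in \<open>\<Omega>1\<close> were closer, then \<open>y\<close> would
  be a convex combination of \<open>z\<close> and a point \<open>c + b\<close> of the ball about
  \<open>c\<close>, hence in \<open>\<Omega>1\<close>.\<close>

lemma dil_far:
  assumes c: "ball c \<rho> \<subseteq> \<Omega>1" and \<delta>: "0 < \<delta>" and y: "y \<notin> \<Omega>1"
  shows "dil c \<delta> y \<in> far (\<delta> * \<rho>)"
  unfolding far_def
proof (clarify, rule ccontr)
  fix z assume z: "z \<in> \<Omega>1" and n: "\<not> \<delta> * \<rho> \<le> dist (dil c \<delta> y) z"
  define b where "b = (1 / \<delta>) *\<^sub>R (dil c \<delta> y - z)"
  have "norm b = dist (dil c \<delta> y) z / \<delta>" unfolding b_def norm_scaleR dist_norm using \<delta> by simp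
  then have "norm b < \<rho>" using n \<delta> by (simp add: divide_less_eq mult.commute)
  then have "c + b \<in> \<Omega>1" using c by (auto simp: dist_norm)
  then have "(1 - \<delta> / (1 + \<delta>)) *\<^sub>R z + (\<delta> / (1 + \<delta>)) *\<^sub>R (c + b) \<in> \<Omega>1"
    using convexD_alt[OF convex1 z, of "c + b" "\<delta> / (1 + \<delta>)"] \<delta> by simp
  moreover have "(1 - \<delta> / (1 + \<delta>)) *\<^sub>R z + (\<delta> / (1 + \<delta>)) *\<^sub>R (c + b) = y"
  proof -
    have e: "1 - \<delta> / (1 + \<delta>) = inverse (1 + \<delta>)" using \<delta> by (simp add: field_simps)
    have "(\<delta> / (1 + \<delta>)) *\<^sub>R b = (1 - \<delta> / (1 + \<delta>)) *\<^sub>R (dil c \<delta> y - z)"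
      unfolding b_def e using \<delta> by (simp add: divide_inverse)
    then have "(1 - \<delta> / (1 + \<delta>)) *\<^sub>R z + (\<delta> / (1 + \<delta>)) *\<^sub>R (c + b)
       = (1 - \<delta> / (1 + \<delta>)) *\<^sub>R dil c \<delta> y + (\<delta> / (1 + \<delta>)) *\<^sub>R c"
      by (simp add: scaleR_add_right scaleR_diff_right)
    then show ?thesis using undil[OF \<delta>, of y c] by simp
  qed
  ultimately show False using y by simp
qed

lemma dil_notin_closure0:
  assumes "c \<in> \<Omega>0" "0 < \<delta>" "p \<in> frontier \<Omega>0"
  shows "dil c \<delta> p \<notin> closure \<Omega>0"
proof
  assume *: "dil c \<delta> p \<in> closure \<Omega>0"
  have "dil c \<delta> p - (\<delta> / (1 + \<delta>)) *\<^sub>R (dil c \<delta> p - c) \<in> interior \<Omega>0"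
    by (rule mem_interior_closure_convex_shrink[OF convex0 _ *]) (use assms open0 in \<open>auto simp: interior_open\<close>)
  moreover have "dil c \<delta> p - (\<delta> / (1 + \<delta>)) *\<^sub>R (dil c \<delta> p - c) = p"
    using undil[OF assms(2), of p c] by (simp add: algebra_simps)
  ultimately have "p \<in> \<Omega>0" using interior_open[OF open0] by simp
  then show False using assms(3) by (simp add: frontier0_iff)
qed

text \<open>The end point \<open>a\<close> of an edge issuing from \<open>x\<close> is pushed by a dilation to \<open>dil c \<delta> a\<close>; if
  \<open>a\<close> is on the outer boundary, the dilated edge is cut where it leaves \<open>\<Omega>0\<close>. Lower
  semicontinuity of \<open>f\<close> controls the value there.\<close>

lemma pushed_endpoint:
  assumes lsc: "lsc_on (frontier \<Omega>0) f" and c: "c \<in> \<Omega>0" "ball c \<rho> \<subseteq> \<Omega>1"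
    and x: "x \<in> \<Omega>0" and a: "a \<in> frontier \<Omega>0" and seg: "closed_segment x a \<inter> \<Omega>1 = {}"
    and \<tau>: "0 < \<tau>" "\<tau> \<le> 1/2"
  obtains \<delta>0 where "0 < \<delta>0" "\<And>\<delta>. 0 < \<delta> \<Longrightarrow> \<delta> < \<delta>0 \<Longrightarrow> \<exists>\<theta> R V. 1 - \<tau> \<le> \<theta> \<and> \<theta> \<le> 1 \<and> f a - \<tau> \<le> V \<and>
     reach (away (\<delta> * \<rho>) R) (frontier \<Omega>0) f (dil c \<delta> x + \<theta> *\<^sub>R (dil c \<delta> a - dil c \<delta> x)) V"
proof -
  have "\<forall>\<^sub>F y in at a within frontier \<Omega>0. f a - \<tau> < f y"
    using lsc a \<tau> unfolding lsc_on_def by simp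
  then obtain d where d: "0 < d" "\<And>y. y \<in> frontier \<Omega>0 \<Longrightarrow> dist y a < d \<Longrightarrow> f a - \<tau> < f y"
    unfolding eventually_at using \<tau> by (metis diff_less_eq less_add_same_cancel1)
  \<comment> \<open>The fraction of the edge that may be cut off at \<open>a\<close>, such that the
    part cut off is shorter than \<open>d / 2\<close>.\<close>
  define t where "t = min \<tau> (d / (2 * (dist a x + 1)))"
  have t: "0 < t" "t \<le> \<tau>" "t < 1" using \<tau> d by (auto simp: t_def add_nonneg_pos)
  have tx: "t * dist a x < d / 2"
  proof -
    have "t * dist a x \<le> d / (2 * (dist a x + 1)) * dist a x"
      by (intro mult_right_mono) (auto simp: t_def)
    also have "\<dots> = (d / 2) * (dist a x / (dist a x + 1))" by simp
    also have "\<dots> < (d / 2) * 1"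
      using d by (intro mult_strict_left_mono) (auto simp: divide_less_eq add_nonneg_pos)
    finally show ?thesis by simp
  qed
  \<comment> \<open>An inner point of the edge near \<open>a\<close>. For small
    \<open>\<delta>\<close> its dilation is still in \<open>\<Omega>0\<close>, so the dilated edge
    leaves \<open>\<Omega>0\<close> between the images of \<open>y0\<close> and
    \<open>a\<close>.\<close>
  define y0 where "y0 = x + (1 - t) *\<^sub>R (a - x)"
  have xa: "x \<noteq> a" using x a frontier0_iff by auto
  have "y0 \<in> open_segment x a"
    unfolding in_segment y0_def using t xa by (intro conjI exI[of _ "1 - t"]) (auto simp: algebra_simps)
  then have "y0 \<in> \<Omega>0"
    using in_interior_closure_convex_segment[OF convex0, of x a] x a open0 by (auto simp: interior_open frontier_def)
  then obtain e where e: "0 < e" "ball y0 e \<subseteq> \<Omega>0" using open0 open_contains_ball by blast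
  define K where "K = dist x c + dist a c + dist y0 c + 1"
  have K: "0 < K" by (simp add: K_def add_nonneg_pos)
  show ?thesis
  \<comment> \<open>The first bound keeps the image of \<open>y0\<close> in
    \<open>\<Omega>0\<close>; the second makes the dilation move points of the edge by less than
    \<open>d / 2\<close>.\<close>
  proof (rule that[of "min (e / K) (d / (2 * K))"])
    show "0 < min (e / K) (d / (2 * K))" using e d K by auto
    fix \<delta> assume \<delta>: "0 < \<delta>" "\<delta> < min (e / K) (d / (2 * K))"
    have \<delta>K: "\<delta> * K < e" "\<delta> * K < d / 2" using \<delta> K by (auto simp: field_simps)
    have "dist (dil c \<delta> y0) y0 \<le> \<delta> * K"
      using \<delta> by (simp add: dist_dil K_def)
    then have in0: "dil c \<delta> y0 \<in> \<Omega>0" using e \<delta>K by (auto simp: dist_commute intro!: subsetD[OF e(2)])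
    have "dil c \<delta> a \<notin> \<Omega>0" using dil_notin_closure0[OF c(1) \<delta>(1) a] closure_subset by blast
    then obtain z where z: "z \<in> closed_segment (dil c \<delta> y0) (dil c \<delta> a)" "z \<in> frontier \<Omega>0"
      using segment_to_outside_meets_frontier[OF in0] by blast
    obtain u where u: "0 \<le> u" "u \<le> 1" "z = (1 - u) *\<^sub>R dil c \<delta> y0 + u *\<^sub>R dil c \<delta> a"
      using z(1) by (auto simp: in_segment)
    define \<theta> where "\<theta> = 1 - t + u * t"
    define y where "y = x + \<theta> *\<^sub>R (a - x)"
    have \<theta>: "1 - t \<le> \<theta>" "\<theta> \<le> 1" using u t by (auto simp: \<theta>_def mult_left_le_one_le)
    have "y = (1 - u) *\<^sub>R y0 + u *\<^sub>R a" by (simp add: y_def y0_def \<theta>_def algebra_simps)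
    then have zy: "z = dil c \<delta> y" unfolding u(3) by (simp add: dil_affine)
    have yseg: "y \<in> closed_segment x a"
      unfolding in_segment y_def using \<theta> t by (intro exI[of _ \<theta>]) (auto simp: algebra_simps)
    have "z \<in> far (\<delta> * \<rho>)" unfolding zy by (rule dil_far[OF c(2) \<delta>(1)]) (use yseg seg in auto)
    then have zaway: "z \<in> away (\<delta> * \<rho>) (norm z)" using z(2) by (auto simp: away_def frontier_def)
    have "dist y c \<le> K"
    proof -
      have "y - c = (1 - \<theta>) *\<^sub>R (x - c) + \<theta> *\<^sub>R (a - c)" by (simp add: y_def algebra_simps)
      then have "norm (y - c) \<le> norm ((1 - \<theta>) *\<^sub>R (x - c)) + norm (\<theta> *\<^sub>R (a - c))" by (metis norm_triangle_ineq)
      also have "\<dots> \<le> 1 * norm (x - c) + 1 * norm (a - c)"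
        unfolding norm_scaleR using \<theta> t by (intro add_mono mult_right_mono) auto
      finally have "norm (y - c) \<le> norm (x - c) + norm (a - c) + norm (y0 - c) + 1"
        using norm_ge_zero[of "y0 - c"] by linarith
      then show ?thesis by (simp add: K_def dist_norm)
    qed
    then have "\<delta> * dist y c \<le> \<delta> * K" using \<delta> by (intro mult_left_mono) auto
    moreover have "dist z y = \<delta> * dist y c" unfolding zy using \<delta> by (simp add: dist_dil)
    ultimately have "dist z y < d / 2" using \<delta>K by linarith
    moreover have "dist y a < d / 2"
    proof -
      have "y - a = (\<theta> - 1) *\<^sub>R (a - x)" by (simp add: y_def algebra_simps)
      then have "dist y a = (1 - \<theta>) * dist a x" using \<theta> by (simp add: dist_norm)
      also have "\<dots> \<le> t * dist a x" using \<theta> by (intro mult_right_mono) auto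
      finally show ?thesis using tx by linarith
    qed
    ultimately have "dist z a < d" using dist_triangle[of z a y] by linarith
    then have "f a - \<tau> < f z" by (rule d(2)[OF z(2)])
    moreover have "reach (away (\<delta> * \<rho>) (norm z)) (frontier \<Omega>0) f z (f z)" by (rule reach.leaf[OF zaway z(2)])
    moreover have "z = dil c \<delta> x + \<theta> *\<^sub>R (dil c \<delta> a - dil c \<delta> x)" unfolding zy y_def dil_line ..
    ultimately show "\<exists>\<theta> R V. 1 - \<tau> \<le> \<theta> \<and> \<theta> \<le> 1 \<and> f a - \<tau> \<le> V \<and>
     reach (away (\<delta> * \<rho>) R) (frontier \<Omega>0) f (dil c \<delta> x + \<theta> *\<^sub>R (dil c \<delta> a - dil c \<delta> x)) V"
      using \<theta> t(2) by (intro exI[of _ \<theta>] exI[of _ "norm z"] exI[of _ "f z"]) auto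
  qed
qed

text \<open>The claim is for all small \<open>\<delta>\<close>, since both branches of a node have
  to be pushed by the same dilation. Points of the outer boundary cannot be pushed, but being
  extreme they admit only the value \<open>f x\<close>; an edge ending there is trimmed by
  \<open>pushed_endpoint\<close>.\<close>

lemma reach_pushed:
  assumes lsc: "lsc_on (frontier \<Omega>0) f" and c: "c \<in> \<Omega>0" "ball c \<rho> \<subseteq> \<Omega>1"
    and "reach (closure \<Omega>0 - \<Omega>1) (frontier \<Omega>0) f x V"
  shows "(x \<in> frontier \<Omega>0 \<longrightarrow> V = f x) \<and> (x \<in> \<Omega>0 \<longrightarrow> (\<forall>\<epsilon>>0. \<exists>\<delta>0>0. \<forall>\<delta>. 0 < \<delta> \<longrightarrow> \<delta> < \<delta>0 \<longrightarrow>
     (\<exists>R V'. V - \<epsilon> \<le> V' \<and> reach (away (\<delta> * \<rho>) R) (frontier \<Omega>0) f (dil c \<delta> x) V')))"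
  using assms(4)
proof (induction rule: reach.induct)
  case (leaf x)
  then show ?case using frontier0_iff by auto
next
  case (node a V b W s)
  define x where "x = (1 - s) *\<^sub>R a + s *\<^sub>R b"
  have ab0: "a \<in> closure \<Omega>0" "b \<in> closure \<Omega>0" using node.hyps(3) by auto
  show ?case
  proof (cases "s = 0 \<or> s = 1")
    case True
    then show ?thesis using node.IH by auto
  next
    case False
    then have s: "0 < s" "s < 1" using node.hyps by auto
    have fr: "(1 - s) * V + s * W = f x" if xf: "x \<in> frontier \<Omega>0"
    proof -
      have "a = b"
      proof (rule ccontr)
        assume "a \<noteq> b"
        then have "x \<in> open_segment a b" using s by (auto simp: in_segment x_def)
        then have "x \<in> \<Omega>0" by (rule open_segment_in_strictly_convex[OF open0 convex0 strict0 ab0])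
        then show False using xf frontier0_iff by auto
      qed
      then have "x = a" "x = b" by (simp_all add: x_def flip: scaleR_add_left)
      then show ?thesis using node.IH xf by (simp flip: distrib_right)
    qed
    have int: "\<exists>\<delta>0>0. \<forall>\<delta>. 0 < \<delta> \<longrightarrow> \<delta> < \<delta>0 \<longrightarrow>
       (\<exists>R V'. (1 - s) * V + s * W - \<epsilon> \<le> V' \<and> reach (away (\<delta> * \<rho>) R) (frontier \<Omega>0) f (dil c \<delta> x) V')"
      if xi: "x \<in> \<Omega>0" and \<epsilon>: "0 < \<epsilon>" for \<epsilon>
    proof -
      \<comment> \<open>Trimming lowers the values at the ends by at most \<open>\<tau>\<close> and
        changes the weight by at most \<open>\<tau>\<close>, which costs at most
        \<open>\<tau> * (1 + \<bar>W - V\<bar>)\<close> altogether.\<close>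
      define \<tau> where "\<tau> = min (1/2) (\<epsilon> / (1 + \<bar>W - V\<bar>))"
      have \<tau>: "0 < \<tau>" using \<epsilon> by (auto simp: \<tau>_def add_pos_nonneg)
      have \<tau>2: "\<tau> \<le> 1/2" unfolding \<tau>_def by (rule min.cobounded1)
      have \<tau>\<epsilon>: "\<tau> * (1 + \<bar>W - V\<bar>) \<le> \<epsilon>"
      proof -
        have "\<tau> \<le> \<epsilon> / (1 + \<bar>W - V\<bar>)" by (simp add: \<tau>_def)
        then show ?thesis by (simp add: le_divide_eq add_pos_nonneg)
      qed
      have xab: "x \<in> closed_segment a b" unfolding in_segment x_def using s by (intro exI[of _ s]) auto
      have end_pt: "\<exists>\<delta>0>0. \<forall>\<delta>. 0 < \<delta> \<longrightarrow> \<delta> < \<delta>0 \<longrightarrow> (\<exists>\<theta> R V'. 1 - \<tau> \<le> \<theta> \<and> \<theta> \<le> 1 \<and> Vy - \<tau> \<le> V' \<and>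
          reach (away (\<delta> * \<rho>) R) (frontier \<Omega>0) f (dil c \<delta> x + \<theta> *\<^sub>R (dil c \<delta> y - dil c \<delta> x)) V')"
        if y: "y \<in> closed_segment a b" and IH: "y \<in> frontier \<Omega>0 \<longrightarrow> Vy = f y"
          "y \<in> \<Omega>0 \<longrightarrow> (\<forall>\<epsilon>>0. \<exists>\<delta>0>0. \<forall>\<delta>. 0 < \<delta> \<longrightarrow> \<delta> < \<delta>0 \<longrightarrow>
     (\<exists>R V'. Vy - \<epsilon> \<le> V' \<and> reach (away (\<delta> * \<rho>) R) (frontier \<Omega>0) f (dil c \<delta> y) V'))" for y Vy
      proof (cases "y \<in> \<Omega>0")
        case True
        then obtain \<delta>0 where d0: "\<delta>0 > 0" and d1: "\<And>\<delta>. 0 < \<delta> \<Longrightarrow> \<delta> < \<delta>0 \<Longrightarrow>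
           \<exists>R V'. Vy - \<tau> \<le> V' \<and> reach (away (\<delta> * \<rho>) R) (frontier \<Omega>0) f (dil c \<delta> y) V'"
          using IH(2) \<tau> by metis
        show ?thesis
        proof (rule exI[of _ \<delta>0], intro conjI allI impI d0)
          fix \<delta> assume "0 < \<delta>" "\<delta> < \<delta>0"
          then obtain R V' where "Vy - \<tau> \<le> V'" "reach (away (\<delta> * \<rho>) R) (frontier \<Omega>0) f (dil c \<delta> y) V'"
            using d1 by metis
          then show "\<exists>\<theta> R V'. 1 - \<tau> \<le> \<theta> \<and> \<theta> \<le> 1 \<and> Vy - \<tau> \<le> V' \<and>
            reach (away (\<delta> * \<rho>) R) (frontier \<Omega>0) f (dil c \<delta> x + \<theta> *\<^sub>R (dil c \<delta> y - dil c \<delta> x)) V'"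
            using \<tau> by (intro exI[of _ 1] exI[of _ R] exI[of _ V']) auto
        qed
      next
        case False
        then have yf: "y \<in> frontier \<Omega>0" using y node.hyps(3) frontier0_iff by auto
        have Vy: "Vy = f y" using IH(1) yf by simp
        have "closed_segment x y \<subseteq> closed_segment a b" using xab y by (simp add: subset_closed_segment)
        then have "closed_segment x y \<inter> \<Omega>1 = {}" using node.hyps(3) by auto
        then show ?thesis unfolding Vy
          using pushed_endpoint[OF lsc c xi yf _ \<tau> \<tau>2] by metis
      qed
      obtain \<delta>a where da: "\<delta>a > 0" and da1: "\<And>\<delta>. 0 < \<delta> \<Longrightarrow> \<delta> < \<delta>a \<Longrightarrow> \<exists>\<theta> R V'. 1 - \<tau> \<le> \<theta> \<and> \<theta> \<le> 1 \<and> V - \<tau> \<le> V' \<and>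
          reach (away (\<delta> * \<rho>) R) (frontier \<Omega>0) f (dil c \<delta> x + \<theta> *\<^sub>R (dil c \<delta> a - dil c \<delta> x)) V'"
        using end_pt[of a V] node.IH(1) by auto
      obtain \<delta>b where db: "\<delta>b > 0" and db1: "\<And>\<delta>. 0 < \<delta> \<Longrightarrow> \<delta> < \<delta>b \<Longrightarrow> \<exists>\<theta> R V'. 1 - \<tau> \<le> \<theta> \<and> \<theta> \<le> 1 \<and> W - \<tau> \<le> V' \<and>
          reach (away (\<delta> * \<rho>) R) (frontier \<Omega>0) f (dil c \<delta> x + \<theta> *\<^sub>R (dil c \<delta> b - dil c \<delta> x)) V'"
        using end_pt[of b W] node.IH(2) by auto
      show ?thesis
      proof (rule exI[of _ "min \<delta>a \<delta>b"], intro conjI allI impI)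
        show "0 < min \<delta>a \<delta>b" using da db by simp
        fix \<delta> assume \<delta>: "0 < \<delta>" "\<delta> < min \<delta>a \<delta>b"
        define X where "X = dil c \<delta> x"
        obtain \<theta>a Ra Va where A: "1 - \<tau> \<le> \<theta>a" "\<theta>a \<le> 1" "V - \<tau> \<le> Va"
          "reach (away (\<delta> * \<rho>) Ra) (frontier \<Omega>0) f (X + \<theta>a *\<^sub>R (dil c \<delta> a - X)) Va"
          using da1[of \<delta>] \<delta> unfolding X_def by auto
        obtain \<theta>b Rb Vb where B: "1 - \<tau> \<le> \<theta>b" "\<theta>b \<le> 1" "W - \<tau> \<le> Vb"
          "reach (away (\<delta> * \<rho>) Rb) (frontier \<Omega>0) f (X + \<theta>b *\<^sub>R (dil c \<delta> b - X)) Vb"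
          using db1[of \<delta>] \<delta> unfolding X_def by auto
        define R where "R = max Ra Rb"
        define a' where "a' = X + \<theta>a *\<^sub>R (dil c \<delta> a - X)"
        define b' where "b' = X + \<theta>b *\<^sub>R (dil c \<delta> b - X)"
        have X: "X = (1 - s) *\<^sub>R dil c \<delta> a + s *\<^sub>R dil c \<delta> b" by (simp add: X_def x_def dil_affine)
        obtain s' where s': "0 \<le> s'" "s' \<le> 1" "\<bar>s' - s\<bar> \<le> \<tau>" "X = (1 - s') *\<^sub>R a' + s' *\<^sub>R b'"
          using segment_trimmed[OF X s A(1,2) B(1,2) \<tau> \<tau>2] unfolding a'_def b'_def by metis
        have ra: "reach (away (\<delta> * \<rho>) R) (frontier \<Omega>0) f a' Va"
          using reach_mono[OF A(4)] away_mono[of "\<delta> * \<rho>" "\<delta> * \<rho>" Ra R] by (simp add: a'_def R_def)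
        have rb: "reach (away (\<delta> * \<rho>) R) (frontier \<Omega>0) f b' Vb"
          using reach_mono[OF B(4)] away_mono[of "\<delta> * \<rho>" "\<delta> * \<rho>" Rb R] by (simp add: b'_def R_def)
        \<comment> \<open>The trimmed ends are dilations of points of the original edge, so this
          segment is the dilation of a part of that edge and \<open>dil_far\<close> applies.\<close>
        have "closed_segment a' b' \<subseteq> far (\<delta> * \<rho>)"
        proof
          fix z assume "z \<in> closed_segment a' b'"
          then obtain u where u: "0 \<le> u" "u \<le> 1" "z = (1 - u) *\<^sub>R a' + u *\<^sub>R b'" by (auto simp: in_segment)
          define a2 where "a2 = x + \<theta>a *\<^sub>R (a - x)"
          define b2 where "b2 = x + \<theta>b *\<^sub>R (b - x)"
          have a2: "a' = dil c \<delta> a2" and b2: "b' = dil c \<delta> b2"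
            by (simp_all add: a2_def b2_def a'_def b'_def X_def dil_line)
          have "a2 \<in> closed_segment x a" "b2 \<in> closed_segment x b"
            unfolding in_segment a2_def b2_def using A(1,2) B(1,2) \<tau> \<tau>2
            by (intro exI[of _ \<theta>a] exI[of _ \<theta>b]; auto simp: algebra_simps)+
          moreover have "closed_segment x a \<subseteq> closed_segment a b" "closed_segment x b \<subseteq> closed_segment a b"
            unfolding subset_closed_segment using xab by auto
          ultimately have "a2 \<in> closed_segment a b" "b2 \<in> closed_segment a b" by (metis subsetD)+
          then have "closed_segment a2 b2 \<subseteq> closed_segment a b"
            unfolding subset_closed_segment by simp
          moreover have "(1 - u) *\<^sub>R a2 + u *\<^sub>R b2 \<in> closed_segment a2 b2" using u by (auto simp: in_segment)
          ultimately have "(1 - u) *\<^sub>R a2 + u *\<^sub>R b2 \<notin> \<Omega>1" using node.hyps(3) by auto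
          then show "z \<in> far (\<delta> * \<rho>)"
            using dil_far[OF c(2) \<delta>(1)] unfolding u(3) a2 b2 dil_affine[symmetric] by blast
        qed
        moreover have "a' \<in> closure \<Omega>0 \<inter> cball 0 R" "b' \<in> closure \<Omega>0 \<inter> cball 0 R"
          using reach_in[OF ra] reach_in[OF rb] by (auto simp: away_def)
        moreover have "convex (closure \<Omega>0 \<inter> cball 0 R)" by (intro convex_Int convex_closure convex0 convex_cball)
        ultimately have "closed_segment a' b' \<subseteq> away (\<delta> * \<rho>) R"
          unfolding away_def using closed_segment_subset by (metis Int_subset_iff)
        then have "reach (away (\<delta> * \<rho>) R) (frontier \<Omega>0) f X ((1 - s') * Va + s' * Vb)"
          unfolding s'(4) by (rule reach.node[OF ra rb _ s'(1,2)])
        moreover have "(1 - s) * V + s * W - \<epsilon> \<le> (1 - s') * Va + s' * Vb"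
        proof -
          have "(1 - s') * (V - \<tau>) + s' * (W - \<tau>) \<le> (1 - s') * Va + s' * Vb"
            using A(3) B(3) s' by (intro add_mono mult_left_mono) auto
          moreover have "(1 - s') * (V - \<tau>) + s' * (W - \<tau>) = (1 - s) * V + s * W - \<tau> + (s' - s) * (W - V)"
            by (simp add: algebra_simps)
          moreover have "- (\<tau> * \<bar>W - V\<bar>) \<le> (s' - s) * (W - V)"
          proof -
            have "\<bar>(s' - s) * (W - V)\<bar> \<le> \<tau> * \<bar>W - V\<bar>"
              unfolding abs_mult by (intro mult_right_mono s'(3) abs_ge_zero)
            then show ?thesis by linarith
          qed
          ultimately show ?thesis using \<tau>\<epsilon> by (simp add: distrib_left)
        qed
        ultimately show "\<exists>R V'. (1 - s) * V + s * W - \<epsilon> \<le> V' \<and> reach (away (\<delta> * \<rho>) R) (frontier \<Omega>0) f (dil c \<delta> x) V'"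
          unfolding X_def by blast
      qed
    qed
    show ?thesis using fr int unfolding x_def[symmetric] by blast
  qed
qed

text \<open>A martingale of one step along the default chord. It serves for the auxiliary point in
  \<open>reach_strict\<close>, where any finite value will do.\<close>

lemma chord_reach:
  assumes z: "z \<in> away r R" and r: "0 < r" and m: "\<And>y. y \<in> frontier \<Omega>0 \<Longrightarrow> m \<le> f y"
  shows "\<exists>r1 R1 V. 0 < r1 \<and> m \<le> V \<and> reach (away r1 R1) (frontier \<Omega>0) f z V"
proof (rule default_chords[OF r, of R])
  fix r1 \<delta> B l and p q :: "'a \<Rightarrow> 'a"
  assume fam: "0 < r1" "0 < \<delta>"
    "\<And>m. m \<in> away r R \<Longrightarrow> 0 < l m \<and> l m < 1 \<and> m = (1 - l m) *\<^sub>R p m + l m *\<^sub>R q m"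
    "\<And>m. m \<in> away r R \<Longrightarrow> p m \<in> frontier \<Omega>0 \<and> q m \<in> frontier \<Omega>0 \<and> norm (p m) \<le> B \<and> norm (q m) \<le> B"
    "\<And>m m'. m \<in> away r R \<Longrightarrow> m' \<in> away r R \<Longrightarrow> dist m m' < \<delta> \<Longrightarrow>
       \<exists>X. convex X \<and> {p m, q m, p m', q m'} \<subseteq> X \<and> X \<subseteq> far r1"
  have l: "0 < l z" "l z < 1" "z = (1 - l z) *\<^sub>R p z + l z *\<^sub>R q z" using fam(3)[OF z] by auto
  have pq: "p z \<in> frontier \<Omega>0" "q z \<in> frontier \<Omega>0" "norm (p z) \<le> B" "norm (q z) \<le> B" using fam(4)[OF z] by auto
  obtain X where X: "convex X" "{p z, q z} \<subseteq> X" "X \<subseteq> far r1" using fam(5)[OF z z] fam(2) by auto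
  have "convex (closure \<Omega>0 \<inter> cball 0 B \<inter> X)" by (intro convex_Int convex_closure convex0 convex_cball X)
  then have "closed_segment (p z) (q z) \<subseteq> closure \<Omega>0 \<inter> cball 0 B \<inter> X"
    using pq X frontier0_iff by (intro closed_segment_subset) auto
  then have seg: "closed_segment (p z) (q z) \<subseteq> away r1 B" using X(3) by (auto simp: away_def)
  have "reach (away r1 B) (frontier \<Omega>0) f (p z) (f (p z))" "reach (away r1 B) (frontier \<Omega>0) f (q z) (f (q z))"
    using seg pq by (auto intro!: reach.leaf)
  from reach.node[OF this seg, of "l z"] have "reach (away r1 B) (frontier \<Omega>0) f z ((1 - l z) * f (p z) + l z * f (q z))"
    using l by simp
  moreover have "m \<le> (1 - l z) * f (p z) + l z * f (q z)"
  proof -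
    have "(1 - l z) * m + l z * m \<le> (1 - l z) * f (p z) + l z * f (q z)"
      using l m pq by (intro add_mono mult_left_mono) auto
    then show ?thesis by (simp add: algebra_simps)
  qed
  ultimately show ?thesis using fam(1) by blast
qed

text \<open>The pushed martingale starts at \<open>dil c \<delta> x\<close>. One more step, from
  \<open>x\<close> either there or to a fixed point \<open>z\<close> on the side of
  \<open>c\<close>, makes it start at \<open>x\<close>. The value at \<open>z\<close> is fixed
  before \<open>\<delta>\<close>, and the weight of \<open>z\<close> is at most
  \<open>\<delta> / t\<close>.\<close>

lemma reach_strict:
  assumes lsc: "lsc_on (frontier \<Omega>0) f" and m: "\<And>y. y \<in> frontier \<Omega>0 \<Longrightarrow> m \<le> f y"
    and x: "x \<in> \<Omega>0" "x \<notin> closure \<Omega>1" and reach: "reach (closure \<Omega>0 - \<Omega>1) (frontier \<Omega>0) f x V" and \<epsilon>: "0 < \<epsilon>"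
  shows "\<exists>r R V'. 0 < r \<and> V - \<epsilon> \<le> V' \<and> reach (away r R) (frontier \<Omega>0) f x V'"
proof -
  obtain c where c1: "c \<in> \<Omega>1" using ne1 by auto
  then have c0: "c \<in> \<Omega>0" using sub10 by auto
  obtain \<rho> where \<rho>: "0 < \<rho>" "ball c \<rho> \<subseteq> \<Omega>1" using open1 c1 open_contains_ball by blast
  obtain r0 where r0: "0 < r0" "x \<in> far r0" using far_point[OF x(2)] by blast
  obtain e0 where e0: "0 < e0" "cball x e0 \<subseteq> \<Omega>0" using open0 x(1) open_contains_cball by blast
  define e where "e = min e0 (r0/2)"
  have e: "0 < e" "cball x e \<subseteq> \<Omega>0" using e0 r0 by (auto simp: e_def)
  have cb: "cball x e \<subseteq> away (r0/2) (norm x + e)"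
  proof
    fix y assume y: "y \<in> cball x e"
    have "y \<in> far (r0/2)" by (rule far_perturb[OF r0(2)]) (use y in \<open>auto simp: e_def dist_commute\<close>)
    moreover have "norm y \<le> norm x + e" using y norm_triangle_sub[of y x] by (simp add: dist_norm norm_minus_commute)
    moreover have "y \<in> closure \<Omega>0" using y e(2) by (intro subsetD[OF closure_subset]) auto
    ultimately show "y \<in> away (r0/2) (norm x + e)" by (auto simp: away_def)
  qed
  have xc: "0 < dist x c" using x c1 closure_subset by auto
  define t where "t = e / dist x c"
  have t: "0 < t" using e xc by (simp add: t_def)
  define z where "z = x - t *\<^sub>R (x - c)"
  have zx: "z \<in> cball x e" using t xc e by (simp add: z_def t_def dist_norm)
  obtain rz Rz Vz where vz: "0 < rz" "m \<le> Vz" "reach (away rz Rz) (frontier \<Omega>0) f z Vz"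
    using chord_reach[where f = f and m = m, OF subsetD[OF cb zx] half_gt_zero[OF r0(1)] m] by blast
  obtain \<delta>0 where d0: "0 < \<delta>0" and d1: "\<And>\<delta>. 0 < \<delta> \<Longrightarrow> \<delta> < \<delta>0 \<Longrightarrow>
      \<exists>R V'. V - \<epsilon>/2 \<le> V' \<and> reach (away (\<delta> * \<rho>) R) (frontier \<Omega>0) f (dil c \<delta> x) V'"
    using reach_pushed[OF lsc c0 \<rho>(2) reach] x(1) half_gt_zero[OF \<epsilon>] by metis
  define K where "K = \<bar>Vz\<bar> + \<bar>V\<bar> + \<epsilon>"
  have K: "0 < K" using \<epsilon> by (simp add: K_def add_nonneg_pos)
  \<comment> \<open>The bound \<open>t\<close> keeps the dilated point in the ball about
    \<open>x\<close>; the last one limits the loss caused by \<open>z\<close> to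
    \<open>\<epsilon> / 2\<close>.\<close>
  define \<delta> where "\<delta> = min (\<delta>0 / 2) (min t (t * \<epsilon> / (2 * K)))"
  have \<delta>: "0 < \<delta>" "\<delta> < \<delta>0" "\<delta> \<le> t" "\<delta> \<le> t * \<epsilon> / (2 * K)" using d0 t \<epsilon> K by (auto simp: \<delta>_def)
  obtain R V' where V': "V - \<epsilon>/2 \<le> V'" "reach (away (\<delta> * \<rho>) R) (frontier \<Omega>0) f (dil c \<delta> x) V'"
    using d1[OF \<delta>(1,2)] by blast
  have Sx: "dil c \<delta> x \<in> cball x e"
  proof -
    have "dist (dil c \<delta> x) x = \<delta> * dist x c" using \<delta> by (simp add: dist_dil)
    also have "\<dots> \<le> t * dist x c" using \<delta> xc by (intro mult_right_mono) auto
    also have "\<dots> = e" using xc by (simp add: t_def)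
    finally show ?thesis by (simp add: dist_commute)
  qed
  define s where "s = \<delta> / (\<delta> + t)"
  have s: "0 \<le> s" "s \<le> 1" "s \<le> \<delta> / t" using \<delta> t by (auto simp: s_def intro!: frac_le)
  have xs: "(1 - s) *\<^sub>R dil c \<delta> x + s *\<^sub>R z = x"
  proof -
    have "(1 - s) *\<^sub>R dil c \<delta> x + s *\<^sub>R z = x + ((1 - s) * \<delta> - s * t) *\<^sub>R (x - c)"
      by (simp add: dil_eq z_def algebra_simps)
    also have "(1 - s) * \<delta> - s * t = 0" using \<delta> t by (simp add: s_def field_simps)
    finally show ?thesis by simp
  qed
  define r where "r = min (\<delta> * \<rho>) (min rz (r0/2))"
  define R' where "R' = max R (max Rz (norm x + e))"
  have "closed_segment (dil c \<delta> x) z \<subseteq> cball x e" using Sx zx by (intro closed_segment_subset convex_cball) auto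
  also have "\<dots> \<subseteq> away r R'"
    by (rule subset_trans[OF cb away_mono]) (auto simp: r_def R'_def min_le_iff_disj le_max_iff_disj)
  finally have seg: "closed_segment (dil c \<delta> x) z \<subseteq> away r R'" .
  have "reach (away r R') (frontier \<Omega>0) f (dil c \<delta> x) V'"
    by (rule reach_mono[OF V'(2) away_mono]) (auto simp: r_def R'_def min_le_iff_disj le_max_iff_disj)
  moreover have "reach (away r R') (frontier \<Omega>0) f z Vz"
    by (rule reach_mono[OF vz(3) away_mono]) (auto simp: r_def R'_def min_le_iff_disj le_max_iff_disj)
  ultimately have "reach (away r R') (frontier \<Omega>0) f ((1 - s) *\<^sub>R dil c \<delta> x + s *\<^sub>R z) ((1 - s) * V' + s * Vz)"
    by (rule reach.node[OF _ _ seg s(1,2)])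
  moreover have "V - \<epsilon> \<le> (1 - s) * V' + s * Vz"
  proof -
    have "(1 - s) * (V - \<epsilon>/2) \<le> (1 - s) * V'" using V' s by (intro mult_left_mono) auto
    moreover have "(1 - s) * (V - \<epsilon>/2) + s * Vz = V - \<epsilon>/2 + s * (Vz - V + \<epsilon>/2)" by (simp add: field_simps)
    moreover have "s * K \<le> \<epsilon>/2"
    proof -
      have "s * K \<le> \<delta> / t * K" using s(3) K by (intro mult_right_mono) auto
      also have "\<dots> \<le> (t * \<epsilon> / (2 * K)) / t * K" using \<delta>(4) t K by (intro mult_right_mono divide_right_mono) auto
      also have "\<dots> = \<epsilon>/2" using t K by simp
      finally show ?thesis .
    qed
    moreover have "s * (- K) \<le> s * (Vz - V + \<epsilon>/2)" using s \<epsilon> by (intro mult_left_mono) (auto simp: K_def)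
    ultimately show ?thesis by simp
  qed
  moreover have "0 < r" using \<delta> \<rho> vz r0 by (simp add: r_def)
  ultimately show ?thesis unfolding xs by blast
qed

section \<open>The supremum over martingales as a locally concave majorant\<close>

definition reach_sup :: "('a \<Rightarrow> real) \<Rightarrow> 'a \<Rightarrow> ereal" where
  "reach_sup f x = (SUP V\<in>{V. reach (closure \<Omega>0 - \<Omega>1) (frontier \<Omega>0) f x V}. ereal V)"

lemma reach_sup_upper: "reach (closure \<Omega>0 - \<Omega>1) (frontier \<Omega>0) f x V \<Longrightarrow> ereal V \<le> reach_sup f x"
  unfolding reach_sup_def by (rule SUP_upper) simp

lemma reach_sup_least:
  "(\<And>V. reach (closure \<Omega>0 - \<Omega>1) (frontier \<Omega>0) f x V \<Longrightarrow> ereal V \<le> z) \<Longrightarrow> reach_sup f x \<le> z"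
  unfolding reach_sup_def by (rule SUP_least) simp

lemma frontier0_subset: "frontier \<Omega>0 \<subseteq> closure \<Omega>0 - \<Omega>1"
  using frontier0_iff sub10 by auto

lemma reach_exists:
  assumes "x \<in> closure \<Omega>0 - \<Omega>1"
  shows "\<exists>V. reach (closure \<Omega>0 - \<Omega>1) (frontier \<Omega>0) f x V"
proof (cases "x \<in> \<Omega>0")
  case True
  then obtain a b where ab: "a \<in> frontier \<Omega>0" "b \<in> frontier \<Omega>0" "x \<in> open_segment a b"
    "closed_segment a b \<subseteq> closure \<Omega>0 - \<Omega>1"
    using chord_exists[of x] assms by auto
  obtain u where u: "0 < u" "u < 1" "x = (1 - u) *\<^sub>R a + u *\<^sub>R b" using ab(3) by (auto simp: in_segment)
  have "reach (closure \<Omega>0 - \<Omega>1) (frontier \<Omega>0) f ((1 - u) *\<^sub>R a + u *\<^sub>R b) ((1 - u) * f a + u * f b)"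
    using u(1,2) frontier0_subset ab by (intro reach.node reach.leaf) auto
  then show ?thesis unfolding u(3) by blast
next
  case False
  then have "x \<in> frontier \<Omega>0" using assms frontier0_iff by auto
  then show ?thesis using assms reach.leaf by metis
qed

text \<open>Martingales from the two ends of a segment can be joined by a first step along it, which
  is local concavity; those of length zero give the boundary inequality.\<close>

lemma reach_sup_majorant: "reach_sup f \<in> loc_concave_majorants (closure \<Omega>0 - \<Omega>1) f"
proof -
  have ninf: "reach_sup f x \<noteq> -\<infinity>" if x: "x \<in> closure \<Omega>0 - \<Omega>1" for x
  proof -
    obtain V where "reach (closure \<Omega>0 - \<Omega>1) (frontier \<Omega>0) f x V" using reach_exists[OF x] by blast
    then have "ereal V \<le> reach_sup f x" by (rule reach_sup_upper)
    then show ?thesis by auto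
  qed
  have conc: "ereal u * reach_sup f x + ereal v * reach_sup f y \<le> reach_sup f (u *\<^sub>R x + v *\<^sub>R y)"
    if seg: "closed_segment x y \<subseteq> closure \<Omega>0 - \<Omega>1" and uv: "0 \<le> u" "0 \<le> v" "u + v = 1" for x y u v
  proof (cases "u = 0 \<or> v = 0")
    case True
    then show ?thesis using uv by (auto simp flip: one_ereal_def zero_ereal_def)
  next
    case False
    then have pos: "0 < u" "0 < v" using uv by auto
    define z where "z = u *\<^sub>R x + v *\<^sub>R y"
    have u1: "u = 1 - v" using uv by simp
    have mem: "x \<in> closure \<Omega>0 - \<Omega>1" "y \<in> closure \<Omega>0 - \<Omega>1" using seg by auto
    have comb: "ereal (u * V + v * W) \<le> reach_sup f z"
      if "reach (closure \<Omega>0 - \<Omega>1) (frontier \<Omega>0) f x V" "reach (closure \<Omega>0 - \<Omega>1) (frontier \<Omega>0) f y W" for V W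
      unfolding z_def u1 by (rule reach_sup_upper[OF reach.node[OF that seg]]) (use uv in auto)
    show ?thesis
    proof (cases "reach_sup f z")
      case PInf
      then show ?thesis by (simp add: z_def)
    next
      case MInf
      obtain V W where "reach (closure \<Omega>0 - \<Omega>1) (frontier \<Omega>0) f x V" "reach (closure \<Omega>0 - \<Omega>1) (frontier \<Omega>0) f y W"
        using reach_exists mem by metis
      then show ?thesis using comb MInf by fastforce
    next
      case (real h)
      \<comment> \<open>With the value at \<open>y\<close> fixed, the supremum at \<open>x\<close>
        is bounded; only then is the supremum at \<open>y\<close> taken. Thus both turn out finite
        and no infinite values have to be combined.\<close>
      have bx: "reach_sup f x \<le> ereal ((h - v * W) / u)" if "reach (closure \<Omega>0 - \<Omega>1) (frontier \<Omega>0) f y W" for W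
      proof (rule reach_sup_least)
        fix V assume "reach (closure \<Omega>0 - \<Omega>1) (frontier \<Omega>0) f x V"
        from comb[OF this that] show "ereal V \<le> ereal ((h - v * W) / u)"
          using pos by (simp add: real le_divide_eq algebra_simps)
      qed
      obtain W0 where W0: "reach (closure \<Omega>0 - \<Omega>1) (frontier \<Omega>0) f y W0" using reach_exists[OF mem(2)] by blast
      obtain hx where hx: "reach_sup f x = ereal hx"
        using bx[OF W0] ninf[OF mem(1)] by (cases "reach_sup f x") auto
      have by': "reach_sup f y \<le> ereal ((h - u * hx) / v)"
      proof (rule reach_sup_least)
        fix W assume "reach (closure \<Omega>0 - \<Omega>1) (frontier \<Omega>0) f y W"
        from bx[OF this] show "ereal W \<le> ereal ((h - u * hx) / v)"
          using pos by (simp add: hx le_divide_eq algebra_simps)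
      qed
      obtain hy where hy: "reach_sup f y = ereal hy"
        using by' ninf[OF mem(2)] by (cases "reach_sup f y") auto
      show ?thesis using by' pos real by (simp add: hx hy z_def le_divide_eq algebra_simps)
    qed
  qed
  show ?thesis
    unfolding loc_concave_majorants_def locally_concave_on_def ext_concave_on_def
  proof (intro CollectI conjI ballI allI impI)
    fix x assume "x \<in> closure \<Omega>0 - \<Omega>1" then show "reach_sup f x \<noteq> -\<infinity>" by (rule ninf)
  next
    fix a b x y and u v :: real
    assume "closed_segment a b \<subseteq> closure \<Omega>0 - \<Omega>1" "x \<in> closed_segment a b" "y \<in> closed_segment a b"
      and uv: "0 \<le> u" "0 \<le> v" "u + v = 1"
    then have "closed_segment x y \<subseteq> closure \<Omega>0 - \<Omega>1"
      using subset_closed_segment by (metis subset_trans)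
    then show "ereal u * reach_sup f x + ereal v * reach_sup f y \<le> reach_sup f (u *\<^sub>R x + v *\<^sub>R y)"
      using conc uv by simp
  next
    fix x assume "x \<in> fixed_boundary (closure \<Omega>0 - \<Omega>1)"
    then have "x \<in> frontier \<Omega>0" using fixed_boundary_annulus by simp
    then show "ereal (f x) \<le> reach_sup f x"
      using frontier0_subset by (intro reach_sup_upper reach.leaf) auto
  qed
qed

lemma min_locally_concave_le_Bellman:
  assumes lsc: "lsc_on (frontier \<Omega>0) f" and m: "\<And>y. y \<in> frontier \<Omega>0 \<Longrightarrow> m \<le> f y"
    and x: "x \<in> closure \<Omega>0 - closure \<Omega>1" and I: "nondegenerate_interval I"
  shows "min_locally_concave (closure \<Omega>0 - \<Omega>1) f x \<le> Bellman \<Omega>0 \<Omega>1 I f x"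
proof -
  have "min_locally_concave (closure \<Omega>0 - \<Omega>1) f x \<le> reach_sup f x"
    unfolding min_locally_concave_def by (rule INF_lower[OF reach_sup_majorant])
  also have "\<dots> \<le> Bellman \<Omega>0 \<Omega>1 I f x"
  proof (rule reach_sup_least)
    fix V assume V: "reach (closure \<Omega>0 - \<Omega>1) (frontier \<Omega>0) f x V"
    show "ereal V \<le> Bellman \<Omega>0 \<Omega>1 I f x"
    proof (cases "x \<in> \<Omega>0")
      case True
      have xn: "x \<notin> closure \<Omega>1" using x by simp
      show ?thesis
      proof (rule ereal_le_epsilon2)
        fix e :: real assume e: "0 < e"
        obtain r R V' where r: "0 < r" "V - e \<le> V'" "reach (away r R) (frontier \<Omega>0) f x V'"
          using reach_strict[OF lsc m True xn V e] by blast
        have "ereal (V - e) \<le> ereal V'" using r by simp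
        also have "\<dots> \<le> Bellman \<Omega>0 \<Omega>1 I f x" by (rule Bellman_ge_reach[OF r(3,1) m I])
        finally have "ereal (V - e) + ereal e \<le> Bellman \<Omega>0 \<Omega>1 I f x + ereal e" by (rule add_right_mono)
        then show "ereal V \<le> Bellman \<Omega>0 \<Omega>1 I f x + ereal e" by simp
      qed
    next
      case False
      then have xf: "x \<in> frontier \<Omega>0" using x frontier0_iff by auto
      obtain c where c1: "c \<in> \<Omega>1" using ne1 by auto
      obtain \<rho> where \<rho>: "ball c \<rho> \<subseteq> \<Omega>1" using open1 c1 open_contains_ball by blast
      \<comment> \<open>An extreme point admits only this value, so the martingale may be replaced
        by a single leaf, which stays away from \<open>\<Omega>1\<close>.\<close>
      have Vx: "V = f x" using reach_pushed[OF lsc _ \<rho> V] xf c1 sub10 by auto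
      obtain r where r: "0 < r" "x \<in> far r" using far_point[of x] x by auto
      have "x \<in> away r (norm x)" using r x by (auto simp: away_def)
      then have "reach (away r (norm x)) (frontier \<Omega>0) f x (f x)" using xf by (rule reach.leaf)
      then show ?thesis unfolding Vx by (rule Bellman_ge_reach[OF _ r(1) m I])
    qed
  qed
  finally show ?thesis .
qed

end

section \<open>Interval means and splitting\<close>

definition mean :: "(real \<Rightarrow> 'b::euclidean_space) \<Rightarrow> real \<Rightarrow> real \<Rightarrow> 'b" where
  "mean \<phi> s t = integral {s..t} \<phi> /\<^sub>R (t - s)"

lemma mean_split:
  assumes "\<phi> integrable_on {s..t}" "s < u" "u < t"
  shows "mean \<phi> s t = (1 - (t - u) / (t - s)) *\<^sub>R mean \<phi> s u + ((t - u) / (t - s)) *\<^sub>R mean \<phi> u t"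
proof -
  have "integral {s..u} \<phi> + integral {u..t} \<phi> = integral {s..t} \<phi>"
    using Henstock_Kurzweil_Integration.integral_combine[of s u t \<phi>] assms by simp
  then have "mean \<phi> s t = inverse (t - s) *\<^sub>R integral {s..u} \<phi> + inverse (t - s) *\<^sub>R integral {u..t} \<phi>"
    by (simp add: mean_def flip: scaleR_add_right)
  moreover have "(1 - (t - u) / (t - s)) * inverse (u - s) = inverse (t - s)"
    using assms(2,3) by (simp add: field_simps)
  moreover have "((t - u) / (t - s)) * inverse (t - u) = inverse (t - s)"
    using assms(2,3) by (simp add: field_simps)
  ultimately show ?thesis by (simp add: mean_def)
qed

text \<open>A pointwise affine bound of \<open>h\<close> in terms of \<open>\<phi>\<close> passes to
  the means over every interval. This links the mean of the values to the mean point where no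
  concavity is at hand.\<close>

lemma mean_le_affine:
  fixes h :: "real \<Rightarrow> real"
  assumes "\<phi> integrable_on {s..t}" "h integrable_on {s..t}" "s < t"
    and le: "\<And>y. y \<in> {s..t} \<Longrightarrow> h y \<le> A + w \<bullet> \<phi> y"
  shows "mean h s t \<le> A + w \<bullet> mean \<phi> s t"
proof -
  have 1: "((\<lambda>y. w \<bullet> \<phi> y) has_integral (w \<bullet> integral {s..t} \<phi>)) {s..t}"
    using has_integral_linear[OF integrable_integral[OF assms(1)] bounded_linear_inner_right[of w]] by (simp add: o_def)
  have "((\<lambda>y. A + w \<bullet> \<phi> y) has_integral ((t - s) *\<^sub>R A + w \<bullet> integral {s..t} \<phi>)) {s..t}"
    using has_integral_add[OF has_integral_const_real[of A s t] 1] assms(3) by simp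
  then have "integral {s..t} h \<le> (t - s) *\<^sub>R A + w \<bullet> integral {s..t} \<phi>"
    using has_integral_le[OF integrable_integral[OF assms(2)]] le by blast
  then have "integral {s..t} h / (t - s) \<le> ((t - s) *\<^sub>R A + w \<bullet> integral {s..t} \<phi>) / (t - s)"
    using assms(3) by (intro divide_right_mono) auto
  also have "\<dots> = A + w \<bullet> mean \<phi> s t" using assms(3) by (simp add: mean_def add_divide_distrib) (simp add: divide_inverse mult.commute)
  finally show ?thesis by (simp add: mean_def divide_inverse mult.commute)
qed

lemma mean_eq_diff:
  assumes "\<phi> integrable_on {a..b}" "a \<le> s" "s \<le> t" "t \<le> b"
  shows "mean \<phi> s t = (integral {a..t} \<phi> - integral {a..s} \<phi>) /\<^sub>R (t - s)"
proof -
  have "\<phi> integrable_on {a..t}" by (rule integrable_on_subinterval[OF assms(1)]) (use assms in auto)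
  then have "integral {a..s} \<phi> + integral {s..t} \<phi> = integral {a..t} \<phi>"
    using Henstock_Kurzweil_Integration.integral_combine[of a s t \<phi>] assms by simp
  then have "integral {s..t} \<phi> = integral {a..t} \<phi> - integral {a..s} \<phi>" by (simp add: algebra_simps)
  then show ?thesis by (simp add: mean_def)
qed

lemma mean_tendsto:
  assumes int: "\<phi> integrable_on {a..b}" and s: "s \<longlonglongrightarrow> s0" and t: "t \<longlonglongrightarrow> t0"
    and st: "\<And>n. a \<le> s n" "\<And>n. s n \<le> t n" "\<And>n. t n \<le> b" and st0: "s0 < t0" "a \<le> s0" "t0 \<le> b"
  shows "(\<lambda>n. mean \<phi> (s n) (t n)) \<longlonglongrightarrow> mean \<phi> s0 t0"
proof -
  have cont: "continuous_on {a..b} (\<lambda>x. integral {a..x} \<phi>)" by (rule indefinite_integral_continuous_1[OF int])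
  have lim: "(\<lambda>n. integral {a..u n} \<phi>) \<longlonglongrightarrow> integral {a..u0} \<phi>"
    if "u \<longlonglongrightarrow> u0" "\<And>n. u n \<in> {a..b}" "u0 \<in> {a..b}" for u u0
    by (rule continuous_on_tendsto_compose[OF cont that(1,3)]) (intro always_eventually allI that(2))
  have mem: "s n \<in> {a..b}" "t n \<in> {a..b}" for n
    using st(1)[of n] st(2)[of n] st(3)[of n] by auto
  have "(\<lambda>n. (integral {a..t n} \<phi> - integral {a..s n} \<phi>) /\<^sub>R (t n - s n)) \<longlonglongrightarrow>
      (integral {a..t0} \<phi> - integral {a..s0} \<phi>) /\<^sub>R (t0 - s0)"
    by (intro tendsto_intros lim s t mem) (use st0 in auto)
  then show ?thesis using mean_eq_diff[OF int] st st0 by simp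
qed

lemma mean_continuous:
  assumes int: "\<phi> integrable_on {a..b}" and s: "continuous_on A s" and t: "continuous_on A t"
    and st: "\<And>x. x \<in> A \<Longrightarrow> a \<le> s x \<and> s x < t x \<and> t x \<le> b"
  shows "continuous_on A (\<lambda>x. mean \<phi> (s x) (t x))"
proof -
  have cont: "continuous_on {a..b} (\<lambda>x. integral {a..x} \<phi>)" by (rule indefinite_integral_continuous_1[OF int])
  have "continuous_on A (\<lambda>x. integral {a..s x} \<phi>)" "continuous_on A (\<lambda>x. integral {a..t x} \<phi>)"
    using st by (intro continuous_on_compose2[OF cont s] continuous_on_compose2[OF cont t]; fastforce)+
  then have "continuous_on A (\<lambda>x. (integral {a..t x} \<phi> - integral {a..s x} \<phi>) /\<^sub>R (t x - s x))"
    using s t st by (intro continuous_intros) force+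
  then show ?thesis
    by (rule continuous_on_eq) (use mean_eq_diff[OF int] st in force)
qed

section \<open>Lebesgue points\<close>

lemma right_lebesgue_points:
  fixes \<phi> :: "real \<Rightarrow> 'b::euclidean_space"
  assumes "\<phi> integrable_on {a..b}"
  obtains N where "negligible N"
    "\<And>x e. \<lbrakk>x \<in> {a..<b} - N; 0 < e\<rbrakk> \<Longrightarrow> \<exists>d>0. \<forall>t. x \<le> t \<and> t < x + d \<and> t \<le> b \<longrightarrow>
       norm (integral {x..t} \<phi> - (t - x) *\<^sub>R \<phi> x) \<le> e * (t - x)"
proof -
  define f where "f x = (if x \<in> {a..b} then \<phi> x else 0)" for x
  have "f integrable_on UNIV" unfolding f_def by (simp only: integrable_restrict_UNIV assms)
  then have "f integrable_on cbox u v" for u v using integrable_on_subcbox by blast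
  then obtain N where N: "negligible N"
    "\<And>x e. \<lbrakk>x \<notin> N; 0 < e\<rbrakk> \<Longrightarrow> \<exists>d>0. \<forall>h. 0 < h \<and> h < d \<longrightarrow>
        norm (integral (cbox x (x + h *\<^sub>R One)) f /\<^sub>R h ^ DIM(real) - f x) < e"
    using integrable_ccontinuous_explicit by blast
  show ?thesis
  proof (rule that[OF N(1)])
    fix x e :: real assume x: "x \<in> {a..<b} - N" and e: "0 < e"
    obtain d where d: "0 < d" "\<And>h. 0 < h \<Longrightarrow> h < d \<Longrightarrow> norm (integral (cbox x (x + h *\<^sub>R One)) f /\<^sub>R h ^ DIM(real) - f x) < e"
      using N(2)[of x e] x e by auto
    have "norm (integral {x..t} \<phi> - (t - x) *\<^sub>R \<phi> x) \<le> e * (t - x)" if t: "x \<le> t" "t < x + d" "t \<le> b" for t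
    proof (cases "x = t")
      case False
      then have h: "0 < t - x" "t - x < d" using t by auto
      have "integral {x..t} f = integral {x..t} \<phi>"
        by (rule integral_cong) (use x t in \<open>auto simp: f_def\<close>)
      then have "norm (integral {x..t} \<phi> /\<^sub>R (t - x) - \<phi> x) < e"
        using d(2)[OF h] x by (simp add: f_def)
      moreover have "integral {x..t} \<phi> - (t - x) *\<^sub>R \<phi> x = (t - x) *\<^sub>R (integral {x..t} \<phi> /\<^sub>R (t - x) - \<phi> x)"
        using h by (simp add: scaleR_diff_right)
      ultimately show ?thesis using h by (simp add: mult.commute mult_left_mono)
    qed simp
    then show "\<exists>d>0. \<forall>t. x \<le> t \<and> t < x + d \<and> t \<le> b \<longrightarrow> norm (integral {x..t} \<phi> - (t - x) *\<^sub>R \<phi> x) \<le> e * (t - x)"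
      using d(1) by blast
  qed
qed

text \<open>Right-hand Lebesgue points of \<open>\<phi>\<close> and of its reflection together
  control all short intervals containing \<open>x\<close>, also those with \<open>x\<close> not at
  an end.\<close>

lemma lebesgue_points:
  fixes \<phi> :: "real \<Rightarrow> 'b::euclidean_space"
  assumes int: "\<phi> integrable_on {a..b}"
  obtains N where "negligible N"
    "\<And>x e. \<lbrakk>x \<in> {a<..<b} - N; 0 < e\<rbrakk> \<Longrightarrow> \<exists>d>0. \<forall>s t. a \<le> s \<and> s \<le> x \<and> x \<le> t \<and> t \<le> b \<and> s < t \<and> t - s < d \<longrightarrow>
       norm (mean \<phi> s t - \<phi> x) \<le> e"
proof -
  obtain N1 where N1: "negligible N1"
    "\<And>x e. \<lbrakk>x \<in> {a..<b} - N1; 0 < e\<rbrakk> \<Longrightarrow> \<exists>d>0. \<forall>t. x \<le> t \<and> t < x + d \<and> t \<le> b \<longrightarrow>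
       norm (integral {x..t} \<phi> - (t - x) *\<^sub>R \<phi> x) \<le> e * (t - x)"
    using right_lebesgue_points[OF int] by blast
  have "(\<lambda>x. \<phi> (- x)) integrable_on {- b..- a}" using int by simp
  then obtain N2 where N2: "negligible N2"
    "\<And>x e. \<lbrakk>x \<in> {- b..<- a} - N2; 0 < e\<rbrakk> \<Longrightarrow> \<exists>d>0. \<forall>t. x \<le> t \<and> t < x + d \<and> t \<le> - a \<longrightarrow>
       norm (integral {x..t} (\<lambda>x. \<phi> (- x)) - (t - x) *\<^sub>R \<phi> (- x)) \<le> e * (t - x)"
    using right_lebesgue_points[of "\<lambda>x. \<phi> (- x)" "- b" "- a"] by blast
  have "negligible (uminus ` N2)"
    by (rule negligible_differentiable_image_negligible[OF order_refl N2(1)]) (auto intro: derivative_intros)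
  with N1(1) have "negligible (N1 \<union> uminus ` N2)" by (rule negligible_Un)
  then show ?thesis
  proof (rule that)
    fix x e :: real assume x: "x \<in> {a<..<b} - (N1 \<union> uminus ` N2)" and e: "0 < e"
    obtain d1 where d1: "0 < d1" "\<And>t. x \<le> t \<Longrightarrow> t < x + d1 \<Longrightarrow> t \<le> b \<Longrightarrow>
       norm (integral {x..t} \<phi> - (t - x) *\<^sub>R \<phi> x) \<le> e * (t - x)"
      using N1(2)[of x e] x e by auto
    have "- x \<notin> N2" using x by (metis DiffD2 UnI2 image_eqI minus_minus)
    then obtain d2 where d2: "0 < d2" "\<And>t. - x \<le> t \<Longrightarrow> t < - x + d2 \<Longrightarrow> t \<le> - a \<Longrightarrow>
       norm (integral {- x..t} (\<lambda>x. \<phi> (- x)) - (t - - x) *\<^sub>R \<phi> (- (- x))) \<le> e * (t - - x)"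
      using N2(2)[of "- x" e] x e by auto
    have left: "norm (integral {s..x} \<phi> - (x - s) *\<^sub>R \<phi> x) \<le> e * (x - s)" if "s \<le> x" "x - d2 < s" "a \<le> s" for s
    proof -
      have "integral {- x..- s} (\<lambda>x. \<phi> (- x)) = integral {s..x} \<phi>" by simp
      then show ?thesis using d2(2)[of "- s"] that by simp
    qed
    show "\<exists>d>0. \<forall>s t. a \<le> s \<and> s \<le> x \<and> x \<le> t \<and> t \<le> b \<and> s < t \<and> t - s < d \<longrightarrow> norm (mean \<phi> s t - \<phi> x) \<le> e"
    proof (intro exI[of _ "min d1 d2"] conjI allI impI)
      show "0 < min d1 d2" using d1 d2 by simp
      fix s t assume "a \<le> s \<and> s \<le> x \<and> x \<le> t \<and> t \<le> b \<and> s < t \<and> t - s < min d1 d2"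
      then have st: "a \<le> s" "s \<le> x" "x \<le> t" "t \<le> b" "s < t" "t - s < d1" "t - s < d2" by auto
      have "\<phi> integrable_on {s..t}" by (rule integrable_on_subinterval[OF int]) (use st in auto)
      then have "integral {s..x} \<phi> + integral {x..t} \<phi> = integral {s..t} \<phi>"
        using Henstock_Kurzweil_Integration.integral_combine[of s x t \<phi>] st by simp
      then have "integral {s..t} \<phi> - (t - s) *\<^sub>R \<phi> x
          = (integral {s..x} \<phi> - (x - s) *\<^sub>R \<phi> x) + (integral {x..t} \<phi> - (t - x) *\<^sub>R \<phi> x)"
        by (simp add: algebra_simps flip: \<open>integral {s..x} \<phi> + integral {x..t} \<phi> = integral {s..t} \<phi>\<close>)
      then have "norm (integral {s..t} \<phi> - (t - s) *\<^sub>R \<phi> x) \<le> e * (x - s) + e * (t - x)"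
        using norm_triangle_mono[OF left[of s] d1(2)[of t]] st by simp
      also have "\<dots> = (t - s) * e" by (simp add: algebra_simps)
      finally have 1: "norm (integral {s..t} \<phi> - (t - s) *\<^sub>R \<phi> x) \<le> (t - s) * e" .
      have "mean \<phi> s t - \<phi> x = (integral {s..t} \<phi> - (t - s) *\<^sub>R \<phi> x) /\<^sub>R (t - s)"
        using st by (simp add: mean_def scaleR_diff_right)
      then have "norm (mean \<phi> s t - \<phi> x) = norm (integral {s..t} \<phi> - (t - s) *\<^sub>R \<phi> x) / (t - s)"
        using st by (simp add: divide_inverse mult.commute)
      also have "\<dots> \<le> e" using 1 st by (simp add: divide_le_eq mult.commute)
      finally show "norm (mean \<phi> s t - \<phi> x) \<le> e" .
    qed
  qed
qed

section \<open>Splitting an interval so that the segment of means misses a convex set\<close>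

lemma segment_hits_open:
  fixes p :: "real \<Rightarrow> 'a::euclidean_space"
  assumes "continuous_on A p" "open Q" "s0 \<in> A" "closed_segment x (p s0) \<inter> Q \<noteq> {}"
  obtains d where "0 < d" "\<And>s. s \<in> A \<Longrightarrow> dist s s0 < d \<Longrightarrow> closed_segment x (p s) \<inter> Q \<noteq> {}"
proof -
  obtain u where u: "0 \<le> u" "u \<le> 1" "(1 - u) *\<^sub>R x + u *\<^sub>R p s0 \<in> Q" using assms(4) by (auto simp: in_segment)
  have cont: "continuous_on A (\<lambda>s. (1 - u) *\<^sub>R x + u *\<^sub>R p s)" by (intro continuous_intros assms(1))
  obtain e where e: "0 < e" "ball ((1 - u) *\<^sub>R x + u *\<^sub>R p s0) e \<subseteq> Q" using assms(2) u(3) open_contains_ball by blast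
  obtain d where d: "0 < d" "\<And>s. s \<in> A \<Longrightarrow> dist s s0 < d \<Longrightarrow> dist ((1 - u) *\<^sub>R x + u *\<^sub>R p s) ((1 - u) *\<^sub>R x + u *\<^sub>R p s0) < e"
    using cont assms(3) e(1) unfolding continuous_on_iff by meson
  show ?thesis
  proof (rule that[OF d(1)])
    fix s assume "s \<in> A" "dist s s0 < d"
    then have "dist ((1 - u) *\<^sub>R x + u *\<^sub>R p s) ((1 - u) *\<^sub>R x + u *\<^sub>R p s0) < e" by (rule d(2))
    then have "(1 - u) *\<^sub>R x + u *\<^sub>R p s \<in> Q" by (intro subsetD[OF e(2)]) (simp only: mem_ball dist_commute)
    moreover have "(1 - u) *\<^sub>R x + u *\<^sub>R p s \<in> closed_segment x (p s)" using u by (auto simp: in_segment)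
    ultimately show "closed_segment x (p s) \<inter> Q \<noteq> {}" by blast
  qed
qed

text \<open>Moving the splitting point continuously: the segment can neither jump from meeting \<open>Q\<close> on
  one side of \<open>x\<close> to meeting it on the other side, nor meet \<open>Q\<close> on the side where it is short.\<close>

lemma splitting_point:
  fixes p q :: "real \<Rightarrow> 'a::euclidean_space"
  assumes h: "0 < h" and p: "continuous_on {0<..h} p" and q: "continuous_on {0<..h} q"
    and x: "\<And>s. s \<in> {0<..h} \<Longrightarrow> x \<in> closed_segment (p s) (q s)"
    and lim: "(p \<longlongrightarrow> x) (at_right 0)" and Q: "open Q" "convex Q" and \<eta>: "0 < \<eta>" "ball x \<eta> \<inter> Q = {}"
    and hit: "closed_segment x (p h) \<inter> Q \<noteq> {}"
  obtains s where "0 < s" "s < h" "closed_segment (p s) (q s) \<inter> Q = {}" "\<eta> \<le> dist (p s) x"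
proof -
  have xQ: "x \<notin> Q" using \<eta> centre_in_ball[of x \<eta>] by blast
  have far_hit: "\<eta> \<le> dist y x" if hit: "closed_segment x y \<inter> Q \<noteq> {}" for y
  proof (rule ccontr)
    assume "\<not> \<eta> \<le> dist y x"
    then have "closed_segment x y \<subseteq> ball x \<eta>" using \<eta> by (intro closed_segment_subset convex_ball) (auto simp: dist_commute)
    then show False using hit \<eta> by blast
  qed
  \<comment> \<open>If both sides met \<open>Q\<close>, then \<open>x\<close> would be a convex
    combination of two points of \<open>Q\<close>, hence in \<open>Q\<close>.\<close>
  have both: False if "s \<in> {0<..h}" "closed_segment x (p s) \<inter> Q \<noteq> {}" "closed_segment x (q s) \<inter> Q \<noteq> {}" for s
  proof -
    obtain y1 where y1: "y1 \<in> closed_segment x (p s)" "y1 \<in> Q" using \<open>closed_segment x (p s) \<inter> Q \<noteq> {}\<close> by blast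
    obtain y2 where y2: "y2 \<in> closed_segment x (q s)" "y2 \<in> Q" using \<open>closed_segment x (q s) \<inter> Q \<noteq> {}\<close> by blast
    obtain u where u: "0 \<le> u" "y1 = (1 - u) *\<^sub>R x + u *\<^sub>R p s" using y1 by (auto simp: in_segment)
    obtain v where v: "0 \<le> v" "y2 = (1 - v) *\<^sub>R x + v *\<^sub>R q s" using y2 by (auto simp: in_segment)
    obtain l where l: "0 \<le> l" "l \<le> 1" "x = (1 - l) *\<^sub>R p s + l *\<^sub>R q s" using x[OF \<open>s \<in> {0<..h}\<close>] by (auto simp: in_segment)
    define D where "D = u * l + v * (1 - l)"
    have px: "p s - x = l *\<^sub>R (p s - q s)" and qx: "q s - x = (l - 1) *\<^sub>R (p s - q s)"
      by (subst l(3), simp add: algebra_simps)+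
    have "y1 = x + u *\<^sub>R (p s - x)" "y2 = x + v *\<^sub>R (q s - x)" unfolding u(2) v(2) by (simp_all add: algebra_simps)
    then have y1': "y1 = x + (u * l) *\<^sub>R (p s - q s)" and y2': "y2 = x + (v * (l - 1)) *\<^sub>R (p s - q s)"
      unfolding px qx by simp_all
    have D0: "0 \<le> u * l" "0 \<le> v * (1 - l)" using u v l by auto
    show False
    proof (cases "D = 0")
      case True
      then have "u * l = 0" using D0 unfolding D_def by linarith
      then have "y1 = x" unfolding y1' by (simp only: scaleR_zero_left add_0_right)
      then show False using y1(2) xQ by simp
    next
      case False
      then have D: "0 < D" using D0 by (simp add: D_def)
      have "(1 - u * l / D) *\<^sub>R y1 + (u * l / D) *\<^sub>R y2 \<in> Q"
        using convexD_alt[OF Q(2) y1(2) y2(2), of "u * l / D"] D D0 by (simp add: D_def)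
      moreover have "(1 - u * l / D) *\<^sub>R y1 + (u * l / D) *\<^sub>R y2
          = x + ((1 - u * l / D) * (u * l) + (u * l / D) * (v * (l - 1))) *\<^sub>R (p s - q s)"
      proof -
        have "(1 - t) *\<^sub>R (x + c *\<^sub>R e) + t *\<^sub>R (x + d *\<^sub>R e) = x + ((1 - t) * c + t * d) *\<^sub>R e" for t c d e
          by (simp add: algebra_simps)
        then show ?thesis unfolding y1' y2' by blast
      qed
      moreover have "(1 - u * l / D) * (u * l) + (u * l / D) * (v * (l - 1)) = 0"
      proof -
        have e: "1 - u * l / D = v * (1 - l) / D" using D by (simp add: D_def field_simps)
        have "v * (1 - l) / D * (u * l) + (u * l / D) * (v * (l - 1)) = (v * (1 - l) * (u * l) + u * l * (v * (l - 1))) / D"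
          by (simp add: add_divide_distrib)
        also have "v * (1 - l) * (u * l) + u * l * (v * (l - 1)) = 0" by (simp add: algebra_simps)
        finally show ?thesis unfolding e by simp
      qed
      ultimately show False using xQ by simp
    qed
  qed
  \<comment> \<open>At the supremum of \<open>A\<close> the side of \<open>p\<close> misses
    \<open>Q\<close>, since hitting an open set is stable; immediately above it this side hits
    \<open>Q\<close>.\<close>
  define A where "A = {s \<in> {0<..h}. closed_segment x (p s) \<inter> Q = {}}"
  have "\<forall>\<^sub>F s in at_right 0. dist (p s) x < \<eta>" using lim \<eta>(1) by (rule tendstoD)
  then obtain b where b: "0 < b" "\<And>s. 0 < s \<Longrightarrow> s < b \<Longrightarrow> dist (p s) x < \<eta>"
    unfolding eventually_at_right_field by blast
  define s1 where "s1 = min (b / 2) (h / 2)"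
  have s1: "dist (p s1) x < \<eta>" "s1 < h" "0 < s1" using b h by (auto simp: s1_def intro!: b(2))
  have s1A: "s1 \<in> A" using s1 far_hit[of "p s1"] by (auto simp: A_def)
  have bdd: "bdd_above A" by (rule bdd_aboveI[of _ h]) (auto simp: A_def)
  define r where "r = Sup A"
  have r0: "0 < r" using cSup_upper[OF s1A bdd] s1 by (simp add: r_def)
  have rh: "r \<le> h" unfolding r_def by (rule cSup_least) (use s1A in \<open>auto simp: A_def\<close>)
  have rmem: "r \<in> {0<..h}" using r0 rh by simp
  have rA: "closed_segment x (p r) \<inter> Q = {}"
  proof (rule ccontr)
    assume "closed_segment x (p r) \<inter> Q \<noteq> {}"
    then obtain d where d: "0 < d" "\<And>s. s \<in> {0<..h} \<Longrightarrow> dist s r < d \<Longrightarrow> closed_segment x (p s) \<inter> Q \<noteq> {}"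
      using segment_hits_open[OF p Q(1) rmem] by blast
    obtain s where s: "s \<in> A" "r - d < s" using less_cSupD[of A "r - d"] s1A d(1) by (auto simp: r_def)
    have "s \<le> r" unfolding r_def by (rule cSup_upper[OF s(1) bdd])
    then have "closed_segment x (p s) \<inter> Q \<noteq> {}" using s by (intro d(2)) (auto simp: A_def dist_real_def)
    then show False using s(1) by (simp add: A_def)
  qed
  have rlt: "r < h" using rA hit rh by (cases "r = h") auto
  have above: "closed_segment x (p s) \<inter> Q \<noteq> {}" if "r < s" "s \<le> h" for s
  proof
    assume "closed_segment x (p s) \<inter> Q = {}"
    then have "s \<in> A" using that r0 by (simp add: A_def)
    then have "s \<le> r" unfolding r_def by (rule cSup_upper[OF _ bdd])
    then show False using that by simp
  qed
  \<comment> \<open>If the side of \<open>q\<close> hit \<open>Q\<close> at \<open>r\<close>, it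
    would do so slightly above \<open>r\<close> too, where the side of \<open>p\<close>
    hits.\<close>
  have rq: "closed_segment x (q r) \<inter> Q = {}"
  proof (rule ccontr)
    assume "closed_segment x (q r) \<inter> Q \<noteq> {}"
    then obtain d where d: "0 < d" "\<And>s. s \<in> {0<..h} \<Longrightarrow> dist s r < d \<Longrightarrow> closed_segment x (q s) \<inter> Q \<noteq> {}"
      using segment_hits_open[OF q Q(1) rmem] by blast
    define s where "s = min h (r + d / 2)"
    have "r < s" "s \<le> h" "s \<in> {0<..h}" "dist s r < d" using d(1) rlt r0 by (auto simp: s_def dist_real_def)
    then show False using both above d(2) by blast
  qed
  \<comment> \<open>Immediately above \<open>r\<close> the points \<open>p s\<close> have distance
    at least \<open>\<eta>\<close> because their side hits \<open>Q\<close>; continuity carries this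
    to \<open>r\<close>.\<close>
  have "\<eta> \<le> dist (p r) x"
  proof (rule ccontr)
    assume "\<not> \<eta> \<le> dist (p r) x"
    then have lt: "0 < \<eta> - dist (p r) x" by simp
    obtain d where d: "0 < d" "\<And>s. s \<in> {0<..h} \<Longrightarrow> dist s r < d \<Longrightarrow> dist (p s) (p r) < \<eta> - dist (p r) x"
      using p rmem lt unfolding continuous_on_iff by meson
    define s where "s = min h (r + d / 2)"
    have s: "r < s" "s \<le> h" "s \<in> {0<..h}" "dist s r < d" using d(1) rlt r0 by (auto simp: s_def dist_real_def)
    have "dist (p s) x < \<eta>" using d(2)[OF s(3,4)] dist_triangle[of "p s" x "p r"] by linarith
    then show False using far_hit[OF above[OF s(1,2)]] by simp
  qed
  moreover have "closed_segment (p r) (q r) \<inter> Q = {}"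
    using Un_closed_segment[OF x[OF rmem]] rA rq by (auto simp: closed_segment_commute)
  ultimately show ?thesis using that r0 rlt by blast
qed

lemma mean_at_left_end:
  assumes int: "\<phi> integrable_on {a..b}" and "a < b"
  shows "((\<lambda>s. mean \<phi> (a + s) b) \<longlongrightarrow> mean \<phi> a b) (at_right 0)"
proof -
  have "continuous_on {0..(b - a) / 2} (\<lambda>s. mean \<phi> (a + s) b)"
    by (rule mean_continuous[OF int]) (use \<open>a < b\<close> in \<open>auto intro!: continuous_intros simp: field_simps\<close>)
  then have "((\<lambda>s. mean \<phi> (a + s) b) \<longlongrightarrow> mean \<phi> (a + 0) b) (at 0 within {0..(b - a) / 2})"
    using \<open>a < b\<close> unfolding continuous_on_def by (elim ballE[of _ _ 0]) auto
  moreover have "at 0 within {0..(b - a) / 2} = at_right (0::real)"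
    using \<open>a < b\<close> by (intro at_within_Icc_at_right) auto
  ultimately show ?thesis by simp
qed

lemma mean_at_right_end:
  assumes int: "\<phi> integrable_on {a..b}" and "a < b"
  shows "((\<lambda>s. mean \<phi> a (b - s)) \<longlongrightarrow> mean \<phi> a b) (at_right 0)"
proof -
  have "continuous_on {0..(b - a) / 2} (\<lambda>s. mean \<phi> a (b - s))"
    by (rule mean_continuous[OF int]) (use \<open>a < b\<close> in \<open>auto intro!: continuous_intros simp: field_simps\<close>)
  then have "((\<lambda>s. mean \<phi> a (b - s)) \<longlongrightarrow> mean \<phi> a (b - 0)) (at 0 within {0..(b - a) / 2})"
    using \<open>a < b\<close> unfolding continuous_on_def by (elim ballE[of _ _ 0]) auto
  moreover have "at 0 within {0..(b - a) / 2} = at_right (0::real)"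
    using \<open>a < b\<close> by (intro at_within_Icc_at_right) auto
  ultimately show ?thesis by simp
qed

lemma mean_in_segment:
  assumes "\<phi> integrable_on {a..b}" "a < u" "u < b"
  shows "mean \<phi> a b \<in> closed_segment (mean \<phi> a u) (mean \<phi> u b)"
  unfolding in_segment using mean_split[OF assms] assms(2,3)
  by (intro exI[of _ "(b - u) / (b - a)"]) auto

text \<open>The midpoint is tried first. If the segment to the mean of one half meets
  \<open>Q\<close>, the splitting point is moved so that this half grows: when it fills the interval
  its mean is that of the whole interval and the meeting has ceased. The longer part then pays for
  its length by a displacement of its mean.\<close>

lemma splitting_interval:
  fixes \<phi> :: "real \<Rightarrow> 'a::euclidean_space"
  assumes int: "\<phi> integrable_on {a..b}" and ab: "a < b"
    and Q: "open Q" "convex Q" and \<eta>: "0 < \<eta>" "ball (mean \<phi> a b) \<eta> \<inter> Q = {}"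
  obtains t where "a < t" "t < b" "closed_segment (mean \<phi> a t) (mean \<phi> t b) \<inter> Q = {}"
    "t - a \<le> (b - a) / 2 \<or> \<eta> \<le> dist (mean \<phi> a t) (mean \<phi> a b)"
    "b - t \<le> (b - a) / 2 \<or> \<eta> \<le> dist (mean \<phi> t b) (mean \<phi> a b)"
proof -
  define h where "h = (b - a) / 2"
  have h: "0 < h" "h < b - a" using ab by (auto simp: h_def field_simps)
  let ?x = "mean \<phi> a b"
  consider "closed_segment ?x (mean \<phi> (a + h) b) \<inter> Q \<noteq> {}" | "closed_segment ?x (mean \<phi> a (b - h)) \<inter> Q \<noteq> {}"
    | "closed_segment ?x (mean \<phi> (a + h) b) \<inter> Q = {}" "closed_segment ?x (mean \<phi> a (b - h)) \<inter> Q = {}" by blast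
  then show ?thesis
  proof cases
    case 1
    have "continuous_on {0<..h} (\<lambda>s. mean \<phi> (a + s) b)" "continuous_on {0<..h} (\<lambda>s. mean \<phi> a (a + s))"
      using h by (auto intro!: mean_continuous[OF int] continuous_intros)
    moreover have "?x \<in> closed_segment (mean \<phi> (a + s) b) (mean \<phi> a (a + s))" if "s \<in> {0<..h}" for s
      using mean_in_segment[OF int, of "a + s"] that h by (simp add: closed_segment_commute)
    ultimately obtain s where s: "0 < s" "s < h" "closed_segment (mean \<phi> (a + s) b) (mean \<phi> a (a + s)) \<inter> Q = {}"
        "\<eta> \<le> dist (mean \<phi> (a + s) b) ?x"
      using splitting_point[OF h(1) _ _ _ mean_at_left_end[OF int ab] Q \<eta> 1] by blast
    then show ?thesis using that[of "a + s"] h by (simp add: closed_segment_commute h_def)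
  next
    case 2
    have "continuous_on {0<..h} (\<lambda>s. mean \<phi> a (b - s))" "continuous_on {0<..h} (\<lambda>s. mean \<phi> (b - s) b)"
      using h by (auto intro!: mean_continuous[OF int] continuous_intros)
    moreover have "?x \<in> closed_segment (mean \<phi> a (b - s)) (mean \<phi> (b - s) b)" if "s \<in> {0<..h}" for s
      using mean_in_segment[OF int, of "b - s"] that h by simp
    ultimately obtain s where s: "0 < s" "s < h" "closed_segment (mean \<phi> a (b - s)) (mean \<phi> (b - s) b) \<inter> Q = {}"
        "\<eta> \<le> dist (mean \<phi> a (b - s)) ?x"
      using splitting_point[OF h(1) _ _ _ mean_at_right_end[OF int ab] Q \<eta> 2] by blast
    then show ?thesis using that[of "b - s"] h by (simp add: h_def)
  next
    case 3
    have e: "b - h = a + h" by (simp add: h_def field_simps)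
    have "?x \<in> closed_segment (mean \<phi> a (a + h)) (mean \<phi> (a + h) b)"
      using mean_in_segment[OF int, of "a + h"] h by simp
    from Un_closed_segment[OF this] have "closed_segment (mean \<phi> a (a + h)) (mean \<phi> (a + h) b) \<inter> Q = {}"
      using 3 unfolding e by (auto simp: closed_segment_commute)
    then show ?thesis using that[of "a + h"] h by (simp add: h_def field_simps)
  qed
qed

text \<open>The truncation at \<open>m + k\<close> keeps the minorants bounded, so that their compositions with an
  admissible function are integrable.\<close>

definition lip_minorant :: "'a::euclidean_space set \<Rightarrow> ('a \<Rightarrow> real) \<Rightarrow> real \<Rightarrow> nat \<Rightarrow> 'a \<Rightarrow> real" where
  "lip_minorant F f m k z = (INF p\<in>F. min (f p) (m + real k) + real k * dist p z)"

context
  fixes F :: "'a::euclidean_space set" and f :: "'a \<Rightarrow> real" and m :: real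
  assumes F: "F \<noteq> {}" and m: "\<And>p. p \<in> F \<Longrightarrow> m \<le> f p"
begin

lemma lip_minorant_bdd: "bdd_below ((\<lambda>p. min (f p) (m + real k) + real k * dist p z) ` F)"
  using m by (intro bdd_belowI[of _ m]) (force intro: add_increasing2)

lemma lip_minorant_ge: "m \<le> lip_minorant F f m k z"
  unfolding lip_minorant_def using m by (intro cINF_greatest F) (auto intro!: add_increasing2)

lemma lip_minorant_le: "z \<in> F \<Longrightarrow> lip_minorant F f m k z \<le> min (f z) (m + real k)"
  unfolding lip_minorant_def using cINF_lower[OF lip_minorant_bdd[of k z], of z] by simp

lemma lip_minorant_mono: "k \<le> k' \<Longrightarrow> lip_minorant F f m k z \<le> lip_minorant F f m k' z"
  unfolding lip_minorant_def
  by (rule cINF_mono[OF F lip_minorant_bdd]) (auto intro!: bexI add_mono mult_right_mono)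

lemma lip_minorant_lipschitz: "lip_minorant F f m k z \<le> lip_minorant F f m k z' + real k * dist z z'"
proof -
  have "lip_minorant F f m k z - real k * dist z z' \<le> lip_minorant F f m k z'"
    unfolding lip_minorant_def[of F f m k z']
  proof (rule cINF_greatest[OF F])
    fix p assume p: "p \<in> F"
    have "lip_minorant F f m k z \<le> min (f p) (m + real k) + real k * dist p z"
      unfolding lip_minorant_def by (rule cINF_lower[OF lip_minorant_bdd p])
    also have "\<dots> \<le> min (f p) (m + real k) + real k * (dist p z' + dist z z')"
      by (intro add_left_mono mult_left_mono dist_triangle2) simp
    finally show "lip_minorant F f m k z - real k * dist z z' \<le> min (f p) (m + real k) + real k * dist p z'"
      by (simp add: algebra_simps)
  qed
  then show ?thesis by simp
qed

lemma lip_minorant_continuous: "continuous_on UNIV (lip_minorant F f m k)"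
proof (rule lipschitz_on_continuous_on[of "real k"], rule lipschitz_onI)
  fix x y
  show "dist (lip_minorant F f m k x) (lip_minorant F f m k y) \<le> real k * dist x y"
    using lip_minorant_lipschitz[of k x y] lip_minorant_lipschitz[of k y x]
    by (simp add: dist_real_def dist_commute abs_le_iff)
qed simp

text \<open>In the infimum, points near \<open>z\<close> are controlled by lower semicontinuity;
  points farther than \<open>d\<close> carry a penalty of at least \<open>k * d\<close>, which
  outgrows the bound \<open>m\<close> from below.\<close>

lemma lip_minorant_tendsto:
  assumes lsc: "lsc_on F f" and z: "z \<in> F"
  shows "(\<lambda>k. lip_minorant F f m k z) \<longlonglongrightarrow> f z"
proof (rule order_tendstoI)
  fix c assume c: "c < f z"
  obtain c' where c': "c < c'" "c' < f z" using c dense by blast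
  have "\<forall>\<^sub>F y in at z within F. c' < f y" using lsc c' z unfolding lsc_on_def by simp
  then obtain d where d: "0 < d" "\<And>y. y \<in> F \<Longrightarrow> dist y z < d \<Longrightarrow> c' < f y"
    unfolding eventually_at using c' by metis
  obtain K where K: "max (c' - m) ((c' - m) / d) < real K" using reals_Archimedean2 by blast
  have "c < lip_minorant F f m k z" if "K \<le> k" for k
  proof -
    have k: "c' \<le> m + real k" "c' \<le> m + real k * d"
      using K that d(1) by (auto simp: divide_less_eq) (smt (verit) mult_right_mono of_nat_le_iff)
    have "c' \<le> lip_minorant F f m k z"
      unfolding lip_minorant_def
    proof (rule cINF_greatest[OF F])
      fix p assume p: "p \<in> F"
      show "c' \<le> min (f p) (m + real k) + real k * dist p z"
      proof (cases "dist p z < d")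
        case True
        then have "c' \<le> min (f p) (m + real k)" using d(2)[OF p] k by simp
        then show ?thesis by (intro add_increasing2) auto
      next
        case False
        then have "real k * d \<le> real k * dist p z" by (intro mult_left_mono) auto
        moreover have "m \<le> min (f p) (m + real k)" using m[OF p] by simp
        ultimately show ?thesis using k(2) by linarith
      qed
    qed
    then show ?thesis using c' by simp
  qed
  then show "\<forall>\<^sub>F k in sequentially. c < lip_minorant F f m k z" unfolding eventually_sequentially by blast
next
  fix c assume "f z < c"
  then show "\<forall>\<^sub>F k in sequentially. lip_minorant F f m k z < c"
    using lip_minorant_le[OF z] by (intro always_eventually allI) (smt (verit) min_le_iff_disj)
qed

end

section \<open>Majorants dominate averages\<close>

text \<open>Exceptional points are put into a small open set, on which an integrand can be lowered
  at little cost.\<close>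

lemma negligible_open_cover:
  fixes N :: "real set"
  assumes "negligible N" "0 < e"
  obtains T where "open T" "N \<subseteq> T" "T \<in> lmeasurable" "measure lebesgue T < e"
proof -
  have N: "N \<in> null_sets lebesgue" using assms(1) by (simp add: negligible_iff_null_sets)
  obtain T where T: "open T" "N \<subseteq> T" "T - N \<in> lmeasurable" "emeasure lebesgue (T - N) < ennreal e"
    using sets_lebesgue_outer_open[OF null_setsD2[OF N] assms(2)] by blast
  have "T = (T - N) \<union> N" using T(2) by auto
  moreover have "emeasure lebesgue ((T - N) \<union> N) = emeasure lebesgue (T - N)"
    by (rule emeasure_Un_null_set[OF _ N]) (use T(3) in auto)
  ultimately have em: "emeasure lebesgue T < ennreal e" using T(4) by metis
  then have lm: "T \<in> lmeasurable"
    using T(1) by (intro fmeasurableI) (auto simp: top.not_eq_extremum intro: order_less_trans)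
  then have "ennreal (measure lebesgue T) < ennreal e" using em by (simp add: emeasure_eq_measure2)
  then show ?thesis using that[OF T(1,2) lm] by (simp add: ennreal_less_iff)
qed

context convex_annulus
begin

text \<open>Phrased with real lower bounds at the ends, since \<open>G\<close> may be infinite
  there.\<close>

lemma majorant_segment:
  assumes G: "G \<in> loc_concave_majorants (closure \<Omega>0 - \<Omega>1) f"
    and seg: "closed_segment a b \<subseteq> closure \<Omega>0 - \<Omega>1"
    and ab: "ereal A \<le> G a" "ereal B \<le> G b" and t: "0 \<le> t" "t \<le> 1"
  shows "ereal ((1 - t) * A + t * B) \<le> G ((1 - t) *\<^sub>R a + t *\<^sub>R b)"
proof -
  have "ext_concave_on (closed_segment a b) G"
    using G seg by (simp add: loc_concave_majorants_def locally_concave_on_def)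
  then have "ereal (1 - t) * G a + ereal t * G b \<le> G ((1 - t) *\<^sub>R a + t *\<^sub>R b)"
    unfolding ext_concave_on_def using t by simp
  moreover have "ereal (1 - t) * ereal A + ereal t * ereal B \<le> ereal (1 - t) * G a + ereal t * G b"
    using ab t by (intro add_mono ereal_mult_left_mono) auto
  ultimately show ?thesis by simp
qed

lemma majorant_ge_f:
  assumes "G \<in> loc_concave_majorants (closure \<Omega>0 - \<Omega>1) f" "p \<in> frontier \<Omega>0"
  shows "ereal (f p) \<le> G p"
  using assms fixed_boundary_annulus by (simp add: loc_concave_majorants_def)

lemma majorant_ge:
  assumes G: "G \<in> loc_concave_majorants (closure \<Omega>0 - \<Omega>1) f" and m: "\<And>p. p \<in> frontier \<Omega>0 \<Longrightarrow> m \<le> f p"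
    and y: "y \<in> \<Omega>0" "y \<notin> \<Omega>1"
  shows "ereal m \<le> G y"
proof -
  obtain a b where ab: "a \<in> frontier \<Omega>0" "b \<in> frontier \<Omega>0" "y \<in> open_segment a b"
    "closed_segment a b \<subseteq> closure \<Omega>0 - \<Omega>1"
    using chord_exists[OF y] by blast
  obtain u where u: "0 < u" "u < 1" "y = (1 - u) *\<^sub>R a + u *\<^sub>R b" using ab(3) by (auto simp: in_segment)
  have ge: "ereal m \<le> G p" if "p \<in> frontier \<Omega>0" for p
    using majorant_ge_f[OF G that] m[OF that] by (meson ereal_less_eq(3) order_trans)
  have "ereal ((1 - u) * m + u * m) \<le> G y"
    unfolding u(3) by (rule majorant_segment[OF G ab(4) ge[OF ab(1)] ge[OF ab(2)]]) (use u in auto)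
  then show ?thesis by (simp flip: distrib_right)
qed

text \<open>A uniform form of strict convexity. Over the compact set of triples of a contact point
  \<open>p\<close> in a ball, a unit supporting normal and a point of the closure at distance
  exactly \<open>\<kappa>\<close> from \<open>p\<close>, the functional is positive and so has a
  positive lower bound \<open>e\<close>. More distant points reduce to these by convexity.\<close>

lemma support_modulus:
  assumes \<kappa>: "0 < \<kappa>"
  obtains C where "0 \<le> C" "\<And>p. p \<in> frontier \<Omega>0 \<Longrightarrow> norm p \<le> R \<Longrightarrow>
    \<exists>w. norm w = 1 \<and> (\<forall>q\<in>closure \<Omega>0. dist q p \<le> \<kappa> + C * (w \<bullet> (q - p)))"
proof -
  define K where "K = ((frontier \<Omega>0 \<inter> cball 0 R) \<times> sphere 0 1 \<times> (closure \<Omega>0 \<inter> cball 0 (R + \<kappa>)))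
     \<inter> ({z. dist (snd (snd z)) (fst z) = \<kappa>} \<inter> (\<Inter>y\<in>closure \<Omega>0. {z. 0 \<le> fst (snd z) \<bullet> (y - fst z)}))"
  have "compact ((frontier \<Omega>0 \<inter> cball 0 R) \<times> sphere (0::'a) 1 \<times> (closure \<Omega>0 \<inter> cball 0 (R + \<kappa>)))"
    by (intro compact_Times closed_Int_compact frontier_closed closed_closure compact_cball compact_sphere)
  moreover have "closed ({z :: 'a \<times> 'a \<times> 'a. dist (snd (snd z)) (fst z) = \<kappa>} \<inter> (\<Inter>y\<in>closure \<Omega>0. {z. 0 \<le> fst (snd z) \<bullet> (y - fst z)}))"
    by (intro closed_Int closed_INT ballI closed_Collect_eq closed_Collect_le continuous_intros)
  ultimately have "compact K" unfolding K_def by (rule compact_Int_closed)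
  have Kpos: "0 < fst (snd z) \<bullet> (snd (snd z) - fst z)" if "z \<in> K" for z
  proof -
    obtain p w y where z: "z = (p, w, y)" by (cases z)
    have k: "p \<in> frontier \<Omega>0" "norm w = 1" "y \<in> closure \<Omega>0" "dist y p = \<kappa>" "\<And>y. y \<in> closure \<Omega>0 \<Longrightarrow> 0 \<le> w \<bullet> (y - p)"
      using \<open>z \<in> K\<close> by (auto simp: K_def z)
    show ?thesis
    proof (rule ccontr)
      assume "\<not> ?thesis"
      then have "w \<bullet> (y - p) \<le> 0" by (simp add: z)
      then have "y = p"
        using strictly_supported_point_unique[OF open0 convex0 strict0, of w p y] k
        by (metis closure_subset frontier0_iff norm_zero subsetD zero_neq_one)
      then show False using k(4) \<kappa> by simp
    qed
  qed
  obtain e where e: "0 < e" "\<And>z. z \<in> K \<Longrightarrow> e \<le> fst (snd z) \<bullet> (snd (snd z) - fst z)"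
  proof (cases "K = {}")
    case True
    then show ?thesis using that[of 1] by simp
  next
    case False
    have "continuous_on K (\<lambda>z. fst (snd z) \<bullet> (snd (snd z) - fst z))" by (intro continuous_intros)
    then obtain z0 where "z0 \<in> K" "\<And>z. z \<in> K \<Longrightarrow> fst (snd z0) \<bullet> (snd (snd z0) - fst z0) \<le> fst (snd z) \<bullet> (snd (snd z) - fst z)"
      using continuous_attains_inf[OF \<open>compact K\<close> False] by blast
    then show ?thesis using Kpos that by blast
  qed
  show ?thesis
  proof (rule that[of "\<kappa> / e"])
    show "0 \<le> \<kappa> / e" using \<kappa> e by simp
    fix p assume p: "p \<in> frontier \<Omega>0" "norm p \<le> R"
    obtain w where w: "norm w = 1" "\<And>y. y \<in> closure \<Omega>0 \<Longrightarrow> 0 \<le> w \<bullet> (y - p)"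
      using frontier_supporting_hyperplane[OF open0 convex0 p(1)] by blast
    have "dist q p \<le> \<kappa> + \<kappa> / e * (w \<bullet> (q - p))" if q: "q \<in> closure \<Omega>0" for q
    proof (cases "dist q p \<le> \<kappa>")
      case True
      then show ?thesis using w(2)[OF q] \<kappa> e by (simp add: add_increasing2)
    next
      case False
      define D where "D = dist q p"
      have D: "\<kappa> < D" "0 < D" using False \<kappa> by (auto simp: D_def)
      \<comment> \<open>The point at distance \<open>\<kappa>\<close> from \<open>p\<close> on the
        segment to \<open>q\<close>; the functional scales linearly along it.\<close>
      define y where "y = (1 - \<kappa> / D) *\<^sub>R p + (\<kappa> / D) *\<^sub>R q"
      have yp: "y - p = (\<kappa> / D) *\<^sub>R (q - p)" by (simp add: y_def algebra_simps)
      have "y \<in> closure \<Omega>0"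
        unfolding y_def using convexD_alt[OF convex_closure[OF convex0], of p q "\<kappa> / D"] p q D \<kappa>
        by (simp add: frontier0_iff)
      moreover have dyp: "dist y p = \<kappa>" using D \<kappa> unfolding dist_norm yp by (simp add: D_def dist_norm)
      moreover have "norm y \<le> R + \<kappa>"
        using dyp p(2) norm_triangle_sub[of y p] by (simp add: dist_norm)
      ultimately have "(p, w, y) \<in> K" using p w by (auto simp: K_def)
      then have "e \<le> w \<bullet> (y - p)" using e(2) by force
      then have "e \<le> (\<kappa> / D) * (w \<bullet> (q - p))" by (simp add: yp)
      then have "D * e \<le> \<kappa> * (w \<bullet> (q - p))" using D by (simp add: field_simps)
      then have "D \<le> \<kappa> / e * (w \<bullet> (q - p))" using e(1) by (simp add: field_simps)
      then show ?thesis using \<kappa> by (simp add: D_def)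
    qed
    then show "\<exists>w. norm w = 1 \<and> (\<forall>q\<in>closure \<Omega>0. dist q p \<le> \<kappa> + \<kappa> / e * (w \<bullet> (q - p)))" using w(1) by blast
  qed
qed

text \<open>The term linear in \<open>norm q\<close> pays for exit points outside \<open>cball 0 R\<close>, where the modulus of strict
  convexity is not available.\<close>

lemma exit_estimate:
  assumes C: "0 \<le> C" "\<And>p. p \<in> frontier \<Omega>0 \<Longrightarrow> norm p \<le> R \<Longrightarrow>
      \<exists>w. norm w = 1 \<and> (\<forall>q\<in>closure \<Omega>0. dist q p \<le> \<kappa> + C * (w \<bullet> (q - p)))"
    and g: "\<And>q. q \<in> frontier \<Omega>0 \<Longrightarrow> m \<le> g q \<and> g q \<le> m + k" and k: "0 \<le> k"
    and lip: "\<And>q p. g q \<le> g p + L * dist q p" and L: "0 \<le> L"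
    and R: "0 < R" and \<delta>: "0 < \<delta>" "\<delta> \<le> 1" and \<kappa>: "0 < \<kappa>"
    and A: "A = L * \<kappa> + L * C * (R + norm c) * \<delta>"
    and v: "dil c \<delta> v \<in> frontier \<Omega>0"
  shows "\<exists>A0 w. (\<forall>q\<in>frontier \<Omega>0. g q - A - 2 * k / R * (norm q + norm c) \<le> A0 + w \<bullet> q) \<and> A0 + w \<bullet> v \<le> g (dil c \<delta> v)"
proof -
  define p where "p = dil c \<delta> v"
  have p: "p \<in> frontier \<Omega>0" using v by (simp add: p_def)
  have pv: "p - v = \<delta> *\<^sub>R (v - c)" by (simp add: p_def dil_eq)
  have pc: "p - c = (1 + \<delta>) *\<^sub>R (v - c)" by (simp add: p_def dil_def)
  have A0: "0 \<le> A" unfolding A using L C(1) R \<delta> \<kappa> by (intro add_nonneg_nonneg mult_nonneg_nonneg) auto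
  have kR: "0 \<le> 2 * k / R * (norm q + norm c)" for q :: 'a using k R by simp
  show ?thesis
  proof (cases "norm p \<le> R")
    case True
    obtain w where w: "norm w = 1" "\<And>q. q \<in> closure \<Omega>0 \<Longrightarrow> dist q p \<le> \<kappa> + C * (w \<bullet> (q - p))"
      using C(2)[OF p True] by blast
    \<comment> \<open>The affine function has to lie below \<open>g p\<close> at \<open>v\<close>,
      not at \<open>p\<close> itself. The second summand of \<open>A\<close> pays for this, as
      \<open>v\<close> is within \<open>\<delta> * (R + norm c)\<close> of \<open>p\<close>.\<close>
    define A1 where "A1 = g p + L * \<kappa> - A - L * C * (w \<bullet> p)"
    have eq: "A1 + ((L * C) *\<^sub>R w) \<bullet> q = g p + L * \<kappa> - A + L * (C * (w \<bullet> (q - p)))" for q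
      by (simp add: A1_def inner_diff_right algebra_simps)
    have "g q - A - 2 * k / R * (norm q + norm c) \<le> A1 + ((L * C) *\<^sub>R w) \<bullet> q" if q: "q \<in> frontier \<Omega>0" for q
    proof -
      have "L * dist q p \<le> L * (\<kappa> + C * (w \<bullet> (q - p)))"
        using w(2)[of q] q L by (intro mult_left_mono) (auto simp: frontier0_iff)
      then have "g q \<le> g p + L * \<kappa> + L * (C * (w \<bullet> (q - p)))" using lip[of q p] by (simp add: distrib_left)
      then show ?thesis unfolding eq using kR[of q] by linarith
    qed
    moreover have "A1 + ((L * C) *\<^sub>R w) \<bullet> v \<le> g p"
    proof -
      have "w \<bullet> (v - p) \<le> norm (v - p)" using norm_cauchy_schwarz[of w "v - p"] w(1) by simp
      also have "\<dots> = \<delta> * norm (v - c)" using pv \<delta> by (metis abs_of_pos norm_minus_commute norm_scaleR)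
      also have "\<dots> \<le> \<delta> * (R + norm c)"
      proof (intro mult_left_mono)
        have "norm (p - c) = (1 + \<delta>) * norm (v - c)" unfolding pc using \<delta> by simp
        then have "norm (v - c) \<le> norm (p - c)" using \<delta> by (simp add: mult_left_mono algebra_simps)
        also have "\<dots> \<le> R + norm c" using norm_triangle_ineq4[of p c] True by linarith
        finally show "norm (v - c) \<le> R + norm c" .
      qed (use \<delta> in simp)
      finally have "L * (C * (w \<bullet> (v - p))) \<le> L * (C * (\<delta> * (R + norm c)))"
        using L C(1) by (intro mult_left_mono) auto
      then show ?thesis unfolding eq A by (simp add: algebra_simps)
    qed
    ultimately show ?thesis unfolding p_def by blast
  next
    case False
    \<comment> \<open>Here the affine function only has to drop from \<open>m + k\<close> to
      \<open>m\<close> at \<open>v\<close>. A slope along \<open>- sgn v\<close> achieves this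
      because \<open>v\<close> is far out, and at boundary points it costs no more than the term
      linear in the norm.\<close>
    define A1 where "A1 = m + k - 2 * k / R * norm c"
    have "g q - A - 2 * k / R * (norm q + norm c) \<le> A1 + (- (2 * k / R) *\<^sub>R sgn v) \<bullet> q" if q: "q \<in> frontier \<Omega>0" for q
    proof -
      have "sgn v \<bullet> q \<le> norm (sgn v) * norm q" by (rule norm_cauchy_schwarz)
      also have "\<dots> \<le> 1 * norm q" by (intro mult_right_mono) (auto simp: norm_sgn)
      finally have "2 * k / R * (sgn v \<bullet> q) \<le> 2 * k / R * norm q" using k R by (intro mult_left_mono) auto
      then show ?thesis using g[OF q] A0 by (simp add: A1_def distrib_left)
    qed
    moreover have "A1 + (- (2 * k / R) *\<^sub>R sgn v) \<bullet> v \<le> g p"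
    proof -
      have sv: "sgn v \<bullet> v = norm v"
        by (cases "v = 0") (simp_all add: sgn_div_norm power2_norm_eq_inner[symmetric] power2_eq_square)
      have "p = v + \<delta> *\<^sub>R (v - c)" using pv by (simp add: algebra_simps)
      then have "norm p \<le> norm v + norm (\<delta> *\<^sub>R (v - c))" using norm_triangle_ineq by metis
      also have "\<dots> \<le> norm v + norm (v - c)"
        unfolding norm_scaleR using \<delta> by (intro add_left_mono mult_left_le_one_le) auto
      finally have "norm p \<le> norm v + (norm v + norm c)"
        using norm_triangle_ineq4[of v c] by linarith
      also have "\<dots> \<le> 2 * (norm v + norm c)" by simp
      finally have "norm p \<le> 2 * (norm v + norm c)" .
      then have "R \<le> 2 * (norm v + norm c)" using False by linarith
      then have "k * R \<le> k * (2 * (norm v + norm c))" using k by (rule mult_left_mono)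
      then have "k \<le> 2 * k / R * (norm v + norm c)" using R by (simp add: field_simps)
      moreover have "m \<le> g p" using g[OF p] by simp
      ultimately show ?thesis by (simp add: A1_def sv distrib_left)
    qed
    ultimately show ?thesis unfolding p_def by blast
  qed
qed

text \<open>\<open>dil_far\<close> read before the dilation, which shrinks distances by the factor
  \<open>1 + \<delta>\<close>. The radius becomes the displacement \<open>\<eta>\<close> in the
  splitting.\<close>

lemma dil_far_ball:
  assumes c: "ball c \<rho> \<subseteq> \<Omega>1" and \<delta>: "0 < \<delta>" and v: "v \<notin> \<Omega>1"
  shows "ball v (\<delta> * \<rho> / (1 + \<delta>)) \<inter> dil c \<delta> -` \<Omega>1 = {}"
proof -
  have False if y: "dist v y < \<delta> * \<rho> / (1 + \<delta>)" "dil c \<delta> y \<in> \<Omega>1" for y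
  proof -
    have "\<delta> * \<rho> \<le> dist (dil c \<delta> v) (dil c \<delta> y)"
      using dil_far[OF c \<delta> v] y(2) by (simp add: far_def)
    also have "dil c \<delta> v - dil c \<delta> y = (1 + \<delta>) *\<^sub>R (v - y)" by (simp add: dil_def algebra_simps)
    then have "dist (dil c \<delta> v) (dil c \<delta> y) = (1 + \<delta>) * dist v y" using \<delta> by (simp add: dist_norm)
    finally show False using y(1) \<delta> by (simp add: less_divide_eq mult.commute)
  qed
  then show ?thesis by auto
qed

lemma dil_vimage: "open (dil c \<delta> -` \<Omega>1)" "convex (dil c \<delta> -` \<Omega>1)"
proof -
  have "continuous_on UNIV (dil c \<delta>)" unfolding dil_def by (intro continuous_intros)
  then show "open (dil c \<delta> -` \<Omega>1)" using open1 by (simp add: open_vimage)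
  show "convex (dil c \<delta> -` \<Omega>1)"
    unfolding convex_alt using convexD_alt[OF convex1] by (auto simp: dil_affine)
qed

text \<open>The inequality propagates from the two halves of a splitting to the whole interval; a half
  whose dilated mean has left \<open>\<Omega>0\<close> is replaced by the exit point, where the second hypothesis
  applies.\<close>

lemma mean_le_majorant_split:
  assumes G: "G \<in> loc_concave_majorants (closure \<Omega>0 - \<Omega>1) f"
    and int: "\<phi> integrable_on {a..b}" "h integrable_on {a..b}" and t: "a < t" "t < b"
    and seg: "closed_segment (mean \<phi> a t) (mean \<phi> t b) \<inter> dil c \<delta> -` \<Omega>1 = {}"
    and exit: "\<And>v. dil c \<delta> v \<in> frontier \<Omega>0 \<Longrightarrow> \<exists>A w. (\<forall>y\<in>{a..b}. h y \<le> A + w \<bullet> \<phi> y) \<and> ereal (A + w \<bullet> v) \<le> G (dil c \<delta> v)"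
    and y0: "dil c \<delta> (mean \<phi> a b) \<in> \<Omega>0"
    and left: "dil c \<delta> (mean \<phi> a t) \<in> \<Omega>0 \<Longrightarrow> ereal (mean h a t) \<le> G (dil c \<delta> (mean \<phi> a t))"
    and right: "dil c \<delta> (mean \<phi> t b) \<in> \<Omega>0 \<Longrightarrow> ereal (mean h t b) \<le> G (dil c \<delta> (mean \<phi> t b))"
  shows "ereal (mean h a b) \<le> G (dil c \<delta> (mean \<phi> a b))"
proof -
  \<comment> \<open>\<open>P\<close> and \<open>l\<close> run linearly and simultaneously through
    the mean points and the mean values of the two parts; the whole interval sits at
    \<open>s0\<close>.\<close>
  define P where "P s = (1 - s) *\<^sub>R mean \<phi> a t + s *\<^sub>R mean \<phi> t b" for s
  define l where "l s = (1 - s) * mean h a t + s * mean h t b" for s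
  define s0 where "s0 = (b - t) / (b - a)"
  have s0: "0 < s0" "s0 < 1" using t by (auto simp: s0_def)
  have P0: "mean \<phi> a b = P s0" using mean_split[OF int(1) t] by (simp add: P_def s0_def)
  have l0: "mean h a b = l s0" using mean_split[OF int(2) t] by (simp add: l_def s0_def)
  have sub: "\<phi> integrable_on {a..t}" "\<phi> integrable_on {t..b}" "h integrable_on {a..t}" "h integrable_on {t..b}"
    using t by (auto intro: integrable_on_subinterval[OF int(1)] integrable_on_subinterval[OF int(2)])
  \<comment> \<open>At an exit point the affine bound holds for both parts, hence for their
    combination \<open>l s\<close>.\<close>
  have exit': "ereal (l s) \<le> G (dil c \<delta> (P s))" if s: "0 \<le> s" "s \<le> 1" and fr: "dil c \<delta> (P s) \<in> frontier \<Omega>0" for s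
  proof -
    obtain A w where Aw: "\<And>y. y \<in> {a..b} \<Longrightarrow> h y \<le> A + w \<bullet> \<phi> y" "ereal (A + w \<bullet> P s) \<le> G (dil c \<delta> (P s))"
      using exit[OF fr] by blast
    have "mean h a t \<le> A + w \<bullet> mean \<phi> a t" by (rule mean_le_affine[OF sub(1,3) t(1)]) (use Aw t in auto)
    moreover have "mean h t b \<le> A + w \<bullet> mean \<phi> t b" by (rule mean_le_affine[OF sub(2,4) t(2)]) (use Aw t in auto)
    ultimately have "l s \<le> (1 - s) * (A + w \<bullet> mean \<phi> a t) + s * (A + w \<bullet> mean \<phi> t b)"
      unfolding l_def using s by (intro add_mono mult_left_mono) auto
    also have "\<dots> = A + w \<bullet> P s" by (simp add: P_def inner_add_right algebra_simps)
    finally show ?thesis using Aw(2) by (meson ereal_less_eq(3) order_trans)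
  qed
  have Plin: "(1 - u) *\<^sub>R P s + u *\<^sub>R P s' = P ((1 - u) * s + u * s')" for u s s'
    by (simp add: P_def algebra_simps)
  \<comment> \<open>On each side of \<open>s0\<close> there is a usable end: the mean of the part
    itself, or the first replacement on the outer boundary. Both lie on their own side of
    \<open>s0\<close>, so concavity can be applied between them.\<close>
  have ends: "\<exists>s1. 0 \<le> s1 \<and> s1 \<le> 1 \<and> dil c \<delta> (P s1) \<in> closure \<Omega>0 \<and> ereal (l s1) \<le> G (dil c \<delta> (P s1))
      \<and> (\<exists>u. 0 \<le> u \<and> u \<le> 1 \<and> s1 = (1 - u) * s0 + u * e)"
    if e: "e = 0 \<or> e = 1" and near: "dil c \<delta> (P e) \<in> \<Omega>0 \<Longrightarrow> ereal (l e) \<le> G (dil c \<delta> (P e))" for e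
  proof (cases "dil c \<delta> (P e) \<in> \<Omega>0")
    case True
    then show ?thesis using e near closure_subset by (intro exI[of _ e]) (auto intro!: exI[of _ 1])
  next
    case False
    obtain z where z: "z \<in> closed_segment (dil c \<delta> (P s0)) (dil c \<delta> (P e))" "z \<in> frontier \<Omega>0"
      using segment_to_outside_meets_frontier[OF _ False] y0 P0 by metis
    then obtain u where u: "0 \<le> u" "u \<le> 1" "z = (1 - u) *\<^sub>R dil c \<delta> (P s0) + u *\<^sub>R dil c \<delta> (P e)"
      by (auto simp: in_segment)
    define s1 where "s1 = (1 - u) * s0 + u * e"
    have z1: "z = dil c \<delta> (P s1)" by (simp add: u(3) s1_def flip: dil_affine Plin)
    have "0 \<le> s1" unfolding s1_def using u s0 e by auto
    moreover have "s1 \<le> (1 - u) * 1 + u * 1" unfolding s1_def using u s0 e by (intro add_mono mult_left_mono) auto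
    ultimately have s1: "0 \<le> s1" "s1 \<le> 1" by auto
    have "ereal (l s1) \<le> G (dil c \<delta> (P s1))" by (rule exit'[OF s1]) (use z z1 in simp)
    moreover have "dil c \<delta> (P s1) \<in> closure \<Omega>0" using z z1 frontier0_iff by simp
    ultimately show ?thesis using s1 u by (intro exI[of _ s1]) (auto simp: s1_def)
  qed
  obtain s1 u1 where 1: "0 \<le> s1" "s1 \<le> 1" "dil c \<delta> (P s1) \<in> closure \<Omega>0" "ereal (l s1) \<le> G (dil c \<delta> (P s1))"
    "0 \<le> u1" "u1 \<le> 1" "s1 = (1 - u1) * s0 + u1 * 0"
    using ends[of 0] left by (auto simp: P_def l_def)
  obtain s2 u2 where 2: "0 \<le> s2" "s2 \<le> 1" "dil c \<delta> (P s2) \<in> closure \<Omega>0" "ereal (l s2) \<le> G (dil c \<delta> (P s2))"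
    "0 \<le> u2" "u2 \<le> 1" "s2 = (1 - u2) * s0 + u2 * 1"
    using ends[of 1] right by (auto simp: P_def l_def)
  have "s1 \<le> s0" using 1 s0 by (simp add: mult_left_le_one_le)
  moreover have "s0 \<le> s2"
  proof -
    have "s2 - s0 = u2 * (1 - s0)" by (simp add: 2(7) algebra_simps)
    also have "\<dots> \<ge> 0" using 2 s0 by simp
    finally show ?thesis by simp
  qed
  ultimately have order: "s1 \<le> s0" "s0 \<le> s2" .
  show ?thesis
  proof (cases "s1 = s2")
    case True
    then have "s0 = s1" using order by simp
    then show ?thesis using 1(4) by (simp add: P0 l0)
  next
    case False
    define u where "u = (s0 - s1) / (s2 - s1)"
    have u: "0 \<le> u" "u \<le> 1" using order False by (auto simp: u_def)
    have "u * (s2 - s1) = s0 - s1" using False by (simp add: u_def)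
    then have us: "(1 - u) * s1 + u * s2 = s0" by (simp add: algebra_simps)
    have "closed_segment (dil c \<delta> (P s1)) (dil c \<delta> (P s2)) \<subseteq> closure \<Omega>0 - \<Omega>1"
    proof
      fix z assume z: "z \<in> closed_segment (dil c \<delta> (P s1)) (dil c \<delta> (P s2))"
      then obtain v where v: "0 \<le> v" "v \<le> 1" "z = (1 - v) *\<^sub>R dil c \<delta> (P s1) + v *\<^sub>R dil c \<delta> (P s2)"
        by (auto simp: in_segment)
      define s where "s = (1 - v) * s1 + v * s2"
      have zs: "z = dil c \<delta> (P s)" by (simp add: v(3) s_def flip: dil_affine Plin)
      have "s \<le> (1 - v) * 1 + v * 1" unfolding s_def using v 1 2 by (intro add_mono mult_left_mono) auto
      then have "0 \<le> s" "s \<le> 1" using v 1 2 by (auto simp: s_def)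
      then have "P s \<in> closed_segment (mean \<phi> a t) (mean \<phi> t b)" unfolding in_segment P_def by blast
      then have "z \<notin> \<Omega>1" using seg zs by auto
      then show "z \<in> closure \<Omega>0 - \<Omega>1" using z closed_segment_closure0[OF 1(3) 2(3)] by auto
    qed
    from majorant_segment[OF G this 1(4) 2(4) u]
    have "ereal ((1 - u) * l s1 + u * l s2) \<le> G (dil c \<delta> (P s0))"
      unfolding dil_affine[symmetric] Plin us .
    moreover have "(1 - u) * l s1 + u * l s2 = l s0"
      unfolding us[symmetric] by (simp add: l_def algebra_simps)
    ultimately show ?thesis by (simp add: P0 l0)
  qed
qed

text \<open>Otherwise splitting yields nested violating intervals. Each step halves the length or moves the
  mean by \<open>\<eta>\<close>, so the lengths tend to \<open>0\<close>, contradicting the hypothesis on short intervals.\<close>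

lemma mean_le_majorant:
  assumes G: "G \<in> loc_concave_majorants (closure \<Omega>0 - \<Omega>1) f"
    and int: "\<phi> integrable_on {\<alpha>..\<beta>}" "h integrable_on {\<alpha>..\<beta>}" and \<alpha>\<beta>: "\<alpha> < \<beta>"
    and c: "ball c \<rho> \<subseteq> \<Omega>1" "0 < \<rho>" and \<delta>: "0 < \<delta>"
    and means: "\<And>s t. \<alpha> \<le> s \<Longrightarrow> s < t \<Longrightarrow> t \<le> \<beta> \<Longrightarrow> mean \<phi> s t \<notin> \<Omega>1"
    and exit: "\<And>v. dil c \<delta> v \<in> frontier \<Omega>0 \<Longrightarrow> \<exists>A w. (\<forall>y\<in>{\<alpha>..\<beta>}. h y \<le> A + w \<bullet> \<phi> y) \<and> ereal (A + w \<bullet> v) \<le> G (dil c \<delta> v)"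
    and small: "\<And>y. y \<in> {\<alpha>..\<beta>} \<Longrightarrow> \<exists>d>0. \<forall>s t. \<alpha> \<le> s \<and> s \<le> y \<and> y \<le> t \<and> t \<le> \<beta> \<and> s < t \<and> t - s < d \<longrightarrow>
        dil c \<delta> (mean \<phi> s t) \<notin> \<Omega>0 \<or> ereal (mean h s t) \<le> G (dil c \<delta> (mean \<phi> s t))"
    and start: "dil c \<delta> (mean \<phi> \<alpha> \<beta>) \<in> \<Omega>0"
  shows "ereal (mean h \<alpha> \<beta>) \<le> G (dil c \<delta> (mean \<phi> \<alpha> \<beta>))"
proof (rule ccontr)
  assume contr: "\<not> ?thesis"
  define \<eta> where "\<eta> = \<delta> * \<rho> / (1 + \<delta>)"
  have \<eta>: "0 < \<eta>" using c \<delta> by (simp add: \<eta>_def)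
  \<comment> \<open>Only intervals whose dilated mean is still in \<open>\<Omega>0\<close> count as
    violating; the others need no inequality, being replaced by exit points.\<close>
  define bad where "bad a b \<longleftrightarrow> \<alpha> \<le> a \<and> a < b \<and> b \<le> \<beta> \<and> dil c \<delta> (mean \<phi> a b) \<in> \<Omega>0 \<and>
      \<not> ereal (mean h a b) \<le> G (dil c \<delta> (mean \<phi> a b))" for a b
  have step: "\<exists>a' b'. bad a' b' \<and> a \<le> a' \<and> b' \<le> b \<and> (b' - a' \<le> (b - a) / 2 \<or> \<eta> \<le> dist (mean \<phi> a' b') (mean \<phi> a b))"
    if bad: "bad a b" for a b
  proof -
    have ab: "\<alpha> \<le> a" "a < b" "b \<le> \<beta>" "dil c \<delta> (mean \<phi> a b) \<in> \<Omega>0" "\<not> ereal (mean h a b) \<le> G (dil c \<delta> (mean \<phi> a b))"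
      using bad by (auto simp: bad_def)
    have i: "\<phi> integrable_on {a..b}" "h integrable_on {a..b}"
      using ab by (auto intro: integrable_on_subinterval[OF int(1)] integrable_on_subinterval[OF int(2)])
    have nb: "ball (mean \<phi> a b) \<eta> \<inter> dil c \<delta> -` \<Omega>1 = {}"
      unfolding \<eta>_def by (rule dil_far_ball[OF c(1) \<delta> means]) (use ab in auto)
    obtain t where t: "a < t" "t < b" "closed_segment (mean \<phi> a t) (mean \<phi> t b) \<inter> dil c \<delta> -` \<Omega>1 = {}"
      "t - a \<le> (b - a) / 2 \<or> \<eta> \<le> dist (mean \<phi> a t) (mean \<phi> a b)"
      "b - t \<le> (b - a) / 2 \<or> \<eta> \<le> dist (mean \<phi> t b) (mean \<phi> a b)"
      using splitting_interval[OF i(1) ab(2) dil_vimage \<eta> nb] by blast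
    have "bad a t \<or> bad t b"
    proof (rule ccontr)
      assume "\<not> ?thesis"
      then have "dil c \<delta> (mean \<phi> a t) \<in> \<Omega>0 \<Longrightarrow> ereal (mean h a t) \<le> G (dil c \<delta> (mean \<phi> a t))"
        "dil c \<delta> (mean \<phi> t b) \<in> \<Omega>0 \<Longrightarrow> ereal (mean h t b) \<le> G (dil c \<delta> (mean \<phi> t b))"
        using ab t by (auto simp: bad_def)
      moreover have "\<exists>A w. (\<forall>y\<in>{a..b}. h y \<le> A + w \<bullet> \<phi> y) \<and> ereal (A + w \<bullet> v) \<le> G (dil c \<delta> v)"
        if "dil c \<delta> v \<in> frontier \<Omega>0" for v
      proof -
        obtain A w where "\<forall>y\<in>{\<alpha>..\<beta>}. h y \<le> A + w \<bullet> \<phi> y" "ereal (A + w \<bullet> v) \<le> G (dil c \<delta> v)"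
          using exit[OF \<open>dil c \<delta> v \<in> frontier \<Omega>0\<close>] by blast
        then show ?thesis using ab by (intro exI[of _ A] exI[of _ w]) auto
      qed
      ultimately have "ereal (mean h a b) \<le> G (dil c \<delta> (mean \<phi> a b))"
        by (intro mean_le_majorant_split[OF G i t(1-3) _ ab(4)])
      then show False using ab(5) by simp
    qed
    then show ?thesis
    proof
      assume "bad a t" then show ?thesis using t by (intro exI[of _ a] exI[of _ t]) auto
    next
      assume "bad t b" then show ?thesis using t by (intro exI[of _ t] exI[of _ b]) auto
    qed
  qed
  have "\<exists>F. \<forall>n. (bad (fst (F n)) (snd (F n))) \<and> (fst (F n) \<le> fst (F (Suc n)) \<and> snd (F (Suc n)) \<le> snd (F n) \<and>
      (snd (F (Suc n)) - fst (F (Suc n)) \<le> (snd (F n) - fst (F n)) / 2 \<or>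
       \<eta> \<le> dist (mean \<phi> (fst (F (Suc n))) (snd (F (Suc n)))) (mean \<phi> (fst (F n)) (snd (F n)))))"
  proof (rule dependent_nat_choice)
    show "\<exists>x. bad (fst x) (snd x)"
      using contr start \<alpha>\<beta> by (intro exI[of _ "(\<alpha>, \<beta>)"]) (simp add: bad_def)
    fix x :: "real \<times> real" assume "bad (fst x) (snd x)"
    from step[OF this] show "\<exists>y. bad (fst y) (snd y) \<and> fst x \<le> fst y \<and> snd y \<le> snd x \<and>
      (snd y - fst y \<le> (snd x - fst x) / 2 \<or> \<eta> \<le> dist (mean \<phi> (fst y) (snd y)) (mean \<phi> (fst x) (snd x)))"
      by auto
  qed
  then obtain F where F: "\<And>n. bad (fst (F n)) (snd (F n))" "\<And>n. fst (F n) \<le> fst (F (Suc n))" "\<And>n. snd (F (Suc n)) \<le> snd (F n)"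
    "\<And>n. snd (F (Suc n)) - fst (F (Suc n)) \<le> (snd (F n) - fst (F n)) / 2 \<or>
       \<eta> \<le> dist (mean \<phi> (fst (F (Suc n))) (snd (F (Suc n)))) (mean \<phi> (fst (F n)) (snd (F n)))"
    by blast
  define a where "a n = fst (F n)" for n
  define b where "b n = snd (F n)" for n
  have ab: "\<alpha> \<le> a n" "a n < b n" "b n \<le> \<beta>" for n using F(1)[of n] by (auto simp: bad_def a_def b_def)
  have "incseq a" "decseq b" using F(2,3) by (auto simp: incseq_Suc_iff decseq_Suc_iff a_def b_def)
  have "\<forall>n. a n \<le> \<beta>" "\<forall>n. \<alpha> \<le> b n" using ab by (meson less_imp_le order_trans)+
  obtain a0 where a0: "a \<longlonglongrightarrow> a0" "\<forall>n. a n \<le> a0" using incseq_convergent[OF \<open>incseq a\<close> \<open>\<forall>n. a n \<le> \<beta>\<close>] by blast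
  obtain b0 where b0: "b \<longlonglongrightarrow> b0" "\<forall>n. b0 \<le> b n" using decseq_convergent[OF \<open>decseq b\<close> \<open>\<forall>n. \<alpha> \<le> b n\<close>] by blast
  have le0: "a0 \<le> b0" by (rule LIMSEQ_le[OF a0(1) b0(1)]) (use ab(2) in \<open>auto intro: less_imp_le\<close>)
  have bounds: "\<alpha> \<le> a0" "b0 \<le> \<beta>" using a0(2) b0(2) ab order_trans by blast+
  show False
  proof (cases "a0 < b0")
    case True
    have lim: "(\<lambda>n. mean \<phi> (a n) (b n)) \<longlonglongrightarrow> mean \<phi> a0 b0"
      by (rule mean_tendsto[OF int(1) a0(1) b0(1)]) (use ab True bounds in \<open>auto intro: less_imp_le\<close>)
    have "(\<lambda>n. dist (mean \<phi> (a (Suc n)) (b (Suc n))) (mean \<phi> (a n) (b n))) \<longlonglongrightarrow> dist (mean \<phi> a0 b0) (mean \<phi> a0 b0)"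
      by (intro tendsto_dist lim LIMSEQ_Suc[OF lim])
    then have "\<forall>\<^sub>F n in sequentially. dist (mean \<phi> (a (Suc n)) (b (Suc n))) (mean \<phi> (a n) (b n)) < \<eta>"
      using \<eta> by (simp add: order_tendstoD)
    then have "\<forall>\<^sub>F n in sequentially. b (Suc n) - a (Suc n) \<le> (b n - a n) / 2"
    proof eventually_elim
      case (elim n)
      then show ?case using F(4)[of n] by (simp add: a_def b_def)
    qed
    moreover have "(\<lambda>n. b (Suc n) - a (Suc n)) \<longlonglongrightarrow> b0 - a0" "(\<lambda>n. (b n - a n) / 2) \<longlonglongrightarrow> (b0 - a0) / 2"
      by (intro tendsto_intros LIMSEQ_Suc a0 b0; simp)+
    ultimately have "b0 - a0 \<le> (b0 - a0) / 2"
      using tendsto_le[OF sequentially_bot] by blast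
    then show False using True by simp
  next
    case False
    then have eq: "b0 = a0" using le0 by simp
    have mem: "a0 \<in> {\<alpha>..\<beta>}" using bounds eq by simp
    obtain d where d: "0 < d" "\<And>s t. \<alpha> \<le> s \<and> s \<le> a0 \<and> a0 \<le> t \<and> t \<le> \<beta> \<and> s < t \<and> t - s < d \<Longrightarrow>
        dil c \<delta> (mean \<phi> s t) \<notin> \<Omega>0 \<or> ereal (mean h s t) \<le> G (dil c \<delta> (mean \<phi> s t))"
      using small[OF mem] by blast
    have "(\<lambda>n. b n - a n) \<longlonglongrightarrow> b0 - a0" by (intro tendsto_intros a0 b0)
    then have "\<forall>\<^sub>F n in sequentially. b n - a n < d" using d(1) eq by (simp add: order_tendstoD)
    then obtain n where "b n - a n < d" by (meson eventually_happens sequentially_bot)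
    then have "dil c \<delta> (mean \<phi> (a n) (b n)) \<notin> \<Omega>0 \<or> ereal (mean h (a n) (b n)) \<le> G (dil c \<delta> (mean \<phi> (a n) (b n)))"
      using ab a0(2) b0(2) eq by (intro d(2)) auto
    then show False using F(1)[of n] by (auto simp: bad_def a_def b_def)
  qed
qed

text \<open>The values \<open>g (\<phi> t)\<close> are lowered until the hypotheses of
  \<open>mean_le_majorant\<close> hold. Near a Lebesgue point short means are close to
  \<open>\<phi> y\<close>, whose dilation is outside \<open>closure \<Omega>0\<close>, so nothing is
  to be shown. The remaining points are covered by a small open set \<open>T\<close>, on which the
  integrand is lowered below \<open>m\<close>, a lower bound of \<open>G\<close>. At exit points
  \<open>exit_estimate\<close> applies.\<close>

lemma dilated_bound:
  assumes G: "G \<in> loc_concave_majorants (closure \<Omega>0 - \<Omega>1) f"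
    and m: "\<And>q. q \<in> frontier \<Omega>0 \<Longrightarrow> m \<le> f q"
    and g: "\<And>q. q \<in> frontier \<Omega>0 \<Longrightarrow> m \<le> g q \<and> g q \<le> m + k \<and> g q \<le> f q" and k: "0 \<le> k"
    and lip: "\<And>q p. g q \<le> g p + L * dist q p" and L: "0 \<le> L"
    and \<alpha>\<beta>: "\<alpha> < \<beta>" and int: "\<phi> integrable_on {\<alpha>..\<beta>}" "(\<lambda>t. norm (\<phi> t)) integrable_on {\<alpha>..\<beta>}"
    and intg: "(\<lambda>t. g (\<phi> t)) integrable_on {\<alpha>..\<beta>}"
    and \<phi>: "\<And>t. \<phi> t \<in> frontier \<Omega>0"
    and means: "\<And>s t. \<alpha> \<le> s \<Longrightarrow> s < t \<Longrightarrow> t \<le> \<beta> \<Longrightarrow> mean \<phi> s t \<notin> \<Omega>1"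
    and c: "ball c \<rho> \<subseteq> \<Omega>1" "0 < \<rho>" and \<epsilon>: "0 < \<epsilon>"
  obtains \<delta>0 where "0 < \<delta>0" "\<And>\<delta>. 0 < \<delta> \<Longrightarrow> \<delta> < \<delta>0 \<Longrightarrow> dil c \<delta> (mean \<phi> \<alpha> \<beta>) \<in> \<Omega>0 \<Longrightarrow>
    ereal (mean (\<lambda>t. g (\<phi> t)) \<alpha> \<beta> - \<epsilon>) \<le> G (dil c \<delta> (mean \<phi> \<alpha> \<beta>))"
proof -
  define M where "M = mean (\<lambda>t. g (\<phi> t)) \<alpha> \<beta>"
  define Mn where "Mn = mean (\<lambda>t. norm (\<phi> t)) \<alpha> \<beta>"
  have c0: "c \<in> \<Omega>0" by (intro subsetD[OF sub10] subsetD[OF c(1)]) (simp add: c(2))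
  have Mn: "0 \<le> Mn" using \<alpha>\<beta> unfolding Mn_def mean_def
    by (auto intro!: mult_nonneg_nonneg Henstock_Kurzweil_Integration.integral_nonneg int)
  \<comment> \<open>So large that the penalty linear in the norm has mean at most
    \<open>\<epsilon> / 4\<close>; the mean of the norm is finite because \<open>\<phi>\<close> is
    summable.\<close>
  define R where "R = 8 * k * (Mn + norm c) / \<epsilon> + 1"
  have R: "0 < R" using k Mn \<epsilon> by (simp add: R_def add_nonneg_pos)
  have Rk: "2 * k / R * (Mn + norm c) \<le> \<epsilon> / 4"
  proof -
    have "2 * k * (Mn + norm c) \<le> \<epsilon> / 4 * R" using \<epsilon> by (simp add: R_def field_simps)
    then show ?thesis using R by (simp add: divide_le_eq)
  qed
  define \<kappa> where "\<kappa> = \<epsilon> / (4 * (L + 1))"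
  have \<kappa>: "0 < \<kappa>" using L \<epsilon> by (simp add: \<kappa>_def)
  have L\<kappa>: "L * \<kappa> \<le> \<epsilon> / 4" using L \<epsilon> by (simp add: \<kappa>_def field_simps)
  obtain C where C: "0 \<le> C" "\<And>p. p \<in> frontier \<Omega>0 \<Longrightarrow> norm p \<le> R \<Longrightarrow>
    \<exists>w. norm w = 1 \<and> (\<forall>q\<in>closure \<Omega>0. dist q p \<le> \<kappa> + C * (w \<bullet> (q - p)))"
    using support_modulus[OF \<kappa>] by metis
  define D where "D = L * C * (R + norm c)"
  have D: "0 \<le> D" using L C R by (simp add: D_def)
  obtain N where N: "negligible N"
    "\<And>x e. \<lbrakk>x \<in> {\<alpha><..<\<beta>} - N; 0 < e\<rbrakk> \<Longrightarrow> \<exists>d>0. \<forall>s t. \<alpha> \<le> s \<and> s \<le> x \<and> x \<le> t \<and> t \<le> \<beta> \<and> s < t \<and> t - s < d \<longrightarrow>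
       norm (mean \<phi> s t - \<phi> x) \<le> e"
    using lebesgue_points[OF int(1)] by blast
  have "negligible (N \<union> {\<alpha>, \<beta>})" using N(1) by (intro negligible_Un) auto
  moreover have "0 < \<epsilon> * (\<beta> - \<alpha>) / (4 * (k + 1))" using \<epsilon> \<alpha>\<beta> k by simp
  \<comment> \<open>The ends \<open>\<alpha>\<close> and \<open>\<beta>\<close> are put into
    \<open>T\<close> as well, since they are excluded from the Lebesgue points. The measure is such
    that lowering by \<open>k\<close> on \<open>T\<close> costs at most
    \<open>\<epsilon> / 4\<close> in the mean.\<close>
  ultimately obtain T where T: "open T" "N \<union> {\<alpha>, \<beta>} \<subseteq> T" "T \<in> lmeasurable" "measure lebesgue T < \<epsilon> * (\<beta> - \<alpha>) / (4 * (k + 1))"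
    by (rule negligible_open_cover)
  have Tm: "T \<inter> {\<alpha>..\<beta>} \<in> lmeasurable" using T(3) by (simp add: fmeasurable_Int_fmeasurable)
  define I3 where "I3 = integral {\<alpha>..\<beta>} (indicat_real T)"
  have I3: "k * I3 \<le> \<epsilon> / 4 * (\<beta> - \<alpha>)"
  proof -
    have "I3 = measure lebesgue (T \<inter> {\<alpha>..\<beta>})"
      unfolding I3_def by (rule Equivalence_Lebesgue_Henstock_Integration.integral_indicator[OF Tm])
    also have "\<dots> \<le> measure lebesgue T" using T(3) Tm by (intro measure_mono_fmeasurable) auto
    finally have "I3 \<le> \<epsilon> * (\<beta> - \<alpha>) / (4 * (k + 1))" using T(4) by simp
    then have "k * I3 \<le> k * (\<epsilon> * (\<beta> - \<alpha>) / (4 * (k + 1)))" using k by (rule mult_left_mono)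
    also have "\<dots> = (k / (k + 1)) * (\<epsilon> / 4 * (\<beta> - \<alpha>))" by simp
    also have "\<dots> \<le> 1 * (\<epsilon> / 4 * (\<beta> - \<alpha>))" using k \<epsilon> \<alpha>\<beta> by (intro mult_right_mono) auto
    finally show ?thesis by simp
  qed
  have indI: "(indicat_real T has_integral I3) {\<alpha>..\<beta>}"
    unfolding I3_def by (intro integrable_integral) (simp add: integrable_on_indicator Tm)
  show ?thesis
  \<comment> \<open>\<open>exit_estimate\<close> needs \<open>\<delta> \<le> 1\<close>; the other
    bound makes the part of \<open>A\<close> proportional to \<open>\<delta>\<close> at most
    \<open>\<epsilon> / 4\<close>.\<close>
  proof (rule that[of "min 1 (\<epsilon> / (4 * (D + 1)))"])
    show "0 < min 1 (\<epsilon> / (4 * (D + 1)))" using \<epsilon> D by simp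
    fix \<delta> assume \<delta>: "0 < \<delta>" "\<delta> < min 1 (\<epsilon> / (4 * (D + 1)))" and start: "dil c \<delta> (mean \<phi> \<alpha> \<beta>) \<in> \<Omega>0"
    define A where "A = L * \<kappa> + L * C * (R + norm c) * \<delta>"
    have A0: "0 \<le> A" using L C(1) R \<delta> \<kappa> by (simp add: A_def)
    have A: "A \<le> \<epsilon> / 2"
    proof -
      have "D * \<delta> \<le> D * (\<epsilon> / (4 * (D + 1)))" using \<delta> D by (intro mult_left_mono) auto
      also have "\<dots> \<le> \<epsilon> / 4" using D \<epsilon> by (simp add: field_simps)
      finally show ?thesis using L\<kappa> by (simp add: A_def D_def)
    qed
    \<comment> \<open>The three reductions serve the exit points near, the exit points far out, and
      the exceptional set. Their means are at most \<open>\<epsilon> / 2\<close>,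
      \<open>\<epsilon> / 4\<close> and \<open>\<epsilon> / 4\<close>.\<close>
    define h where "h t = g (\<phi> t) - A - 2 * k / R * (norm (\<phi> t) + norm c) - k * indicat_real T t" for t
    have hI: "(h has_integral (integral {\<alpha>..\<beta>} (\<lambda>t. g (\<phi> t)) - (\<beta> - \<alpha>) *\<^sub>R A
        - 2 * k / R * (integral {\<alpha>..\<beta>} (\<lambda>t. norm (\<phi> t)) + (\<beta> - \<alpha>) *\<^sub>R norm c) - k * I3)) {\<alpha>..\<beta>}"
      unfolding h_def using \<alpha>\<beta>
      by (intro has_integral_diff has_integral_mult_right has_integral_add integrable_integral int intg indI)
         (use has_integral_const_real[of A \<alpha> \<beta>] has_integral_const_real[of "norm c" \<alpha> \<beta>] in auto)
    have hint: "h integrable_on {\<alpha>..\<beta>}" using hI by blast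
    have mh: "M - \<epsilon> \<le> mean h \<alpha> \<beta>"
    proof -
      have e1: "integral {\<alpha>..\<beta>} (\<lambda>t. g (\<phi> t)) = (\<beta> - \<alpha>) * M" "integral {\<alpha>..\<beta>} (\<lambda>t. norm (\<phi> t)) = (\<beta> - \<alpha>) * Mn"
        using \<alpha>\<beta> by (simp_all add: M_def Mn_def mean_def)
      have "integral {\<alpha>..\<beta>} h = (\<beta> - \<alpha>) * (M - A - 2 * k / R * (Mn + norm c)) - k * I3"
      proof -
        have "(\<beta> - \<alpha>) * M - (\<beta> - \<alpha>) * A - X * ((\<beta> - \<alpha>) * Mn + (\<beta> - \<alpha>) * norm c) - k * I3
          = (\<beta> - \<alpha>) * (M - A - X * (Mn + norm c)) - k * I3" for X by (simp add: algebra_simps)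
        then show ?thesis unfolding integral_unique[OF hI] e1 real_scaleR_def .
      qed
      also have "\<dots> \<ge> (\<beta> - \<alpha>) * (M - \<epsilon> / 2 - \<epsilon> / 4) - (\<beta> - \<alpha>) * (\<epsilon> / 4)"
        using A Rk I3 \<alpha>\<beta> by (intro diff_mono mult_left_mono) (auto simp: mult.commute)
      also have "(\<beta> - \<alpha>) * (M - \<epsilon> / 2 - \<epsilon> / 4) - (\<beta> - \<alpha>) * (\<epsilon> / 4) = (\<beta> - \<alpha>) * (M - \<epsilon>)"
        by (simp add: field_simps)
      finally have "(\<beta> - \<alpha>) * (M - \<epsilon>) \<le> integral {\<alpha>..\<beta>} h" .
      then have "M - \<epsilon> \<le> integral {\<alpha>..\<beta>} h / (\<beta> - \<alpha>)" using \<alpha>\<beta> by (simp add: le_divide_eq mult.commute)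
      then show ?thesis by (simp add: mean_def divide_inverse mult.commute)
    qed
    have kR: "0 \<le> 2 * k / R * (norm q + norm c)" for q :: 'a using k R by simp
    have "ereal (mean h \<alpha> \<beta>) \<le> G (dil c \<delta> (mean \<phi> \<alpha> \<beta>))"
    proof (rule mean_le_majorant[OF G int(1) hint \<alpha>\<beta> c \<delta>(1) means _ _ start])
      fix v assume v: "dil c \<delta> v \<in> frontier \<Omega>0"
      obtain A0 w where Aw: "\<forall>q\<in>frontier \<Omega>0. g q - A - 2 * k / R * (norm q + norm c) \<le> A0 + w \<bullet> q"
        "A0 + w \<bullet> v \<le> g (dil c \<delta> v)"
        using exit_estimate[OF C _ k lip L R \<delta>(1) _ \<kappa> A_def v] g \<delta>(2) by (metis less_imp_le min_less_iff_conj)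
      have "h y \<le> A0 + w \<bullet> \<phi> y" for y
        using Aw(1) \<phi>[of y] k by (fastforce simp: h_def indicator_def)
      moreover have "ereal (A0 + w \<bullet> v) \<le> G (dil c \<delta> v)"
      proof -
        have "A0 + w \<bullet> v \<le> f (dil c \<delta> v)" using Aw(2) g[OF v] by linarith
        then show ?thesis using majorant_ge_f[OF G v] by (meson ereal_less_eq(3) order_trans)
      qed
      ultimately show "\<exists>A w. (\<forall>y\<in>{\<alpha>..\<beta>}. h y \<le> A + w \<bullet> \<phi> y) \<and> ereal (A + w \<bullet> v) \<le> G (dil c \<delta> v)" by blast
    next
      fix y assume y: "y \<in> {\<alpha>..\<beta>}"
      show "\<exists>d>0. \<forall>s t. \<alpha> \<le> s \<and> s \<le> y \<and> y \<le> t \<and> t \<le> \<beta> \<and> s < t \<and> t - s < d \<longrightarrow>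
        dil c \<delta> (mean \<phi> s t) \<notin> \<Omega>0 \<or> ereal (mean h s t) \<le> G (dil c \<delta> (mean \<phi> s t))"
      proof (cases "y \<in> T")
        case True
        then obtain d where d: "0 < d" "ball y d \<subseteq> T" using T(1) open_contains_ball by blast
        have "ereal (mean h s t) \<le> G (dil c \<delta> (mean \<phi> s t))"
          if st: "\<alpha> \<le> s" "s \<le> y" "y \<le> t" "t \<le> \<beta>" "s < t" "t - s < d" and in0: "dil c \<delta> (mean \<phi> s t) \<in> \<Omega>0" for s t
        proof -
          \<comment> \<open>Inside \<open>T\<close> the truncation \<open>g q \<le> m + k\<close>
            and the reduction by \<open>k\<close> leave at most \<open>m\<close>.\<close>
          have "mean h s t \<le> m + 0 \<bullet> mean \<phi> s t"
          proof (rule mean_le_affine[OF _ _ st(5)])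
            show "\<phi> integrable_on {s..t}" "h integrable_on {s..t}"
              using st by (auto intro: integrable_on_subinterval[OF int(1)] integrable_on_subinterval[OF hint])
            fix z assume z: "z \<in> {s..t}"
            have "z \<in> T" using z st by (intro subsetD[OF d(2)]) (auto simp: dist_real_def)
            then show "h z \<le> m + 0 \<bullet> \<phi> z" using g[OF \<phi>[of z]] A0 kR[of "\<phi> z"] by (simp add: h_def)
          qed
          then have "ereal (mean h s t) \<le> ereal m" by simp
          also have "\<dots> \<le> G (dil c \<delta> (mean \<phi> s t))"
          proof (rule majorant_ge[OF G m in0])
            have "dil c \<delta> (mean \<phi> s t) \<in> far (\<delta> * \<rho>)"
              by (rule dil_far[OF c(1) \<delta>(1) means]) (use st in auto)
            then show "dil c \<delta> (mean \<phi> s t) \<notin> \<Omega>1" using \<delta>(1) c(2) by (force simp: far_def mult_le_0_iff)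
          qed
          finally show ?thesis .
        qed
        then show ?thesis using d(1) by blast
      next
        case False
        have "y \<notin> N" "y \<noteq> \<alpha>" "y \<noteq> \<beta>" using False T(2) by auto
        then have yN: "y \<in> {\<alpha><..<\<beta>} - N" using y by simp
        have "dil c \<delta> (\<phi> y) \<in> - closure \<Omega>0" using dil_notin_closure0[OF c0 \<delta>(1) \<phi>] by simp
        then obtain e where e: "0 < e" "ball (dil c \<delta> (\<phi> y)) e \<subseteq> - closure \<Omega>0"
          using open_contains_ball[of "- closure \<Omega>0"] by (metis closed_closure open_Compl)
        obtain d where d: "0 < d" "\<And>s t. \<alpha> \<le> s \<and> s \<le> y \<and> y \<le> t \<and> t \<le> \<beta> \<and> s < t \<and> t - s < d \<Longrightarrow>
            norm (mean \<phi> s t - \<phi> y) \<le> e / 3"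
          using N(2)[OF yN, of "e / 3"] e(1) by auto
        have "dil c \<delta> (mean \<phi> s t) \<notin> \<Omega>0"
          if st: "\<alpha> \<le> s \<and> s \<le> y \<and> y \<le> t \<and> t \<le> \<beta> \<and> s < t \<and> t - s < d" for s t
        proof -
          have "dil c \<delta> (mean \<phi> s t) - dil c \<delta> (\<phi> y) = (1 + \<delta>) *\<^sub>R (mean \<phi> s t - \<phi> y)"
            by (simp add: dil_def algebra_simps)
          then have "dist (dil c \<delta> (mean \<phi> s t)) (dil c \<delta> (\<phi> y)) = (1 + \<delta>) * norm (mean \<phi> s t - \<phi> y)"
            using \<delta>(1) by (simp add: dist_norm)
          also have "\<dots> \<le> 2 * (e / 3)" using \<delta> d(2)[OF st] by (intro mult_mono) auto
          finally have "dil c \<delta> (mean \<phi> s t) \<in> ball (dil c \<delta> (\<phi> y)) e" using e(1) by (simp add: dist_commute)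
          then show ?thesis using e(2) closure_subset by blast
        qed
        then show ?thesis using d(1) by blast
      qed
    qed
    then show "ereal (mean (\<lambda>t. g (\<phi> t)) \<alpha> \<beta> - \<epsilon>) \<le> G (dil c \<delta> (mean \<phi> \<alpha> \<beta>))"
      using mh unfolding M_def by (meson ereal_less_eq(3) order_trans)
  qed
qed

text \<open>The bound at the dilated point is carried to \<open>x\<close> without any continuity of
  \<open>G\<close>: by concavity between \<open>dil c \<delta> x\<close> and a fixed point
  \<open>z\<close> beyond \<open>x\<close>, where \<open>G\<close> is at least \<open>m\<close>. The
  weight of \<open>z\<close> vanishes with \<open>\<delta>\<close>.\<close>

lemma mean_lipschitz_le_majorant:
  assumes G: "G \<in> loc_concave_majorants (closure \<Omega>0 - \<Omega>1) f"
    and m: "\<And>q. q \<in> frontier \<Omega>0 \<Longrightarrow> m \<le> f q"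
    and g: "\<And>q. q \<in> frontier \<Omega>0 \<Longrightarrow> m \<le> g q \<and> g q \<le> m + k \<and> g q \<le> f q" and k: "0 \<le> k"
    and lip: "\<And>q p. g q \<le> g p + L * dist q p" and L: "0 \<le> L"
    and \<alpha>\<beta>: "\<alpha> < \<beta>" and int: "\<phi> integrable_on {\<alpha>..\<beta>}" "(\<lambda>t. norm (\<phi> t)) integrable_on {\<alpha>..\<beta>}"
    and intg: "(\<lambda>t. g (\<phi> t)) integrable_on {\<alpha>..\<beta>}"
    and \<phi>: "\<And>t. \<phi> t \<in> frontier \<Omega>0"
    and means: "\<And>s t. \<alpha> \<le> s \<Longrightarrow> s < t \<Longrightarrow> t \<le> \<beta> \<Longrightarrow> mean \<phi> s t \<notin> \<Omega>1"
    and x: "x = mean \<phi> \<alpha> \<beta>" "x \<in> \<Omega>0" "x \<notin> closure \<Omega>1"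
  shows "ereal (mean (\<lambda>t. g (\<phi> t)) \<alpha> \<beta>) \<le> G x"
proof (rule ereal_le_epsilon2)
  fix \<epsilon>' :: real assume \<epsilon>': "0 < \<epsilon>'"
  define \<epsilon> where "\<epsilon> = \<epsilon>' / 2"
  have \<epsilon>: "0 < \<epsilon>" using \<epsilon>' by (simp add: \<epsilon>_def)
  define M where "M = mean (\<lambda>t. g (\<phi> t)) \<alpha> \<beta>"
  obtain c where c1: "c \<in> \<Omega>1" using ne1 by auto
  obtain \<rho> where \<rho>: "0 < \<rho>" "ball c \<rho> \<subseteq> \<Omega>1" using open1 c1 open_contains_ball by blast
  have "x \<in> \<Omega>0 - closure \<Omega>1" "open (\<Omega>0 - closure \<Omega>1)" using x open0 by (auto intro: open_Diff)
  then obtain e where e: "0 < e" "cball x e \<subseteq> \<Omega>0 - closure \<Omega>1" using open_contains_cball by blast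
  have cb: "cball x e \<subseteq> closure \<Omega>0 - \<Omega>1" using e(2) closure_subset by blast
  have xc: "0 < dist x c" using x c1 closure_subset by auto
  define t where "t = e / dist x c"
  have t: "0 < t" using e xc by (simp add: t_def)
  define z where "z = x - t *\<^sub>R (x - c)"
  have zx: "z \<in> cball x e" using t xc e by (simp add: z_def t_def dist_norm)
  have "z \<in> \<Omega>0" "z \<notin> \<Omega>1" using zx e(2) closure_subset by blast+
  then have Gz: "ereal m \<le> G z" by (intro majorant_ge[OF G]) (use m in auto)
  obtain \<delta>0 where \<delta>0: "0 < \<delta>0" "\<And>\<delta>. 0 < \<delta> \<Longrightarrow> \<delta> < \<delta>0 \<Longrightarrow> dil c \<delta> x \<in> \<Omega>0 \<Longrightarrow> ereal (M - \<epsilon>) \<le> G (dil c \<delta> x)"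
    using dilated_bound[OF G m g k lip L \<alpha>\<beta> int intg \<phi> means \<rho>(2,1) \<epsilon>] unfolding x(1) M_def by blast
  define K where "K = \<bar>m\<bar> + \<bar>M\<bar> + \<epsilon>"
  have K: "0 < K" using \<epsilon> by (simp add: K_def add_nonneg_pos)
  define \<delta> where "\<delta> = min (\<delta>0 / 2) (min t (t * \<epsilon> / K))"
  have \<delta>: "0 < \<delta>" "\<delta> \<le> \<delta>0 / 2" "\<delta> \<le> t" "\<delta> \<le> t * \<epsilon> / K"
    unfolding \<delta>_def using \<delta>0(1) t \<epsilon> K by (simp, simp only: min.cobounded1, simp_all only: min.coboundedI2 min.cobounded1 min.cobounded2)
  then have \<delta>lt: "\<delta> < \<delta>0" using \<delta>0(1) by simp
  have Sx: "dil c \<delta> x \<in> cball x e"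
  proof -
    have "dist (dil c \<delta> x) x = \<delta> * dist x c" using \<delta> by (simp add: dist_dil)
    also have "\<dots> \<le> t * dist x c" using \<delta> xc by (intro mult_right_mono) auto
    also have "\<dots> = e" using xc by (simp add: t_def)
    finally show ?thesis by (simp add: dist_commute)
  qed
  then have GS: "ereal (M - \<epsilon>) \<le> G (dil c \<delta> x)" using e(2) by (intro \<delta>0(2) \<delta> \<delta>lt) auto
  define s where "s = \<delta> / (\<delta> + t)"
  have s: "0 \<le> s" "s \<le> 1" "s \<le> \<delta> / t" using \<delta> t by (auto simp: s_def intro!: frac_le)
  have xs: "(1 - s) *\<^sub>R dil c \<delta> x + s *\<^sub>R z = x"
  proof -
    have "(1 - s) *\<^sub>R dil c \<delta> x + s *\<^sub>R z = x + ((1 - s) * \<delta> - s * t) *\<^sub>R (x - c)"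
      by (simp add: dil_eq z_def algebra_simps)
    also have "(1 - s) * \<delta> - s * t = 0" using \<delta> t by (simp add: s_def field_simps)
    finally show ?thesis by simp
  qed
  have seg: "closed_segment (dil c \<delta> x) z \<subseteq> closure \<Omega>0 - \<Omega>1"
    by (rule subset_trans[OF closed_segment_subset[OF Sx zx convex_cball] cb])
  have "ereal ((1 - s) * (M - \<epsilon>) + s * m) \<le> G x"
    using majorant_segment[OF G seg GS Gz s(1,2)] unfolding xs .
  moreover have "M - \<epsilon>' \<le> (1 - s) * (M - \<epsilon>) + s * m"
  proof -
    have "s * K \<le> \<delta> / t * K" using s(3) K by (intro mult_right_mono) auto
    also have "\<dots> \<le> (t * \<epsilon> / K) / t * K" using \<delta>(4) t K by (intro mult_right_mono divide_right_mono) auto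
    also have "\<dots> = \<epsilon>" using t K by simp
    finally have "s * K \<le> \<epsilon>" .
    moreover have "s * (- K) \<le> s * (m - M + \<epsilon>)" using s \<epsilon> by (intro mult_left_mono) (auto simp: K_def)
    moreover have "(1 - s) * (M - \<epsilon>) + s * m = M - \<epsilon> + s * (m - M + \<epsilon>)" by (simp add: algebra_simps)
    moreover have "\<epsilon>' = \<epsilon> + \<epsilon>" by (simp add: \<epsilon>_def)
    ultimately show ?thesis by simp
  qed
  ultimately have "ereal (M - \<epsilon>') \<le> G x" by (meson ereal_less_eq(3) order_trans)
  then have "ereal (M - \<epsilon>') + ereal \<epsilon>' \<le> G x + ereal \<epsilon>'" by (rule add_right_mono)
  then show "ereal (mean (\<lambda>t. g (\<phi> t)) \<alpha> \<beta>) \<le> G x + ereal \<epsilon>'" by (simp add: M_def)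
qed

end

text \<open>Monotone convergence for \<open>v\<close>, whose integral may be infinite. Subtracting
  the lower bound \<open>m'\<close> makes all integrands nonnegative; the rest translates the result
  back into the difference of positive and negative parts.\<close>

lemma ext_average_limit_le:
  assumes u: "\<And>k. integrable (lebesgue_on I) (u k)" and E: "0 < measure lebesgue I" "I \<in> lmeasurable"
    and mono: "\<And>t k k'. t \<in> I \<Longrightarrow> k \<le> k' \<Longrightarrow> u k t \<le> u k' t" and lim: "\<And>t. t \<in> I \<Longrightarrow> (\<lambda>k. u k t) \<longlonglongrightarrow> v t"
    and m: "\<And>t k. t \<in> I \<Longrightarrow> m \<le> u k t"
    and le: "\<And>k. ereal ((LINT t|lebesgue_on I. u k t) / measure lebesgue I) \<le> z"
  shows "ext_average I v \<le> z"
proof -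
  let ?M = "lebesgue_on I"
  let ?L = "measure lebesgue I"
  \<comment> \<open>The bound is made nonpositive, so that \<open>- m'\<close> is not truncated by
    \<open>ennreal\<close>.\<close>
  define m' where "m' = min m 0"
  have m': "m' \<le> 0" "\<And>t k. t \<in> I \<Longrightarrow> m' \<le> u k t" using m by (auto simp: m'_def min_le_iff_disj)
  have um[measurable]: "u k \<in> borel_measurable ?M" for k using u[of k] by auto
  have [measurable]: "v \<in> borel_measurable ?M"
    by (rule borel_measurable_LIMSEQ_real[OF _ um]) (use lim in simp)
  have vge: "m' \<le> v t" if "t \<in> I" for t
    by (rule LIMSEQ_le_const[OF lim[OF that]]) (use m'(2)[OF that] in auto)
  have em: "emeasure ?M (space ?M) = ennreal ?L"
    using E(2) by (simp add: emeasure_restrict_space emeasure_eq_measure2)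
  have fm: "finite_measure ?M" by (rule finite_measure_lebesgue_on[OF E(2)])
  define P where "P = (\<integral>\<^sup>+t. ennreal (v t) \<partial>?M)"
  define N where "N = (\<integral>\<^sup>+t. ennreal (- v t) \<partial>?M)"
  define Q where "Q = (\<integral>\<^sup>+t. ennreal (v t - m') \<partial>?M)"
  have N: "N \<le> ennreal (- m') * ennreal ?L"
  proof -
    have "N \<le> (\<integral>\<^sup>+t. ennreal (- m') \<partial>?M)"
      unfolding N_def using vge by (intro nn_integral_mono ennreal_leI) auto
    then show ?thesis using em by (simp add: nn_integral_const)
  qed
  \<comment> \<open>The shift is written additively, by
    \<open>(v - m') + v\<^sup>- = v\<^sup>+ + (- m')\<close>, because \<open>P\<close> and
    \<open>Q\<close> may be infinite.\<close>
  have "Q + N = P + ennreal (- m') * ennreal ?L"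
  proof -
    have "Q + N = (\<integral>\<^sup>+t. ennreal (v t - m') + ennreal (- v t) \<partial>?M)"
      unfolding Q_def N_def by (rule nn_integral_add[symmetric]) auto
    also have "\<dots> = (\<integral>\<^sup>+t. ennreal (v t) + ennreal (- m') \<partial>?M)"
    proof (rule nn_integral_cong)
      fix t assume "t \<in> space ?M"
      then have vt: "m' \<le> v t" using vge by simp
      show "ennreal (v t - m') + ennreal (- v t) = ennreal (v t) + ennreal (- m')"
      proof (cases "0 \<le> v t")
        case True
        then show ?thesis using vt m' by (simp add: ennreal_neg flip: ennreal_plus)
      next
        case False
        then show ?thesis using vt m' by (simp add: ennreal_neg flip: ennreal_plus)
      qed
    qed
    also have "\<dots> = P + ennreal (- m') * ennreal ?L"
      unfolding P_def using em by (subst nn_integral_add) (auto simp: nn_integral_const)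
    finally show ?thesis .
  qed
  then have split: "enn2ereal P - enn2ereal N = enn2ereal Q + ereal (m' * ?L)"
  proof -
    \<comment> \<open>\<open>N\<close> is finite, since the negative part is at most
      \<open>- m'\<close> on a set of finite measure; so it may be subtracted.\<close>
    obtain n where n: "N = ennreal n" "0 \<le> n"
      using N by (cases N) (auto simp: ennreal_mult[symmetric] m'(1) top_unique simp flip: ennreal_mult')
    have c: "ennreal (- m') * ennreal ?L = ennreal (- m' * ?L)" "0 \<le> - m' * ?L"
      using ennreal_mult[of "- m'" ?L] m'(1) E(1) by (simp_all add: mult_le_0_iff)
    have eq: "Q + ennreal n = P + ennreal (- m' * ?L)"
      using \<open>Q + N = P + ennreal (- m') * ennreal ?L\<close> n c by simp
    show ?thesis
    proof (cases Q)
      case top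
      then have "P = top" using eq c(2) by (cases P) (auto simp: ennreal_plus[symmetric] simp del: ennreal_plus)
      then show ?thesis using top n by (simp add: enn2ereal_ennreal)
    next
      case (real q)
      then have "P + ennreal (- m' * ?L) = ennreal (q + n)" using eq n by (simp add: ennreal_plus)
      then obtain p where p: "P = ennreal p" "0 \<le> p" by (cases P) auto
      have "ennreal (q + n) = ennreal (p - m' * ?L)"
        using \<open>P + ennreal (- m' * ?L) = ennreal (q + n)\<close> p c(2) by (simp flip: ennreal_plus)
      then have "q + n = p - m' * ?L" using real n p c(2) by (subst (asm) ennreal_inj) auto
      then show ?thesis using real n p by (simp add: enn2ereal_ennreal)
    qed
  qed
  have Qsup: "Q = (SUP k. \<integral>\<^sup>+t. ennreal (u k t - m') \<partial>?M)"
  proof -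
    have "Q = (\<integral>\<^sup>+t. (SUP k. ennreal (u k t - m')) \<partial>?M)"
      unfolding Q_def
    proof (rule nn_integral_cong)
      fix t assume "t \<in> space ?M"
      then have t: "t \<in> I" by simp
      have "(\<lambda>k. ennreal (u k t - m')) \<longlonglongrightarrow> ennreal (v t - m')"
        by (intro tendsto_ennrealI tendsto_intros lim t)
      moreover have "incseq (\<lambda>k. ennreal (u k t - m'))"
        by (intro monoI ennreal_leI) (use mono[OF t] in auto)
      ultimately show "ennreal (v t - m') = (SUP k. ennreal (u k t - m'))"
        using LIMSEQ_SUP LIMSEQ_unique by blast
    qed
    also have "\<dots> = (SUP k. \<integral>\<^sup>+t. ennreal (u k t - m') \<partial>?M)"
    proof (rule nn_integral_monotone_convergence_SUP_AE)
      show "AE t in ?M. ennreal (u k t - m') \<le> ennreal (u (Suc k) t - m')" for k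
        by (rule AE_I2) (use mono[of _ k "Suc k"] in \<open>auto intro!: ennreal_leI\<close>)
    qed auto
    finally show ?thesis .
  qed
  show ?thesis
  proof (cases z)
    case PInf
    then show ?thesis by simp
  next
    case MInf
    then show ?thesis using le[of 0] by simp
  next
    case (real r)
    have uk: "(\<integral>\<^sup>+t. ennreal (u k t - m') \<partial>?M) \<le> ennreal (r * ?L - m' * ?L)" for k
    proof -
      have i: "integrable ?M (\<lambda>t. u k t - m')"
        using u[of k] finite_measure.integrable_const[OF fm] by (rule Bochner_Integration.integrable_diff)
      have "(\<integral>\<^sup>+t. ennreal (u k t - m') \<partial>?M) = ennreal (LINT t|?M. u k t - m')"
        by (rule nn_integral_eq_integral[OF i]) (use m'(2) in \<open>auto intro!: AE_I2\<close>)
      also have "(LINT t|?M. u k t - m') = (LINT t|?M. u k t) - m' * ?L"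
        using u[of k] finite_measure.integrable_const[OF fm] E(2)
        by (subst Bochner_Integration.integral_diff) (auto simp: measure_restrict_space mult.commute)
      also have "\<dots> \<le> r * ?L - m' * ?L"
        using le[of k] E(1) by (simp add: real divide_le_eq)
      finally show ?thesis by (simp add: ennreal_leI)
    qed
    have ge0: "0 \<le> r * ?L - m' * ?L"
    proof -
      have "m' * ?L = (LINT t|?M. m')" using E(2) by (simp add: measure_restrict_space mult.commute)
      also have "\<dots> \<le> (LINT t|?M. u 0 t)"
        by (rule integral_mono[OF finite_measure.integrable_const[OF fm] u]) (use m'(2) in auto)
      also have "\<dots> \<le> r * ?L" using le[of 0] E(1) by (simp add: real divide_le_eq)
      finally show ?thesis by simp
    qed
    have "Q \<le> ennreal (r * ?L - m' * ?L)" unfolding Qsup by (rule SUP_least) (rule uk)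
    then obtain q where q: "Q = ennreal q" "0 \<le> q" "q \<le> r * ?L - m' * ?L"
      using ge0 by (cases Q) (auto simp: top_unique)
    have "ext_average I v = (ereal q + ereal (m' * ?L)) / ereal ?L"
      unfolding ext_average_def using split q by (simp add: P_def N_def enn2ereal_ennreal)
    also have "\<dots> = ereal ((q + m' * ?L) / ?L)" using E(1) by simp
    also have "\<dots> \<le> ereal r" using q(3) E(1) by (simp add: divide_le_eq)
    finally show ?thesis using real by simp
  qed
qed

context convex_annulus
begin

text \<open>The supporting functional at \<open>x\<close> is nonnegative along \<open>\<phi>\<close>
  and has integral \<open>0\<close>, so it vanishes almost everywhere; by strict convexity
  \<open>\<phi> = x\<close> there.\<close>

lemma ext_average_boundary_point:
  assumes I: "I \<in> lmeasurable" "0 < measure lebesgue I"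
    and \<phi>: "integrable (lebesgue_on I) \<phi>" "\<And>t. t \<in> I \<Longrightarrow> \<phi> t \<in> frontier \<Omega>0"
    and x: "average I \<phi> = x" "x \<in> frontier \<Omega>0"
  shows "ext_average I (\<lambda>t. f (\<phi> t)) = ereal (f x)"
proof -
  have fm: "finite_measure (lebesgue_on I)" by (rule finite_measure_lebesgue_on[OF I(1)])
  obtain w where w: "norm w = 1" "\<And>y. y \<in> closure \<Omega>0 \<Longrightarrow> 0 \<le> w \<bullet> (y - x)"
    using frontier_supporting_hyperplane[OF open0 convex0 x(2)] by blast
  have ix: "integrable (lebesgue_on I) (\<lambda>t. x)" by (rule finite_measure.integrable_const[OF fm])
  have int: "integrable (lebesgue_on I) (\<lambda>t. w \<bullet> (\<phi> t - x))"
    by (intro integrable_inner_right Bochner_Integration.integrable_diff \<phi>(1) ix)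
  have Lx: "(LINT t|lebesgue_on I. \<phi> t) = measure lebesgue I *\<^sub>R x"
    using x(1) I(2) unfolding average_def by (metis divideR_right less_irrefl scaleR_one inverse_eq_divide)
  have "(LINT t|lebesgue_on I. w \<bullet> (\<phi> t - x)) = w \<bullet> (LINT t|lebesgue_on I. \<phi> t - x)"
    using \<phi>(1) ix by (intro integral_inner_right) auto
  also have "(LINT t|lebesgue_on I. \<phi> t - x) = 0"
    using \<phi>(1) ix I(1) by (simp add: Lx measure_restrict_space)
  finally have z: "(LINT t|lebesgue_on I. w \<bullet> (\<phi> t - x)) = 0" by simp
  have nn: "AE t in lebesgue_on I. 0 \<le> w \<bullet> (\<phi> t - x)"
    by (rule AE_I2) (use w(2) \<phi>(2) frontier0_iff in auto)
  have "AE t in lebesgue_on I. w \<bullet> (\<phi> t - x) = 0"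
    using integral_nonneg_eq_0_iff_AE[OF int nn] z by simp
  then have ae: "AE t in lebesgue_on I. \<phi> t = x"
  proof (rule AE_mp)
    show "AE t in lebesgue_on I. w \<bullet> (\<phi> t - x) = 0 \<longrightarrow> \<phi> t = x"
    proof (rule AE_I2, rule impI)
      fix t assume "t \<in> space (lebesgue_on I)" "w \<bullet> (\<phi> t - x) = 0"
      then show "\<phi> t = x"
        using strictly_supported_point_unique[OF open0 convex0 strict0, of w x "\<phi> t"] w \<phi>(2)[of t] x(2)
          closure_subset[of \<Omega>0] frontier0_iff by force
    qed
  qed
  have "ext_average I (\<lambda>t. f (\<phi> t)) = ext_average I (\<lambda>t. f x)"
  proof -
    have "(\<integral>\<^sup>+t. ennreal (f (\<phi> t)) \<partial>lebesgue_on I) = (\<integral>\<^sup>+t. ennreal (f x) \<partial>lebesgue_on I)"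
      "(\<integral>\<^sup>+t. ennreal (- f (\<phi> t)) \<partial>lebesgue_on I) = (\<integral>\<^sup>+t. ennreal (- f x) \<partial>lebesgue_on I)"
      by (rule nn_integral_cong_AE, use ae in eventually_elim, simp)+
    then show ?thesis by (simp add: ext_average_def)
  qed
  also have "\<dots> = ereal (f x)"
    using ext_average_integrable[OF finite_measure.integrable_const[OF fm] I(2)] I
    by (simp add: measure_restrict_space)
  finally show ?thesis .
qed

lemma ext_average_le_majorant:
  assumes G: "G \<in> loc_concave_majorants (closure \<Omega>0 - \<Omega>1) f"
    and lsc: "lsc_on (frontier \<Omega>0) f" and m: "\<And>q. q \<in> frontier \<Omega>0 \<Longrightarrow> m \<le> f q"
    and I: "nondegenerate_interval I" and \<phi>: "\<phi> \<in> admissible \<Omega>0 \<Omega>1 I"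
    and x: "average I \<phi> = x" "x \<in> closure \<Omega>0 - closure \<Omega>1"
  shows "ext_average I (\<lambda>t. f (\<phi> t)) \<le> G x"
proof -
  obtain \<alpha> \<beta> where ab: "\<alpha> < \<beta>" "{\<alpha><..<\<beta>} \<subseteq> I" "I \<subseteq> {\<alpha>..\<beta>}" using nondegenerate_interval_bounds[OF I] by blast
  have \<phi>F: "\<phi> t \<in> frontier \<Omega>0" if "t \<in> I" for t using \<phi> that by (auto simp: admissible_def)
  have \<phi>int: "integrable (lebesgue_on I) \<phi>" using \<phi> by (simp add: admissible_def)
  have \<phi>avg: "average J \<phi> \<notin> \<Omega>1" if "nondegenerate_interval J" "J \<subseteq> I" for J
    using \<phi> that by (simp add: admissible_def)
  have IL: "measure lebesgue I = \<beta> - \<alpha>" "0 < measure lebesgue I" using interval_measurable(2)[OF ab] ab(1) by auto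
  have Ilm: "I \<in> lmeasurable"
    using interval_measurable(1)[OF ab] I by (intro bounded_set_imp_lmeasurable) (auto simp: nondegenerate_interval_def)
  show ?thesis
  proof (cases "x \<in> \<Omega>0")
    case False
    then have xF: "x \<in> frontier \<Omega>0" using x frontier0_iff by auto
    have "ext_average I (\<lambda>t. f (\<phi> t)) = ereal (f x)"
      by (rule ext_average_boundary_point[OF Ilm IL(2) \<phi>int _ x(1) xF]) (rule \<phi>F)
    then show ?thesis using majorant_ge_f[OF G xF] by simp
  next
    case True
    obtain p0 where p0: "p0 \<in> frontier \<Omega>0" using frontier0_nonempty by auto
    \<comment> \<open>Outside \<open>I\<close>, possibly at its end points, \<open>\<phi>\<close> is
      arbitrary; \<open>\<psi>\<close> takes values in the outer boundary everywhere.\<close>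
    define \<psi> where "\<psi> t = (if t \<in> I then \<phi> t else p0)" for t
    have \<psi>F: "\<psi> t \<in> frontier \<Omega>0" for t using \<phi>F p0 by (simp add: \<psi>_def)
    have \<psi>int: "integrable (lebesgue_on I) \<psi>"
      using \<phi>int by (rule Bochner_Integration.integrable_cong[THEN iffD1, rotated 2]) (auto simp: \<psi>_def)
    then have \<psi>abs: "\<psi> absolutely_integrable_on {\<alpha>..\<beta>}" using integrable_on_interval[OF ab] by blast
    then have int: "\<psi> integrable_on {\<alpha>..\<beta>}" "(\<lambda>t. norm (\<psi> t)) integrable_on {\<alpha>..\<beta>}"
      unfolding absolutely_integrable_on_def by auto
    have avg: "average J \<phi> = average J \<psi>" if "J \<subseteq> I" "J \<in> sets lebesgue" for J
    proof -
      have "(LINT t|lebesgue_on J. \<phi> t) = (LINT t|lebesgue_on J. \<psi> t)"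
        by (rule Bochner_Integration.integral_cong) (use that in \<open>auto simp: \<psi>_def\<close>)
      then show ?thesis by (simp add: average_def)
    qed
    have means: "mean \<psi> s t \<notin> \<Omega>1" if st: "\<alpha> \<le> s" "s < t" "t \<le> \<beta>" for s t
    proof -
      have J: "{s<..<t} \<subseteq> I" using ab(2) st by force
      have nd: "nondegenerate_interval {s<..<t}" using st by (simp add: nondegenerate_interval_def is_interval_oo)
      have "\<psi> absolutely_integrable_on {s..t}"
        using \<psi>abs by (rule set_integrable_subset) (use st in auto)
      then have i: "integrable (lebesgue_on {s<..<t}) \<psi>"
        using integrable_on_interval[OF st(2), of "{s<..<t}" \<psi>] by (simp add: greaterThanLessThan_subseteq_atLeastAtMost_iff)
      have "average {s<..<t} \<phi> = mean \<psi> s t"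
        using avg[OF J] average_interval[OF st(2) _ _ i] by (simp add: mean_def greaterThanLessThan_subseteq_atLeastAtMost_iff)
      then show ?thesis using \<phi>avg[OF nd J] by simp
    qed
    have xm: "x = mean \<psi> \<alpha> \<beta>"
      using x(1) avg[OF order_refl interval_measurable(1)[OF ab]] average_interval[OF ab \<psi>int] by (simp add: mean_def)
    \<comment> \<open>One index \<open>k\<close> is both the Lipschitz constant and the height of
      the truncation, so the minorants increase with it and satisfy \<open>m \<le> g k q\<close> and
      \<open>g k q \<le> m + real k\<close> on the outer boundary.\<close>
    define g where "g = lip_minorant (frontier \<Omega>0) f m"
    have g_ge: "m \<le> g k q" for k q
      unfolding g_def by (rule lip_minorant_ge[OF frontier0_nonempty]) (rule m)
    have g_le: "g k q \<le> min (f q) (m + real k)" if "q \<in> frontier \<Omega>0" for k q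
      unfolding g_def by (rule lip_minorant_le[OF frontier0_nonempty _ that]) (rule m)
    have g_lip: "g k q \<le> g k p + real k * dist q p" for k q p
      unfolding g_def by (rule lip_minorant_lipschitz[OF frontier0_nonempty]) (rule m)
    have g_cont: "continuous_on UNIV (g k)" for k
      unfolding g_def by (rule lip_minorant_continuous[OF frontier0_nonempty]) (rule m)
    have g_mono: "g k q \<le> g k' q" if "k \<le> k'" for k k' q
      unfolding g_def by (rule lip_minorant_mono[OF frontier0_nonempty _ that]) (rule m)
    have g_lim: "(\<lambda>k. g k q) \<longlonglongrightarrow> f q" if "q \<in> frontier \<Omega>0" for q
      unfolding g_def by (rule lip_minorant_tendsto[OF frontier0_nonempty _ lsc that]) (rule m)
    have gint: "integrable (lebesgue_on I) (\<lambda>t. g k (\<psi> t))" for k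
    proof (rule finite_measure.integrable_const_bound[OF finite_measure_lebesgue_on[OF Ilm]])
      show "AE t in lebesgue_on I. norm (g k (\<psi> t)) \<le> \<bar>m\<bar> + real k"
      proof (rule AE_I2)
        fix t
        show "norm (g k (\<psi> t)) \<le> \<bar>m\<bar> + real k" using g_ge[of k "\<psi> t"] g_le[OF \<psi>F, of k t] by auto
      qed
      show "(\<lambda>t. g k (\<psi> t)) \<in> borel_measurable (lebesgue_on I)"
        using \<psi>int by (intro borel_measurable_continuous_on[OF g_cont]) auto
    qed
    show ?thesis
    proof (rule ext_average_limit_le[where u = "\<lambda>k t. g k (\<psi> t)" and m = m])
      show "(\<lambda>k. g k (\<psi> t)) \<longlonglongrightarrow> f (\<phi> t)" if "t \<in> I" for t
        using g_lim[OF \<psi>F[of t]] that by (simp add: \<psi>_def)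
      fix k
      have gabs: "(\<lambda>t. g k (\<psi> t)) absolutely_integrable_on {\<alpha>..\<beta>}" using integrable_on_interval[OF ab] gint by blast
      have "(LINT t|lebesgue_on I. g k (\<psi> t)) / measure lebesgue I = mean (\<lambda>t. g k (\<psi> t)) \<alpha> \<beta>"
        using average_interval[OF ab gint[of k]] by (simp add: average_def mean_def)
      also have "ereal (mean (\<lambda>t. g k (\<psi> t)) \<alpha> \<beta>) \<le> G x"
      proof (rule mean_lipschitz_le_majorant[OF G _ _ _ _ _ ab(1) int _ \<psi>F means xm True])
        show "m \<le> f q" if "q \<in> frontier \<Omega>0" for q using m that .
        show "m \<le> g k q \<and> g k q \<le> m + real k \<and> g k q \<le> f q" if "q \<in> frontier \<Omega>0" for q
          using g_ge[of k q] g_le[OF that, of k] by simp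
        show "g k q \<le> g k p + real k * dist q p" for q p by (rule g_lip)
        show "(\<lambda>t. g k (\<psi> t)) integrable_on {\<alpha>..\<beta>}" using gabs by (simp add: absolutely_integrable_on_def)
      qed (use x in auto)
      finally show "ereal ((LINT t|lebesgue_on I. g k (\<psi> t)) / measure lebesgue I) \<le> G x" .
    qed (use gint IL Ilm g_mono g_ge in auto)
  qed
qed

end

theorem theorem4p4:
  fixes \<Omega>0 \<Omega>1 :: "'a::euclidean_space set"
    and f :: "'a \<Rightarrow> real"
    and I :: "real set"
    and x :: 'a
  assumes "DIM('a) \<ge> 2"
    and "\<Omega>0 \<noteq> {}" and "open \<Omega>0" and "convex \<Omega>0" and "\<Omega>0 \<noteq> UNIV"
    and "\<Omega>1 \<noteq> {}" and "open \<Omega>1" and "convex \<Omega>1"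
    and "closure \<Omega>1 \<subseteq> \<Omega>0"
    and "no_segments (frontier \<Omega>0)" and "no_segments (frontier \<Omega>1)"
    and "cone_condition \<Omega>0 \<Omega>1"
    and "C2_hypersurface (frontier \<Omega>1)"
    and "locally_bounded_on (frontier \<Omega>0) f"
    and "lsc_on (frontier \<Omega>0) f"
    and "bdd_below (f ` frontier \<Omega>0)"
    and "nondegenerate_interval I"
    and "x \<in> closure \<Omega>0 - closure \<Omega>1"
  shows "Bellman \<Omega>0 \<Omega>1 I f x = min_locally_concave (closure \<Omega>0 - \<Omega>1) f x"
proof -
  interpret convex_annulus \<Omega>0 \<Omega>1 using assms by unfold_locales
  obtain m where m: "\<And>q. q \<in> frontier \<Omega>0 \<Longrightarrow> m \<le> f q"
    using assms(16) unfolding bdd_below_def by auto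
  show ?thesis
  proof (rule antisym)
    show "Bellman \<Omega>0 \<Omega>1 I f x \<le> min_locally_concave (closure \<Omega>0 - \<Omega>1) f x"
      unfolding Bellman_def min_locally_concave_def
    proof (intro SUP_least INF_greatest)
      fix \<phi> G assume "\<phi> \<in> {\<phi> \<in> admissible \<Omega>0 \<Omega>1 I. average I \<phi> = x}"
        and G: "G \<in> loc_concave_majorants (closure \<Omega>0 - \<Omega>1) f"
      then have \<phi>: "\<phi> \<in> admissible \<Omega>0 \<Omega>1 I" "average I \<phi> = x" by auto
      show "ext_average I (\<lambda>t. f (\<phi> t)) \<le> G x"
        by (rule ext_average_le_majorant[OF G assms(15) _ assms(17) \<phi> assms(18)]) (rule m)
    qed
    show "min_locally_concave (closure \<Omega>0 - \<Omega>1) f x \<le> Bellman \<Omega>0 \<Omega>1 I f x"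
      by (rule min_locally_concave_le_Bellman[OF assms(15) _ assms(18,17)]) (rule m)
  qed
qed

end
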